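(* Let $p$ be a prime, $n\geqslant 1$, let $\mathcal{I}$ be a nonzero proper monomial ideal of $\mathbf{Z}_p[x_1,\ldots,x_n]$, and let $g\in\mathbf{Z}_p[x_1,\ldots,x_n]$ be a nonzero polynomial with $g(0)=0$ that is non-degenerated over $\mathbf{F}_p$ with respect to all the faces of its Newton polyhedron $\Gamma_g$. For $s\in\mathbf{C}$ with $\Re(s)>0$ put $$Z_{\mathcal{I},gdx}(s)=\int_{\mathbf{Z}_p^n}|\mathcal{I}(x)|^s|g(x)||dx|.$$ Then $$Z_{\mathcal{I},gdx}(s)=\sum_{\delta\in\Delta_{\mathcal{I},g}}L_\delta S_\delta,$$ where, for every cone $\delta\in\Delta_{\mathcal{I},g}$, $$L_\delta=p^{-n}\left((p-1)^n-N_\delta\frac{p}{p+1}\right)\qquad\text{and}\qquad S_\delta=\sum_{k\in\mathbf{Z}_{\geqslant0}^n\cap\delta}p^{-m_{\mathcal{I}}(k)s-m_g(k)-\sigma(k)}.$$ Moreover, for each $\delta\in\Delta_{\mathcal{I},g}$, given a partition of $\delta$ into rational simplicial cones $\delta_i$, $i\in I$, without introducing new rays, where $\delta_i$ is the cone strictly positively spanned by the linearly independent primitive vectors $k_{i,1},\ldots,k_{i,r_i}\in\mathbf{Z}_{\geqslant0}^n\setminus\{0\}$, one has $$S_\delta=\sum_{i\in I}\frac{\sum_h p^{m_{\mathcal{I}}(h)s+m_g(h)+\sigma(h)}}{\prod_{j=1}^{r_i}\left(p^{m_{\mathcal{I}}(k_{i,j})s+m_g(k_{i,j})+\sigma(k_{i,j})}-1\right)},$$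 where $h$ runs through the elements of the set $\mathbf{Z}^n\cap\left\{\sum_{j=1}^{r_i}\lambda_jk_{i,j}\mid 0\leqslant\lambda_j<1\text{ for }j=1,\ldots,r_i\right\}$. Consequently, the real parts of the candidate poles of (the meromorphic continuation to $\mathbf{C}$ of) $Z_{\mathcal{I},gdx}$ are given by the rational numbers $$-\frac{m_g(k)+\sigma(k)}{m_{\mathcal{I}}(k)},$$ for $k$ a primitive generator of a ray in $\Delta_{\mathcal{I},g}$ with $m_{\mathcal{I}}(k)\neq0$; that is, the real part of every pole is one of these numbers.
   Context: $|\cdot|$ is the $p$-adic norm on $\mathbf{Q}_p$ (with $|p|=p^{-1}$), $|dx|$ is the Haar measure on $\mathbf{Q}_p^n$ normalized so that $\mathbf{Z}_p^n$ has measure one, and $|\mathcal{I}(x)|=\max\{|f(x)|\mid f\in\mathcal{I}\}$. A monomial ideal is an ideal that can be generated by monic monomials $x^\omega=x_1^{\omega_1}\cdots x_n^{\omega_n}$, $\omega\in\mathbf{Z}_{\geqslant0}^n$. A bar denotes reduction of coefficients modulo $p\mathbf{Z}_p$. Newton polyhedra: for a nonzero polynomial $g=\sum_\omega b_\omega x^\omega$ over $\mathbf{Z}_p$ with $g(0)=0$, $\Gamma_g$ is the convex hull of $\bigcup_{\omega:\,b_\omega\neq0}(\omega+\mathbf{R}_{\geqslant0}^n)$; $\Gamma_{\mathcal{I}}$ is the convex hull of $\{\omega\in\mathbf{Z}_{\geqslant0}^n\mid x^\omega\in\mathcal{I}\}$. A face of a polyhedron $\Gamma$ is $\Gamma$ itself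 or the intersection of $\Gamma$ with a supporting hyperplane. For a face $\tau'$ of $\Gamma_g$ put $g_{\tau'}=\sum_{\omega\in\tau'}b_\omega x^\omega$. The polynomial $g$ is non-degenerated over $\mathbf{F}_p$ with respect to (all the faces of) $\Gamma_g$ if for every face $\tau'$ of $\Gamma_g$ (including $\Gamma_g$ itself) there is no $a\in(\mathbf{F}_p^\times)^n$ with $\overline{g_{\tau'}}(a)=0$ and $\frac{\partial\overline{g_{\tau'}}}{\partial x_i}(a)=0$ for $i=1,\ldots,n$. For $k\in\mathbf{R}_{\geqslant0}^n$ put $m_{\mathcal{I}}(k)=\inf_{x\in\Gamma_{\mathcal{I}}}k\cdot x$, $m_g(k)=\inf_{x\in\Gamma_g}k\cdot x$, $F_{\mathcal{I}}(k)=\{x\in\Gamma_{\mathcal{I}}\mid k\cdot x=m_{\mathcal{I}}(k)\}$, $F_g(k)=\{x\in\Gamma_g\mid k\cdot x=m_g(k)\}$ and $\sigma(k)=k_1+\cdots+k_n$. For faces $\tau$ of $\Gamma_{\mathcal{I}}$ and $\tau'$ of $\Gamma_g$ put $\Delta_{\mathcal{I}}(\tau)=\{k\in\mathbf{R}_{\geqslant0}^n\mid F_{\mathcal{I}}(k)=\tau\}$ and $\Delta_g(\tau')=\{k\in\mathbf{R}_{\geqslant0}^n\mid F_g(k)=\tau'\}$. The partition $\Delta_{\mathcal{I},g}$ of $\mathbf{R}_{\geqslant0}^n$ is the set of all nonempty intersections $\delta=\Delta_{\mathcal{I}}(\tau)\cap\Delta_g(\tau')$. Each $\delta\in\Delta_{\mathcal{I},g}$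 determines $\tau$ and $\tau'$ uniquely; put $g_\delta=g_{\tau'}$ and $N_\delta=\#\{a\in(\mathbf{F}_p^\times)^n\mid\overline{g_\delta}(a)=0\}$. Cones: the cone strictly positively spanned by $k_1,\ldots,k_r$ is $\{\lambda_1k_1+\cdots+\lambda_rk_r\mid\lambda_i>0\}$ (equal to $\{0\}$ if $r=0$). It is rational if the spanning vectors can be chosen in $\mathbf{Z}^n$, and simplicial if they can be chosen linearly independent over $\mathbf{R}$. A vector is primitive if its components are integers with greatest common divisor one. A ray is a cone of dimension one. Each $\delta\in\Delta_{\mathcal{I},g}$ is a rational cone strictly positively spanned by the primitive generators of the one-dimensional faces of its closure (which give rays in $\Delta_{\mathcal{I},g}$); a partition of $\delta$ into simplicial cones is without introducing new rays if each of its cones is strictly positively spanned by a linearly independent subset of these generators. For $\delta=\{0\}$ the trivial partition ($r=0$, $h=0$, empty product equal to $1$) is used. *)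

theory Defs
  imports
    "HOL-Complex_Analysis.Complex_Analysis"
    "HOL-Library.Poly_Mapping"
    "HOL-Computational_Algebra.Fraction_Field"
    "Berlekamp_Zassenhaus.Finite_Field"
begin

section \<open>The ring of p-adic integers\<close>

text \<open>
  The prime is the cardinality of a type of class \<^class>\<open>prime_card\<close>; the field with
  \<open>p\<close> elements is then the library type \<open>'p mod_ring\<close>.  The ring of \<open>p\<close>-adic integers is
  the inverse limit of the rings of integers modulo \<open>p ^ k\<close>: the \<open>k\<close>-th entry of a sequence
  is the representative in \<open>{0..<p ^ k}\<close> of the class modulo \<open>p ^ k\<close>.
\<close>

typedef (overloaded) 'p padic_int =
  "{x :: nat \<Rightarrow> int. \<forall>k. x k = x (Suc k) mod int CARD('p::prime_card) ^ k}"
  by (rule exI[of _ "\<lambda>_. 0"]) simp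

setup_lifting type_definition_padic_int

lemma mod_power_Suc_mod: "(a mod (q::int) ^ Suc k) mod q ^ k = a mod q ^ k"
  by (rule mod_mod_cancel) (simp add: le_imp_power_dvd)

lemma coherent_mod:
  fixes x y :: "nat \<Rightarrow> int"
  assumes "\<forall>k. x k = x (Suc k) mod q ^ k" "\<forall>k. y k = y (Suc k) mod q ^ k"
  shows "(x k + y k) mod q ^ k = ((x (Suc k) + y (Suc k)) mod q ^ Suc k) mod q ^ k"
    and "(x k - y k) mod q ^ k = ((x (Suc k) - y (Suc k)) mod q ^ Suc k) mod q ^ k"
    and "(x k * y k) mod q ^ k = ((x (Suc k) * y (Suc k)) mod q ^ Suc k) mod q ^ k"
    and "(- x k) mod q ^ k = ((- x (Suc k)) mod q ^ Suc k) mod q ^ k"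
proof -
  have "x k = x (Suc k) mod q ^ k" "y k = y (Suc k) mod q ^ k"
    using assms by blast+
  then show "(x k + y k) mod q ^ k = ((x (Suc k) + y (Suc k)) mod q ^ Suc k) mod q ^ k"
    "(x k - y k) mod q ^ k = ((x (Suc k) - y (Suc k)) mod q ^ Suc k) mod q ^ k"
    "(x k * y k) mod q ^ k = ((x (Suc k) * y (Suc k)) mod q ^ Suc k) mod q ^ k"
    "(- x k) mod q ^ k = ((- x (Suc k)) mod q ^ Suc k) mod q ^ k"
    unfolding mod_power_Suc_mod
    by (simp_all only: mod_add_eq mod_diff_eq mod_mult_eq mod_minus_eq)
qed

instantiation padic_int :: (prime_card) comm_ring_1
begin

lift_definition zero_padic_int :: "'a padic_int" is "\<lambda>_. 0" by simp

lift_definition one_padic_int :: "'a padic_int" is "\<lambda>k. 1 mod int CARD('a) ^ k"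
  by (simp add: mod_power_Suc_mod del: power_Suc)

lift_definition plus_padic_int :: "'a padic_int \<Rightarrow> 'a padic_int \<Rightarrow> 'a padic_int"
  is "\<lambda>x y k. (x k + y k) mod int CARD('a) ^ k"
  by (intro allI coherent_mod)

lift_definition uminus_padic_int :: "'a padic_int \<Rightarrow> 'a padic_int"
  is "\<lambda>x k. (- x k) mod int CARD('a) ^ k"
  by (intro allI coherent_mod)

lift_definition minus_padic_int :: "'a padic_int \<Rightarrow> 'a padic_int \<Rightarrow> 'a padic_int"
  is "\<lambda>x y k. (x k - y k) mod int CARD('a) ^ k"
  by (intro allI coherent_mod)

lift_definition times_padic_int :: "'a padic_int \<Rightarrow> 'a padic_int \<Rightarrow> 'a padic_int"
  is "\<lambda>x y k. (x k * y k) mod int CARD('a) ^ k"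
  by (intro allI coherent_mod)

lemmas padic_int_rep_eqs =
  zero_padic_int.rep_eq one_padic_int.rep_eq plus_padic_int.rep_eq uminus_padic_int.rep_eq
  minus_padic_int.rep_eq times_padic_int.rep_eq

instance
proof
  have Rep: "Rep_padic_int x k mod int CARD('a) ^ k = Rep_padic_int x k" for x :: "'a padic_int" and k
  proof -
    have "Rep_padic_int x k = Rep_padic_int x (Suc k) mod int CARD('a) ^ k"
      using Rep_padic_int[of x] by blast
    then show ?thesis by (metis mod_mod_trivial)
  qed
  have eqI: "x = y" if "\<And>k. Rep_padic_int x k = Rep_padic_int y k" for x y :: "'a padic_int"
    using that by (metis Rep_padic_int_inject ext)
  fix a b c :: "'a padic_int"
  show "a * b * c = a * (b * c)"
    by (rule eqI) (simp add: padic_int_rep_eqs mod_simps mult.assoc)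
  show "a * b = b * a"
    by (rule eqI) (simp add: padic_int_rep_eqs mult.commute)
  show "1 * a = a"
    by (rule eqI) (simp add: padic_int_rep_eqs mod_simps Rep)
  show "a + b + c = a + (b + c)"
    by (rule eqI) (simp add: padic_int_rep_eqs mod_simps add.assoc)
  show "a + b = b + a"
    by (rule eqI) (simp add: padic_int_rep_eqs add.commute)
  show "0 + a = a"
    by (rule eqI) (simp add: padic_int_rep_eqs Rep)
  show "- a + a = 0"
    by (rule eqI) (simp add: padic_int_rep_eqs mod_simps)
  show "a - b = a + - b"
    by (rule eqI) (simp add: padic_int_rep_eqs mod_simps)
  show "(a + b) * c = a * c + b * c"
    by (rule eqI) (simp add: padic_int_rep_eqs mod_simps distrib_right)
  show "(0::'a padic_int) \<noteq> 1"
  proof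
    assume "(0::'a padic_int) = 1"
    then have "Rep_padic_int (0::'a padic_int) 1 = Rep_padic_int 1 1" by simp
    then show False
      using prime_gt_1_nat[OF prime_card[where 'a='a]] by (simp add: padic_int_rep_eqs)
  qed
qed

end

text \<open>The residue map onto the field with \<open>p\<close> elements, i.e. reduction modulo \<open>p\<close>.\<close>

definition residue_mod_p :: "'p::prime_card padic_int \<Rightarrow> 'p mod_ring" where
  "residue_mod_p x = of_int (Rep_padic_int x 1)"

text \<open>For \<open>x \<noteq> 0\<close> this is the exponent of the largest power of \<open>p\<close> dividing \<open>x\<close>.\<close>

definition padic_int_val :: "'p::prime_card padic_int \<Rightarrow> nat" where
  "padic_int_val x = (LEAST k. Rep_padic_int x (Suc k) \<noteq> 0)"

definition padic_int_abs :: "'p::prime_card padic_int \<Rightarrow> real" where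
  "padic_int_abs x = (if x = 0 then 0 else inverse (real CARD('p) ^ padic_int_val x))"

lemma Rep_padic_int_mod:
  fixes x :: "'p::prime_card padic_int"
  assumes "k \<le> m"
  shows "Rep_padic_int x m mod int CARD('p) ^ k = Rep_padic_int x k"
  using assms
proof (induction m rule: dec_induct)
  case base
  have "Rep_padic_int x k = Rep_padic_int x (Suc k) mod int CARD('p) ^ k"
    using Rep_padic_int[of x] by blast
  then show ?case by (metis mod_mod_trivial)
next
  case (step m)
  have "Rep_padic_int x m = Rep_padic_int x (Suc m) mod int CARD('p) ^ m"
    using Rep_padic_int[of x] by blast
  then show ?case
    using step by (metis le_imp_power_dvd mod_mod_cancel)
qed

lemma Rep_padic_int_0 [simp]: "Rep_padic_int 0 k = 0"
  by (simp add: zero_padic_int.rep_eq)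

lemma Rep_padic_int_zero_index [simp]: "Rep_padic_int x 0 = 0"
  using Rep_padic_int_mod[of 0 0 x] by simp

lemma Rep_padic_int_eq_0_iff:
  fixes x :: "'p::prime_card padic_int"
  assumes "k \<le> m"
  shows "Rep_padic_int x k = 0 \<longleftrightarrow> int CARD('p) ^ k dvd Rep_padic_int x m"
  using Rep_padic_int_mod[OF assms, of x] by (simp add: dvd_eq_mod_eq_0)

lemma Rep_padic_int_eq_0_mono: "Rep_padic_int x m = 0 \<Longrightarrow> k \<le> m \<Longrightarrow> Rep_padic_int x k = 0"
  by (simp add: Rep_padic_int_eq_0_iff)

lemma padic_int_val_ex:
  assumes "x \<noteq> 0"
  shows "\<exists>k. Rep_padic_int x (Suc k) \<noteq> 0"
proof (rule ccontr)
  assume *: "\<not> ?thesis"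
  have "Rep_padic_int x k = 0" for k
    using * by (cases k) auto
  then have "Rep_padic_int x = Rep_padic_int 0" by (intro ext) simp
  then have "x = 0" using Rep_padic_int_inject by blast
  with assms show False ..
qed

lemma padic_int_val_ge_iff:
  assumes "x \<noteq> 0"
  shows "k \<le> padic_int_val x \<longleftrightarrow> Rep_padic_int x k = 0"
proof
  assume k: "k \<le> padic_int_val x"
  show "Rep_padic_int x k = 0"
  proof (cases k)
    case (Suc j)
    with k have "j < padic_int_val x" by simp
    then show ?thesis using Suc not_less_Least unfolding padic_int_val_def by blast
  qed simp
next
  assume "Rep_padic_int x k = 0"
  moreover have "Rep_padic_int x (Suc (padic_int_val x)) \<noteq> 0"
    unfolding padic_int_val_def using LeastI_ex[OF padic_int_val_ex[OF assms]] .
  ultimately show "k \<le> padic_int_val x"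
    using Rep_padic_int_eq_0_mono by (metis not_less_eq_eq)
qed

lemma padic_int_mult_aux:
  fixes x y :: "'p::prime_card padic_int"
  assumes "x \<noteq> 0" "y \<noteq> 0"
  shows "x * y \<noteq> 0" "padic_int_val (x * y) = padic_int_val x + padic_int_val y"
proof -
  define p where "p = int CARD('p)"
  have p: "prime p"
    unfolding p_def using prime_card[where 'a='p] by simp
  define a where "a = padic_int_val x"
  define b where "b = padic_int_val y"
  define m where "m = Suc (a + b)"
  define X where "X = Rep_padic_int x m"
  define Y where "Y = Rep_padic_int y m"
  have X: "p ^ a dvd X" "\<not> p ^ Suc a dvd X"
    using padic_int_val_ge_iff[OF assms(1), of a] padic_int_val_ge_iff[OF assms(1), of "Suc a"]
      Rep_padic_int_eq_0_iff[of a m x] Rep_padic_int_eq_0_iff[of "Suc a" m x]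
    by (auto simp: X_def p_def m_def a_def)
  have Y: "p ^ b dvd Y" "\<not> p ^ Suc b dvd Y"
    using padic_int_val_ge_iff[OF assms(2), of b] padic_int_val_ge_iff[OF assms(2), of "Suc b"]
      Rep_padic_int_eq_0_iff[of b m y] Rep_padic_int_eq_0_iff[of "Suc b" m y]
    by (auto simp: Y_def p_def m_def b_def)
  obtain u where u: "X = p ^ a * u" using X(1) by blast
  obtain w where w: "Y = p ^ b * w" using Y(1) by blast
  have "p \<noteq> 0" using p by auto
  have "\<not> p dvd u" "\<not> p dvd w"
    using X(2) Y(2) by (auto simp: u w mult_dvd_mono mult.commute)
  then have nd: "\<not> p dvd u * w" using p by (simp add: prime_dvd_mult_iff)
  have XY: "X * Y = p ^ (a + b) * (u * w)" by (simp add: u w power_add ac_simps)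
  have R: "Rep_padic_int (x * y) m = (X * Y) mod p ^ m"
    by (simp add: times_padic_int.rep_eq X_def Y_def p_def)
  have 1: "Rep_padic_int (x * y) (Suc (a + b)) \<noteq> 0"
  proof
    assume "Rep_padic_int (x * y) (Suc (a + b)) = 0"
    then have "p ^ m dvd X * Y" using R by (simp add: m_def dvd_eq_mod_eq_0)
    then have "p ^ (a + b) * p dvd p ^ (a + b) * (u * w)"
      by (simp add: XY m_def mult.commute)
    then show False using nd \<open>p \<noteq> 0\<close> by (subst (asm) dvd_mult_cancel_left) auto
  qed
  have 2: "Rep_padic_int (x * y) (a + b) = 0"
  proof -
    have "p ^ (a + b) dvd X * Y" by (simp add: XY)
    moreover have "p ^ (a + b) dvd p ^ m" by (simp add: m_def)
    ultimately have "p ^ (a + b) dvd Rep_padic_int (x * y) m"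
      unfolding R by (simp add: dvd_mod)
    then show ?thesis
      using Rep_padic_int_eq_0_iff[of "a + b" m "x * y"] by (simp add: m_def p_def)
  qed
  show nz: "x * y \<noteq> 0" using 1 by auto
  have "a + b \<le> padic_int_val (x * y)" "\<not> Suc (a + b) \<le> padic_int_val (x * y)"
    using 1 2 padic_int_val_ge_iff[OF nz] by auto
  then show "padic_int_val (x * y) = padic_int_val x + padic_int_val y"
    by (simp add: a_def b_def)
qed

instance padic_int :: (prime_card) idom
  by standard (rule padic_int_mult_aux)

lemma prime_card_gt_1: "real CARD('p::prime_card) > 1"
  using prime_gt_1_nat[OF prime_card[where 'a='p]] by simp

lemma padic_int_abs_mult: "padic_int_abs (x * y) = padic_int_abs x * padic_int_abs y"
  by (auto simp: padic_int_abs_def padic_int_mult_aux power_add)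

lemma padic_int_abs_nonneg [simp]: "padic_int_abs x \<ge> 0"
  by (simp add: padic_int_abs_def)

lemma padic_int_abs_eq_0_iff [simp]: "padic_int_abs x = 0 \<longleftrightarrow> x = 0"
  by (simp add: padic_int_abs_def)

lemma padic_int_abs_0 [simp]: "padic_int_abs 0 = 0"
  by simp

lemma padic_int_abs_minus: "padic_int_abs (- x) = padic_int_abs x"
proof -
  have "(padic_int_abs (- 1 :: 'a padic_int))\<^sup>2 = (padic_int_abs (1 :: 'a padic_int))\<^sup>2"
    by (simp add: power2_eq_square flip: padic_int_abs_mult)
  then have "padic_int_abs (- 1 :: 'a padic_int) = padic_int_abs (1 :: 'a padic_int)"
    by (simp add: power2_eq_iff_nonneg)
  then show ?thesis
    by (metis mult.left_neutral mult_minus_left padic_int_abs_mult)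
qed

lemma padic_int_abs_ultrametric:
  "padic_int_abs (x + y) \<le> max (padic_int_abs x) (padic_int_abs y)"
proof (cases "x = 0 \<or> y = 0 \<or> x + y = 0")
  case False
  then have nz: "x \<noteq> 0" "y \<noteq> 0" "x + y \<noteq> 0" by auto
  define k where "k = min (padic_int_val x) (padic_int_val y)"
  have "Rep_padic_int x k = 0" "Rep_padic_int y k = 0"
    using padic_int_val_ge_iff[OF nz(1), of k] padic_int_val_ge_iff[OF nz(2), of k]
    by (auto simp: k_def)
  then have "Rep_padic_int (x + y) k = 0"
    by (simp add: plus_padic_int.rep_eq)
  then have "k \<le> padic_int_val (x + y)"
    using padic_int_val_ge_iff[OF nz(3)] by simp
  then have "inverse (real CARD('a) ^ padic_int_val (x + y)) \<le> inverse (real CARD('a) ^ k)"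
    using prime_card_gt_1[where 'p='a] by (intro le_imp_inverse_le power_increasing) auto
  then show ?thesis
    using nz by (auto simp: padic_int_abs_def k_def min_def max_def split: if_splits)
qed (auto simp: max_def)


lifting_forget padic_int.lifting


section \<open>The field of p-adic numbers\<close>

text \<open>A copy of the fraction field, so that it can carry its own topology.\<close>

typedef (overloaded) 'p padic = "UNIV :: 'p::prime_card padic_int fract set"
  by simp

setup_lifting type_definition_padic

instantiation padic :: (prime_card) field
begin

lift_definition zero_padic :: "'a padic" is 0 .
lift_definition one_padic :: "'a padic" is 1 .
lift_definition plus_padic :: "'a padic \<Rightarrow> 'a padic \<Rightarrow> 'a padic" is "(+)" .
lift_definition uminus_padic :: "'a padic \<Rightarrow> 'a padic" is "uminus" .
lift_definition minus_padic :: "'a padic \<Rightarrow> 'a padic \<Rightarrow> 'a padic" is "(-)" .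
lift_definition times_padic :: "'a padic \<Rightarrow> 'a padic \<Rightarrow> 'a padic" is "(*)" .
lift_definition inverse_padic :: "'a padic \<Rightarrow> 'a padic" is "inverse" .
lift_definition divide_padic :: "'a padic \<Rightarrow> 'a padic \<Rightarrow> 'a padic" is "(/)" .

instance
  by standard (transfer; simp add: algebra_simps divide_inverse)+

end

lift_definition of_padic_int :: "'p::prime_card padic_int \<Rightarrow> 'p padic" is "\<lambda>x. Fract x 1" .

definition fract_padic_abs :: "'p::prime_card padic_int fract \<Rightarrow> real" where
  "fract_padic_abs q =
     (THE r. \<exists>a b. b \<noteq> 0 \<and> q = Fract a b \<and> r = padic_int_abs a / padic_int_abs b)"

lift_definition padic_abs :: "'p::prime_card padic \<Rightarrow> real" is fract_padic_abs .

lemma fract_padic_abs_Fract: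
  "b \<noteq> 0 \<Longrightarrow> fract_padic_abs (Fract a b) = padic_int_abs a / padic_int_abs b"
  unfolding fract_padic_abs_def
proof (rule the_equality)
  fix r
  assume b: "b \<noteq> 0"
    and "\<exists>c d. d \<noteq> 0 \<and> Fract a b = Fract c d \<and> r = padic_int_abs c / padic_int_abs d"
  then obtain c d where "d \<noteq> 0" "a * d = c * b" "r = padic_int_abs c / padic_int_abs d"
    by (auto simp: eq_fract)
  then show "r = padic_int_abs a / padic_int_abs b"
    using b by (simp add: frac_eq_eq flip: padic_int_abs_mult)
qed blast

lemma padic_abs_nonneg [simp]: "padic_abs x \<ge> 0"
proof transfer
  show "fract_padic_abs x \<ge> 0" for x :: "'a padic_int fract"
    by (cases x) (simp add: fract_padic_abs_Fract)
qed

lemma padic_abs_eq_0_iff [simp]: "padic_abs x = 0 \<longleftrightarrow> x = 0"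
proof transfer
  show "fract_padic_abs x = 0 \<longleftrightarrow> x = 0" for x :: "'a padic_int fract"
    by (cases x) (simp add: fract_padic_abs_Fract Zero_fract_def eq_fract)
qed

lemma padic_abs_mult: "padic_abs (x * y) = padic_abs x * padic_abs y"
proof transfer
  show "fract_padic_abs (x * y) = fract_padic_abs x * fract_padic_abs y"
    for x y :: "'a padic_int fract"
    by (cases x; cases y) (simp add: fract_padic_abs_Fract padic_int_abs_mult)
qed

lemma padic_abs_minus [simp]: "padic_abs (- x) = padic_abs x"
proof transfer
  show "fract_padic_abs (- x) = fract_padic_abs x" for x :: "'a padic_int fract"
    by (cases x) (simp add: fract_padic_abs_Fract padic_int_abs_minus)
qed

lemma padic_abs_ultrametric: "padic_abs (x + y) \<le> max (padic_abs x) (padic_abs y)"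
proof transfer
  fix x y :: "'a padic_int fract"
  obtain a b c d where x: "x = Fract a b" "b \<noteq> 0" and y: "y = Fract c d" "d \<noteq> 0"
    by (metis Fract_cases)
  have pos: "padic_int_abs b > 0" "padic_int_abs d > 0"
    using x y by (simp_all add: order_less_le)
  have "fract_padic_abs (x + y) = padic_int_abs (a * d + c * b) / padic_int_abs (b * d)"
    using x y by (simp add: fract_padic_abs_Fract)
  also have "\<dots> \<le> max (padic_int_abs (a * d)) (padic_int_abs (c * b)) / padic_int_abs (b * d)"
    by (intro divide_right_mono padic_int_abs_ultrametric) auto
  also have "\<dots> = max (fract_padic_abs x) (fract_padic_abs y)"
    using x y pos by (auto simp: fract_padic_abs_Fract padic_int_abs_mult max_def field_simps)
  finally show "fract_padic_abs (x + y) \<le> max (fract_padic_abs x) (fract_padic_abs y)" .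
qed

lemma padic_abs_of_padic_int: "padic_abs (of_padic_int x) = padic_int_abs x"
proof transfer
  fix x :: "'a padic_int"
  have "padic_int_abs (1 :: 'a padic_int) = padic_int_abs (1 :: 'a padic_int) * padic_int_abs (1 :: 'a padic_int)"
    using padic_int_abs_mult[of "1 :: 'a padic_int" 1] unfolding mult_1 .
  then have "padic_int_abs (1 :: 'a padic_int) = 1"
    by simp
  then show "fract_padic_abs (Fract x 1) = padic_int_abs x"
    by (simp add: fract_padic_abs_Fract)
qed

lemma padic_abs_p: "padic_abs (of_nat CARD('p) :: 'p::prime_card padic) = inverse (real CARD('p))"
proof -
  define p where "p = int CARD('p)"
  have p: "p > 1"
    using prime_gt_1_nat[OF prime_card[where 'a='p]] by (simp add: p_def)
  have Rep: "Rep_padic_int (of_nat n :: 'p padic_int) k = int n mod p ^ k" for n k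
    by (induction n)
      (simp_all add: p_def plus_padic_int.rep_eq one_padic_int.rep_eq mod_simps)
  have 2: "Rep_padic_int (of_nat CARD('p) :: 'p padic_int) 2 = p"
    and 1: "Rep_padic_int (of_nat CARD('p) :: 'p padic_int) 1 = 0"
    using p by (simp_all add: Rep p_def power2_eq_square)
  have nz: "(of_nat CARD('p) :: 'p padic_int) \<noteq> 0"
    using 2 p by auto
  have "padic_int_val (of_nat CARD('p) :: 'p padic_int) = 1"
    using padic_int_val_ge_iff[OF nz, of 1] padic_int_val_ge_iff[OF nz, of 2] 1 2 p by auto
  then have *: "padic_int_abs (of_nat CARD('p) :: 'p padic_int) = inverse (real CARD('p))"
    using nz by (simp add: padic_int_abs_def)
  have 0: "of_padic_int 0 = (0 :: 'p padic)"
    by transfer (simp add: Zero_fract_def)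
  have "of_padic_int (1 + x) = (1 + of_padic_int x :: 'p padic)" for x
    by transfer (simp add: One_fract_def)
  then have "of_padic_int (of_nat n) = (of_nat n :: 'p padic)" for n
  proof (induction n)
    case (Suc n)
    then show ?case by (simp only: of_nat_Suc)
  qed (simp only: of_nat_0 0)
  then show ?thesis
    using * padic_abs_of_padic_int[of "of_nat CARD('p) :: 'p padic_int"] by simp
qed

instantiation padic :: (prime_card) metric_space
begin

definition dist_padic :: "'a padic \<Rightarrow> 'a padic \<Rightarrow> real" where
  "dist_padic x y = padic_abs (x - y)"

definition uniformity_padic :: "('a padic \<times> 'a padic) filter" where
  "uniformity_padic = (INF e\<in>{0<..}. principal {(x, y). dist x y < e})"

definition open_padic :: "'a padic set \<Rightarrow> bool" where
  "open_padic U \<longleftrightarrow> (\<forall>x\<in>U. eventually (\<lambda>(x', y). x' = x \<longrightarrow> y \<in> U) uniformity)"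

instance
proof
  fix x y z :: "'a padic"
  show "dist x y = 0 \<longleftrightarrow> x = y" by (simp add: dist_padic_def)
  have "dist x y = padic_abs ((x - z) + (- (y - z)))" by (simp add: dist_padic_def)
  also have "\<dots> \<le> max (padic_abs (x - z)) (padic_abs (- (y - z)))"
    by (rule padic_abs_ultrametric)
  also have "\<dots> \<le> dist x z + dist y z"
    unfolding dist_padic_def padic_abs_minus by simp
  finally show "dist x y \<le> dist x z + dist y z" .
qed (simp_all only: uniformity_padic_def open_padic_def)

end

definition Zp_vec :: "('p::prime_card padic ^ 'n) set" where
  "Zp_vec = {x. \<forall>i. x $ i \<in> range of_padic_int}"

text \<open>
  On the locally compact, second countable group \<open>\<rat>\<^sub>p\<^sup>n\<close> a translation invariant Borel measure
  giving the compact open subgroup \<open>\<int>\<^sub>p\<^sup>n\<close> mass one is finite on compact sets and hence regular,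
  so these conditions characterise the normalized Haar measure.
\<close>

definition normalized_haar :: "('p::prime_card padic ^ 'n) measure \<Rightarrow> bool" where
  "normalized_haar \<mu> \<longleftrightarrow>
     sets \<mu> = sets borel \<and>
     (\<forall>a. \<forall>A\<in>sets borel. emeasure \<mu> ((\<lambda>x. a + x) ` A) = emeasure \<mu> A) \<and>
     emeasure \<mu> Zp_vec = 1"


section \<open>Polynomials in several variables\<close>

text \<open>
  A polynomial in the variables indexed by \<open>'n\<close> is a finitely supported map from exponent
  vectors to coefficients; the library provides the ring structure.
\<close>

type_synonym ('n, 'a) mpoly = "('n \<Rightarrow>\<^sub>0 nat) \<Rightarrow>\<^sub>0 'a"

definition mpoly_eval :: "'a::comm_ring_1 ^ 'n \<Rightarrow> ('n::finite, 'a) mpoly \<Rightarrow> 'a" where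
  "mpoly_eval a f = (\<Sum>\<omega>\<in>Poly_Mapping.keys f.
     Poly_Mapping.lookup f \<omega> * (\<Prod>i\<in>UNIV. (a $ i) ^ Poly_Mapping.lookup \<omega> i))"

text \<open>Where \<open>\<omega> i = 0\<close> the exponent subtraction truncates, but the coefficient vanishes.\<close>

definition mpoly_deriv :: "'n \<Rightarrow> ('n, 'a::comm_ring_1) mpoly \<Rightarrow> ('n, 'a) mpoly" where
  "mpoly_deriv i f = (\<Sum>\<omega>\<in>Poly_Mapping.keys f.
     Poly_Mapping.single (\<omega> - Poly_Mapping.single i 1)
       (of_nat (Poly_Mapping.lookup \<omega> i) * Poly_Mapping.lookup f \<omega>))"

definition monomial_ideal :: "('n, 'a::comm_ring_1) mpoly set \<Rightarrow> bool" where
  "monomial_ideal I \<longleftrightarrow> (\<exists>A. I = module.span (*) ((\<lambda>\<omega>. Poly_Mapping.single \<omega> 1) ` A))"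

abbreviation reduce_mod_p :: "('n, 'p::prime_card padic_int) mpoly \<Rightarrow> ('n, 'p mod_ring) mpoly"
  where "reduce_mod_p \<equiv> Poly_Mapping.map residue_mod_p"

abbreviation eval_Qp ::
  "('n::finite, 'p::prime_card padic_int) mpoly \<Rightarrow> 'p padic ^ 'n \<Rightarrow> 'p padic" where
  "eval_Qp f x \<equiv> mpoly_eval x (Poly_Mapping.map of_padic_int f)"

text \<open>
  For an ideal \<open>I\<close> and \<open>x \<in> \<int>\<^sub>p\<^sup>n\<close> the supremum is a maximum, as the values are \<open>0\<close> or powers
  of \<open>p\<close> with exponent at most \<open>0\<close>.
\<close>

definition ideal_abs ::
  "('n::finite, 'p::prime_card padic_int) mpoly set \<Rightarrow> 'p padic ^ 'n \<Rightarrow> real" where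
  "ideal_abs I x = (SUP f\<in>I. padic_abs (eval_Qp f x))"


section \<open>Newton polyhedra\<close>

definition expvec :: "('n \<Rightarrow>\<^sub>0 nat) \<Rightarrow> real ^ 'n" where
  "expvec \<omega> = (\<chi> i. real (Poly_Mapping.lookup \<omega> i))"

definition orthant :: "(real ^ 'n) set" where
  "orthant = {k. \<forall>i. 0 \<le> k $ i}"

definition newton_poly :: "('n::finite, 'a::zero) mpoly \<Rightarrow> (real ^ 'n) set" where
  "newton_poly g = convex hull (\<Union>\<omega>\<in>Poly_Mapping.keys g. {expvec \<omega> + v | v. v \<in> orthant})"

definition newton_ideal :: "('n::finite, 'a::comm_ring_1) mpoly set \<Rightarrow> (real ^ 'n) set" where
  "newton_ideal I = convex hull (expvec ` {\<omega>. Poly_Mapping.single \<omega> 1 \<in> I})"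

definition poly_face :: "(real ^ 'n) set \<Rightarrow> (real ^ 'n) set \<Rightarrow> bool" where
  "poly_face \<Gamma> \<tau> \<longleftrightarrow> \<tau> = \<Gamma> \<or>
     (\<exists>a b. a \<noteq> 0 \<and> \<Gamma> \<subseteq> {x. a \<bullet> x \<ge> b} \<and> \<tau> = \<Gamma> \<inter> {x. a \<bullet> x = b} \<and> \<tau> \<noteq> {})"

definition face_part :: "('n::finite, 'a::comm_monoid_add) mpoly \<Rightarrow> (real ^ 'n) set \<Rightarrow> ('n, 'a) mpoly"
  where "face_part g \<tau> = (\<Sum>\<omega>\<in>{\<omega>\<in>Poly_Mapping.keys g. expvec \<omega> \<in> \<tau>}.
     Poly_Mapping.single \<omega> (Poly_Mapping.lookup g \<omega>))"

definition nondegenerate :: "('n::finite, 'p::prime_card padic_int) mpoly \<Rightarrow> bool" where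
  "nondegenerate g \<longleftrightarrow> (\<forall>\<tau>. poly_face (newton_poly g) \<tau> \<longrightarrow>
     \<not> (\<exists>a. (\<forall>i. a $ i \<noteq> 0) \<and>
           mpoly_eval a (reduce_mod_p (face_part g \<tau>)) = 0 \<and>
           (\<forall>i. mpoly_eval a (mpoly_deriv i (reduce_mod_p (face_part g \<tau>))) = 0)))"

definition supp_min :: "(real ^ 'n) set \<Rightarrow> real ^ 'n \<Rightarrow> real" where
  "supp_min \<Gamma> k = (INF x\<in>\<Gamma>. k \<bullet> x)"

definition first_meet :: "(real ^ 'n) set \<Rightarrow> real ^ 'n \<Rightarrow> (real ^ 'n) set" where
  "first_meet \<Gamma> k = {x \<in> \<Gamma>. k \<bullet> x = supp_min \<Gamma> k}"

definition sigma :: "real ^ 'n \<Rightarrow> real" where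
  "sigma k = (\<Sum>i\<in>UNIV. k $ i)"

definition dual_cone :: "(real ^ 'n) set \<Rightarrow> (real ^ 'n) set \<Rightarrow> (real ^ 'n) set" where
  "dual_cone \<Gamma> \<tau> = {k \<in> orthant. first_meet \<Gamma> k = \<tau>}"

definition dual_partition ::
  "('n::finite, 'a::comm_ring_1) mpoly set \<Rightarrow> ('n, 'a) mpoly \<Rightarrow> (real ^ 'n) set set" where
  "dual_partition I g = {\<delta>. \<delta> \<noteq> {} \<and> (\<exists>\<tau> \<tau>'. poly_face (newton_ideal I) \<tau> \<and>
     poly_face (newton_poly g) \<tau>' \<and> \<delta> = dual_cone (newton_ideal I) \<tau> \<inter> dual_cone (newton_poly g) \<tau>')}"

text \<open>
  The face \<open>\<tau>'\<close> below is unique, because \<open>\<delta>\<close> is nonempty and \<open>\<tau>'\<close> is the first meet locus in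
  the Newton polyhedron of \<open>g\<close> of every vector of \<open>\<delta>\<close>.
\<close>

definition cone_face_part ::
  "('n::finite, 'a::comm_ring_1) mpoly set \<Rightarrow> ('n, 'a) mpoly \<Rightarrow> (real ^ 'n) set \<Rightarrow> ('n, 'a) mpoly" where
  "cone_face_part I g \<delta> = face_part g (THE \<tau>'. poly_face (newton_poly g) \<tau>' \<and>
     (\<exists>\<tau>. poly_face (newton_ideal I) \<tau> \<and>
        \<delta> = dual_cone (newton_ideal I) \<tau> \<inter> dual_cone (newton_poly g) \<tau>'))"


section \<open>Cones\<close>

text \<open>The cone strictly positively spanned by a finite set; it is \<open>{0}\<close> for the empty set.\<close>

definition strict_cone :: "(real ^ 'n) set \<Rightarrow> (real ^ 'n) set" where
  "strict_cone B = {\<Sum>v\<in>B. c v *\<^sub>R v | c. \<forall>v\<in>B. 0 < c v}"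

definition int_vec :: "real ^ 'n \<Rightarrow> bool" where
  "int_vec k \<longleftrightarrow> (\<forall>i. k $ i \<in> \<int>)"

definition primitive_vec :: "real ^ 'n \<Rightarrow> bool" where
  "primitive_vec k \<longleftrightarrow> (\<exists>z. (\<forall>i. k $ i = of_int (z i)) \<and> Gcd (range z) = (1::int))"

definition cone_generators :: "(real ^ 'n) set \<Rightarrow> (real ^ 'n) set" where
  "cone_generators \<delta> =
     {k. primitive_vec k \<and> (\<exists>\<rho>. poly_face (closure \<delta>) \<rho> \<and> aff_dim \<rho> = 1 \<and> k \<in> \<rho>)}"

text \<open>
  A partition into rational simplicial cones without introducing new rays, given by the
  uniquely determined sets of primitive generators of its members.
\<close>

definition simplicial_partition :: "(real ^ 'n) set \<Rightarrow> (real ^ 'n) set set \<Rightarrow> bool" where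
  "simplicial_partition \<delta> \<B> \<longleftrightarrow>
     finite \<B> \<and>
     (\<forall>B\<in>\<B>. B \<subseteq> cone_generators \<delta> \<and> independent B) \<and>
     (\<forall>B\<in>\<B>. \<forall>C\<in>\<B>. B \<noteq> C \<longrightarrow> strict_cone B \<inter> strict_cone C = {}) \<and>
     (\<Union>B\<in>\<B>. strict_cone B) = \<delta>"

definition box_points :: "(real ^ 'n) set \<Rightarrow> (real ^ 'n) set" where
  "box_points B = {h. int_vec h \<and>
     (\<exists>c. (\<forall>v\<in>B. 0 \<le> c v \<and> c v < 1) \<and> h = (\<Sum>v\<in>B. c v *\<^sub>R v))}"


section \<open>The zeta function and the terms of the formula\<close>

definition zeta_integrand ::
  "('n::finite, 'p::prime_card padic_int) mpoly set \<Rightarrow> ('n, 'p padic_int) mpoly \<Rightarrow>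
     complex \<Rightarrow> 'p padic ^ 'n \<Rightarrow> complex" where
  "zeta_integrand I g s x = of_real (ideal_abs I x) powr s * of_real (padic_abs (eval_Qp g x))"

definition zeta_int ::
  "('p::prime_card padic ^ 'n::finite) measure \<Rightarrow> ('n, 'p padic_int) mpoly set \<Rightarrow>
     ('n, 'p padic_int) mpoly \<Rightarrow> complex \<Rightarrow> complex" where
  "zeta_int \<mu> I g s = (LINT x:Zp_vec|\<mu>. zeta_integrand I g s x)"

definition N_cone ::
  "('n::finite, 'p::prime_card padic_int) mpoly set \<Rightarrow> ('n, 'p padic_int) mpoly \<Rightarrow>
     (real ^ 'n) set \<Rightarrow> nat" where
  "N_cone I g \<delta> = card {a :: 'p mod_ring ^ 'n.
     (\<forall>i. a $ i \<noteq> 0) \<and> mpoly_eval a (reduce_mod_p (cone_face_part I g \<delta>)) = 0}"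

definition L_cone ::
  "('n::finite, 'p::prime_card padic_int) mpoly set \<Rightarrow> ('n, 'p padic_int) mpoly \<Rightarrow>
     (real ^ 'n) set \<Rightarrow> real" where
  "L_cone I g \<delta> = (let p = real CARD('p); n = CARD('n) in
     ((p - 1) ^ n - real (N_cone I g \<delta>) * (p / (p + 1))) / p ^ n)"

definition p_exponent ::
  "('n::finite, 'a::comm_ring_1) mpoly set \<Rightarrow> ('n, 'a) mpoly \<Rightarrow> complex \<Rightarrow> real ^ 'n \<Rightarrow> complex" where
  "p_exponent I g s k = of_real (supp_min (newton_ideal I) k) * s
     + of_real (supp_min (newton_poly g) k) + of_real (sigma k)"

definition S_term ::
  "('n::finite, 'p::prime_card padic_int) mpoly set \<Rightarrow> ('n, 'p padic_int) mpoly \<Rightarrow>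
     complex \<Rightarrow> real ^ 'n \<Rightarrow> complex" where
  "S_term I g s k = of_nat CARD('p) powr (- p_exponent I g s k)"

text \<open>The cones are contained in the nonnegative orthant.\<close>

definition S_cone ::
  "('n::finite, 'p::prime_card padic_int) mpoly set \<Rightarrow> ('n, 'p padic_int) mpoly \<Rightarrow>
     complex \<Rightarrow> (real ^ 'n) set \<Rightarrow> complex" where
  "S_cone I g s \<delta> = (\<Sum>\<^sub>\<infinity>k\<in>{k\<in>\<delta>. int_vec k}. S_term I g s k)"

definition simplicial_term ::
  "('n::finite, 'p::prime_card padic_int) mpoly set \<Rightarrow> ('n, 'p padic_int) mpoly \<Rightarrow>
     complex \<Rightarrow> (real ^ 'n) set \<Rightarrow> complex" where
  "simplicial_term I g s B =
     (\<Sum>h\<in>box_points B. of_nat CARD('p) powr p_exponent I g s h) /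
     (\<Prod>k\<in>B. of_nat CARD('p) powr p_exponent I g s k - 1)"

definition ray_generators ::
  "('n::finite, 'a::comm_ring_1) mpoly set \<Rightarrow> ('n, 'a) mpoly \<Rightarrow> (real ^ 'n) set" where
  "ray_generators I g = {k. primitive_vec k \<and> strict_cone {k} \<in> dual_partition I g}"

definition candidate_real_part ::
  "('n::finite, 'a::comm_ring_1) mpoly set \<Rightarrow> ('n, 'a) mpoly \<Rightarrow> real ^ 'n \<Rightarrow> real" where
  "candidate_real_part I g k =
     - (supp_min (newton_poly g) k + sigma k) / supp_min (newton_ideal I) k"

end

theory Submission
  imports Defs
begin

text \<open>
  Up to a null set \<open>\<int>\<^sub>p\<^sup>n\<close> is the disjoint union of the shells on which every coordinate has a fixed
  valuation \<open>k\<^sub>i\<close>.  On such a shell the ideal has constant absolute value, and \<open>g\<close> is a power of \<open>p\<close>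
  times a polynomial that reduces to the face polynomial of \<open>k\<close>.  At a zero of the reduction some
  partial derivative does not vanish, and translations in this direction show that the part where
  \<open>g\<close> is divisible by one more power of \<open>p\<close> has a \<open>p\<close>-th of the volume; hence the integral is
  the series of the theorem.

  For the poles no triangulation is needed.  Every lattice point of a cell \<open>\<delta>\<close> is one of finitely many
  lattice points of \<open>\<delta>\<close> plus a combination with natural coefficients of the primitive generators of
  the rays in the closure of \<open>\<delta>\<close>.  Choosing one representation of every point and applying
  Dickson's lemma splits the lattice points into finitely many translates of free monoids spanned by
  such generators, so the cone sum is a finite sum of products of geometric series.
\<close>


section \<open>Multivariate geometric series\<close>

text \<open>The factor p/(p+1) measures the loss at a zero of the reduced face polynomial. Put q =
  1/p and let V be the volume of one residue class in a shell on which g has valuation at least m.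
  Over a zero, the part where the valuation is exactly m + j has volume V q^(j-1) (1 - q) for j >=
  1, so |g| integrates to q^m V (1 - q) (q + q^3 + q^5 + ...) = q^m V / (p + 1). Over a nonzero
  value of the reduction the integral is q^m V, and the difference is q^m V p/(p+1).

  Two obstacles shape the treatment of the cone sums. The exponent of p is only piecewise linear in
  k. A vertex of each polyhedron is therefore fixed, and the work takes place in the cone where both
  vertices are minimal, which contains the closure of the cell; there the weight is multiplicative.
  Secondly, the ray generators of a cell may be linearly dependent, so a lattice point can have many
  representations and a plain product of geometric series would count it repeatedly. Enlarging the
  set of generators is no remedy, because every vector in a denominator is a candidate for a
  pole.\<close>

text \<open>Elements of N^K are encoded as total functions vanishing off \<open>K\<close>, so that
  equality of exponents is equality of functions and a subset of \<open>K\<close> gives a submonoid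
  of the same type.\<close>

definition exponents_on :: "'v set \<Rightarrow> ('v \<Rightarrow> nat) set" where
  "exponents_on K = {a. \<forall>x. x \<notin> K \<longrightarrow> a x = 0}"

lemma exponents_on_insert_bij:
  assumes "j \<notin> J"
  shows "bij_betw (\<lambda>(n, a). a(j := n)) (UNIV \<times> exponents_on J) (exponents_on (insert j J))"
  by (rule bij_betwI[where g = "\<lambda>a. (a j, a(j := 0))"])
    (use assms in \<open>auto simp: exponents_on_def fun_eq_iff\<close>)

text \<open>A product of geometric series. Absolute summability is carried through the induction
  because the iterated sum over an inserted variable yields the sum over the product set only once
  summability there is known.\<close>

lemma has_sum_monomials:
  fixes z :: "'v \<Rightarrow> complex"
  assumes "finite J" "\<And>x. x \<in> J \<Longrightarrow> norm (z x) < 1"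
  shows "((\<lambda>a. \<Prod>x\<in>J. z x ^ a x) has_sum (\<Prod>x\<in>J. 1 / (1 - z x))) (exponents_on J)"
    and "(\<lambda>a. norm (\<Prod>x\<in>J. z x ^ a x)) summable_on exponents_on J"
proof -
  have "((\<lambda>a. \<Prod>x\<in>J. z x ^ a x) has_sum (\<Prod>x\<in>J. 1 / (1 - z x))) (exponents_on J) \<and>
    (\<lambda>a. norm (\<Prod>x\<in>J. z x ^ a x)) summable_on exponents_on J"
    using assms
  proof (induction J)
    case empty
    have "exponents_on {} = {\<lambda>_ :: 'v. 0}" by (auto simp: exponents_on_def)
    then show ?case by (simp add: has_sum_finiteI)
  next
    case (insert j J)
    let ?f = "\<lambda>a. \<Prod>x\<in>J. z x ^ a x" and ?F = "\<lambda>a. \<Prod>x\<in>insert j J. z x ^ a x"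
    have IH: "(?f has_sum (\<Prod>x\<in>J. 1 / (1 - z x))) (exponents_on J)"
      "(\<lambda>a. norm (?f a)) summable_on exponents_on J"
      using insert by auto
    have zj: "norm (z j) < 1" using insert.prems by simp
    have geo: "((\<lambda>n. z j ^ n) has_sum (1 / (1 - z j))) UNIV"
      using zj by (intro norm_summable_imp_has_sum geometric_sums) (auto simp: norm_power)
    have geo_norm: "(\<lambda>n. norm (z j ^ n)) summable_on UNIV"
      using zj by (intro norm_summable_imp_summable_on) (auto simp: norm_power)
    have F: "?F (a(j := n)) = z j ^ n * ?f a" for a n
    proof -
      have "(\<Prod>x\<in>J. z x ^ (a(j := n)) x) = ?f a"
        by (rule prod.cong) (use insert.hyps in auto)
      then show ?thesis using insert.hyps by simp
    qed
    obtain S where S: "((\<lambda>a. norm (?f a)) has_sum S) (exponents_on J)"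
      using IH(2) unfolding summable_on_def by blast
    have ns: "(\<lambda>p. norm (z j ^ fst p * ?f (snd p))) summable_on (UNIV \<times> exponents_on J)"
    proof (rule summable_on_SigmaI)
      fix n
      show "((\<lambda>a. norm (z j ^ fst (n, a) * ?f (snd (n, a)))) has_sum (norm (z j ^ n) * S)) (exponents_on J)"
        using has_sum_cmult_right[OF S, of "norm (z j ^ n)"] by (simp add: norm_mult)
      show "(\<lambda>n. norm (z j ^ n) * S) summable_on UNIV"
        by (rule summable_on_cmult_left[OF geo_norm])
    qed simp
    have hs: "((\<lambda>p. z j ^ fst p * ?f (snd p)) has_sum
      (1 / (1 - z j) * (\<Prod>x\<in>J. 1 / (1 - z x)))) (UNIV \<times> exponents_on J)"
    proof (rule has_sum_SigmaI)
      fix n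
      show "((\<lambda>a. z j ^ fst (n, a) * ?f (snd (n, a))) has_sum
          (z j ^ n * (\<Prod>x\<in>J. 1 / (1 - z x)))) (exponents_on J)"
        using has_sum_cmult_right[OF IH(1), of "z j ^ n"] by simp
      show "((\<lambda>n. z j ^ n * (\<Prod>x\<in>J. 1 / (1 - z x))) has_sum
          (1 / (1 - z j) * (\<Prod>x\<in>J. 1 / (1 - z x)))) UNIV"
        by (rule has_sum_cmult_left[OF geo])
      show "(\<lambda>p. z j ^ fst p * ?f (snd p)) summable_on (UNIV \<times> exponents_on J)"
        by (rule abs_summable_summable[OF ns])
    qed
    note bij = exponents_on_insert_bij[OF insert.hyps(2)]
    have F': "?F (case p of (n, a) \<Rightarrow> a(j := n)) = z j ^ fst p * ?f (snd p)" for p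
      using F by (cases p) (simp del: prod.insert)
    have 1: "(?F has_sum (1 / (1 - z j) * (\<Prod>x\<in>J. 1 / (1 - z x)))) (exponents_on (insert j J))"
      using has_sum_reindex_bij_betw[OF bij, of ?F] hs unfolding F' by blast
    have 2: "(\<lambda>a. norm (?F a)) summable_on (exponents_on (insert j J))"
      using summable_on_reindex_bij_betw[OF bij, of "\<lambda>a. norm (?F a)"] ns unfolding F' by blast
    show ?case using 1 2 insert.hyps by simp
  qed
  then show "((\<lambda>a. \<Prod>x\<in>J. z x ^ a x) has_sum (\<Prod>x\<in>J. 1 / (1 - z x))) (exponents_on J)"
    and "(\<lambda>a. norm (\<Prod>x\<in>J. z x ^ a x)) summable_on exponents_on J" by auto
qed

text \<open>Induction on the coordinates. A set \<open>F\<close> that works for \<open>K\<close>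
  also handles all points whose new coordinate is at least the bound \<open>C\<close> of the new
  coordinates on \<open>F\<close>. The remaining points lie in the slices of constant new coordinate
  below \<open>C\<close>, and the induction hypothesis applies to each slice. The map
  \<open>\<phi>\<close> allows points that are not functions themselves, such as exponents of
  monomials.\<close>

theorem dickson:
  fixes \<phi> :: "'b \<Rightarrow> 'v \<Rightarrow> nat"
  assumes "finite K"
  shows "\<exists>F\<subseteq>U. finite F \<and> (\<forall>a\<in>U. \<exists>b\<in>F. \<forall>x\<in>K. \<phi> b x \<le> \<phi> a x)"
  using assms
proof (induction K arbitrary: U)
  case empty
  show ?case
  proof (cases "U = {}")
    case False
    then obtain u where "u \<in> U" by blast
    then show ?thesis by (intro exI[of _ "{u}"]) auto
  qed auto
next
  case (insert j K)
  obtain F where F: "F \<subseteq> U" "finite F" "\<forall>a\<in>U. \<exists>b\<in>F. \<forall>x\<in>K. \<phi> b x \<le> \<phi> a x"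
    using insert.IH[of U] by blast
  define C where "C = (\<Sum>b\<in>F. \<phi> b j)"
  have C: "\<phi> b j \<le> C" if "b \<in> F" for b
    unfolding C_def by (rule member_le_sum[where f = "\<lambda>b. \<phi> b j"]) (use that F(2) in auto)
  have "\<forall>v. \<exists>G. G \<subseteq> {a\<in>U. \<phi> a j = v} \<and> finite G \<and> (\<forall>a\<in>{a\<in>U. \<phi> a j = v}. \<exists>b\<in>G. \<forall>x\<in>K. \<phi> b x \<le> \<phi> a x)"
    by (intro allI insert.IH)
  from choice[OF this] obtain G where G0: "\<forall>v. G v \<subseteq> {a\<in>U. \<phi> a j = v} \<and> finite (G v) \<and>
    (\<forall>a\<in>{a\<in>U. \<phi> a j = v}. \<exists>b\<in>G v. \<forall>x\<in>K. \<phi> b x \<le> \<phi> a x)"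
    by (rule exE)
  then have G: "\<And>v. G v \<subseteq> {a\<in>U. \<phi> a j = v}" "\<And>v. finite (G v)" by blast+
  have G3: "\<exists>b\<in>G (\<phi> a j). \<forall>x\<in>K. \<phi> b x \<le> \<phi> a x" if "a \<in> U" for a
    using G0[rule_format, of "\<phi> a j"] that by blast
  have "\<exists>b\<in>F \<union> (\<Union>v<C. G v). \<forall>x\<in>insert j K. \<phi> b x \<le> \<phi> a x" if a: "a \<in> U" for a
  proof (cases "\<phi> a j < C")
    case True
    obtain b where "b \<in> G (\<phi> a j)" "\<forall>x\<in>K. \<phi> b x \<le> \<phi> a x"
      using G3[OF a] by blast
    moreover have "\<phi> b j = \<phi> a j" using G(1) \<open>b \<in> G _\<close> by blast
    ultimately show ?thesis using True by (intro bexI[of _ b]) auto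
  next
    case False
    obtain b where "b \<in> F" "\<forall>x\<in>K. \<phi> b x \<le> \<phi> a x" using F(3) a by blast
    then show ?thesis using C[of b] False by (intro bexI[of _ b]) auto
  qed
  then show ?case
    using F(1,2) G(1,2) by (intro exI[of _ "F \<union> (\<Union>v<C. G v)"] conjI ballI) blast+
qed

text \<open>A set invariant under truncation at \<open>C\<close> is the disjoint union of the translates of the free
  monoids on \<open>{x \<in> K. b x = C}\<close> by its elements \<open>b\<close> that are bounded by \<open>C\<close>.\<close>

lemma has_sum_monomials_saturated:
  fixes z :: "'v \<Rightarrow> complex" and X :: "('v \<Rightarrow> nat) set"
  assumes K: "finite K" and z: "\<And>x. x \<in> K \<Longrightarrow> norm (z x) < 1"
    and X: "X \<subseteq> exponents_on K" "\<And>a. a \<in> exponents_on K \<Longrightarrow> a \<in> X \<longleftrightarrow> (\<lambda>x. min C (a x)) \<in> X"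
  shows "((\<lambda>a. \<Prod>x\<in>K. z x ^ a x) has_sum
    (\<Sum>b | b \<in> X \<and> (\<forall>x. b x \<le> C). (\<Prod>x\<in>K. z x ^ b x) * (\<Prod>x | x \<in> K \<and> b x = C. 1 / (1 - z x)))) X"
proof -
  let ?B = "{b. b \<in> X \<and> (\<forall>x. b x \<le> C)}"
  let ?J = "\<lambda>b. {x. x \<in> K \<and> b x = C}"
  let ?T = "\<lambda>b. (\<lambda>c x. b x + c x) ` exponents_on (?J b)"
  have fB: "finite ?B"
  proof (rule finite_subset)
    show "?B \<subseteq> {f. \<forall>x. (x \<in> K \<longrightarrow> f x \<in> {..C}) \<and> (x \<notin> K \<longrightarrow> f x = 0)}"
      using X(1) by (auto simp: exponents_on_def)
    show "finite {f. \<forall>x. (x \<in> K \<longrightarrow> f x \<in> {..C}) \<and> (x \<notin> K \<longrightarrow> f x = (0::nat))}"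
      by (rule finite_set_of_finite_funs) (use K in auto)
  qed
  \<comment> \<open>Truncation at \<open>C\<close> maps each translate to its base point: where
    \<open>b x < C\<close> nothing is added, and where \<open>b x = C\<close> the addition is cut
    off. Disjointness and membership in \<open>X\<close> both follow.\<close>
  have min_T: "(\<lambda>x. min C (a x)) = b" if b: "b \<in> ?B" and a: "a \<in> ?T b" for a b
  proof
    fix x
    obtain c where c: "c \<in> exponents_on (?J b)" "a = (\<lambda>x. b x + c x)" using a by blast
    show "min C (a x) = b x"
      using b c X(1) by (cases "x \<in> ?J b") (auto simp: exponents_on_def)
  qed
  have T_sub: "a \<in> X" if b: "b \<in> ?B" and a: "a \<in> ?T b" for a b
  proof -
    have "a \<in> exponents_on K"
      using a b X(1) by (auto simp: exponents_on_def)
    from X(2)[OF this] show ?thesis using min_T[OF b a] b by simp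
  qed
  have UN: "X = (\<Union>b\<in>?B. ?T b)"
  proof (intro equalityI subsetI)
    fix a assume a: "a \<in> X"
    let ?b = "\<lambda>x. min C (a x)"
    have "a \<in> exponents_on K" using a X(1) by blast
    from X(2)[OF this] have "?b \<in> ?B" using a by simp
    moreover have "a \<in> ?T ?b"
    proof (rule image_eqI)
      show "(\<lambda>x. a x - ?b x) \<in> exponents_on (?J ?b)"
        using a X(1) by (auto simp: exponents_on_def min_def)
    qed auto
    ultimately show "a \<in> (\<Union>b\<in>?B. ?T b)" by (intro UN_I[of ?b])
  next
    fix a assume "a \<in> (\<Union>b\<in>?B. ?T b)"
    then show "a \<in> X" by (rule UN_E) (rule T_sub)
  qed
  have "((\<lambda>a. \<Prod>x\<in>K. z x ^ a x) has_sum
    (\<Sum>b\<in>?B. (\<Prod>x\<in>K. z x ^ b x) * (\<Prod>x\<in>?J b. 1 / (1 - z x)))) (\<Union>b\<in>?B. ?T b)"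
  proof (rule sum_has_sum[OF fB])
    fix b assume b: "b \<in> ?B"
    have fJ: "finite (?J b)" using K by simp
    have "((\<lambda>c. (\<Prod>x\<in>K. z x ^ b x) * (\<Prod>x\<in>?J b. z x ^ c x)) has_sum
        (\<Prod>x\<in>K. z x ^ b x) * (\<Prod>x\<in>?J b. 1 / (1 - z x))) (exponents_on (?J b))"
      using z by (intro has_sum_cmult_right has_sum_monomials[OF fJ]) auto
    also have "?this \<longleftrightarrow> ((\<lambda>c. \<Prod>x\<in>K. z x ^ (b x + c x)) has_sum
        (\<Prod>x\<in>K. z x ^ b x) * (\<Prod>x\<in>?J b. 1 / (1 - z x))) (exponents_on (?J b))"
    proof (rule has_sum_cong)
      fix c assume c: "c \<in> exponents_on (?J b)"
      have "(\<Prod>x\<in>?J b. z x ^ c x) = (\<Prod>x\<in>K. z x ^ c x)"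
        by (rule prod.mono_neutral_left) (use K c in \<open>auto simp: exponents_on_def\<close>)
      then show "(\<Prod>x\<in>K. z x ^ b x) * (\<Prod>x\<in>?J b. z x ^ c x) = (\<Prod>x\<in>K. z x ^ (b x + c x))"
        by (simp add: power_add prod.distrib)
    qed
    finally show "((\<lambda>a. \<Prod>x\<in>K. z x ^ a x) has_sum
        (\<Prod>x\<in>K. z x ^ b x) * (\<Prod>x\<in>?J b. 1 / (1 - z x))) (?T b)"
      by (subst has_sum_reindex) (simp_all add: inj_on_def fun_eq_iff o_def)
  next
    fix b b' assume b: "b \<in> ?B" "b' \<in> ?B" "b \<noteq> b'"
    show "?T b \<inter> ?T b' = {}"
    proof (rule equals0I)
      fix a assume "a \<in> ?T b \<inter> ?T b'"
      then have "(\<lambda>x. min C (a x)) = b" "(\<lambda>x. min C (a x)) = b'"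
        using min_T[OF b(1)] min_T[OF b(2)] by blast+
      then show False using b(3) by simp
    qed
  qed
  then show ?thesis unfolding UN[symmetric] .
qed

lemma ex_inj_into_primes:
  assumes "finite K"
  shows "\<exists>q :: 'v \<Rightarrow> nat. inj_on q K \<and> (\<forall>x\<in>K. prime (q x))"
proof -
  obtain Q where Q: "Q \<subseteq> {p::nat. prime p}" "finite Q" "card Q = card K"
    using infinite_arbitrarily_large[OF primes_infinite] by metis
  obtain q where "bij_betw q K Q"
    using finite_same_card_bij[OF assms Q(2)] Q(3) by metis
  then show ?thesis using Q(1) by (auto simp: bij_betw_def)
qed

text \<open>
  The numbers \<open>\<Prod>x\<in>K. q x ^ a x\<close> with distinct primes \<open>q x\<close> provide a total well-order of the
  exponents that is compatible with addition; each point is represented by its least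
  representation, and the exponents that are not least form an up-closed set.
\<close>

lemma has_sum_generated:
  fixes K H :: "'v::real_vector set"
  assumes K: "finite K" and H: "finite H"
  shows "\<exists>P :: ('v \<times> ('v \<Rightarrow> nat)) set. \<exists>C. finite P \<and> fst ` P \<subseteq> H \<and>
    (\<forall>w :: 'v \<Rightarrow> complex. (\<forall>x\<in>K. norm (w x) < 1) \<longrightarrow>
       (\<forall>h\<in>H. \<forall>a. w (h + (\<Sum>x\<in>K. real (a x) *\<^sub>R x)) = w h * (\<Prod>x\<in>K. w x ^ a x)) \<longrightarrow>
       (w has_sum (\<Sum>(h, b)\<in>P. w h * ((\<Prod>x\<in>K. w x ^ b x) * (\<Prod>x | x \<in> K \<and> b x = C. 1 / (1 - w x)))))
         {h + (\<Sum>x\<in>K. real (a x) *\<^sub>R x) | h a. h \<in> H})"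
proof -
  obtain q :: "'v \<Rightarrow> nat" where q: "inj_on q K" "\<And>x. x \<in> K \<Longrightarrow> prime (q x)"
    using ex_inj_into_primes[OF K] by blast
  define comb :: "('v \<Rightarrow> nat) \<Rightarrow> 'v" where "comb a = (\<Sum>x\<in>K. real (a x) *\<^sub>R x)" for a
  define N where "N a = (\<Prod>x\<in>K. q x ^ a x)" for a
  have comb_add: "comb (\<lambda>x. a x + b x) = comb a + comb b" for a b
    by (simp add: comb_def scaleR_left_distrib sum.distrib)
  have N_add: "N (\<lambda>x. a x + b x) = N a * N b" for a b
    by (simp add: N_def power_add prod.distrib)
  have N_pos: "N a > 0" for a
    unfolding N_def using q(2) by (intro prod_pos) (auto simp: prime_gt_0_nat)
  \<comment> \<open>Unique factorization recovers the exponent at \<open>x\<close> as the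
    multiplicity of the prime \<open>q x\<close>.\<close>
  have N_inj: "a = b" if "N a = N b" "a \<in> exponents_on K" "b \<in> exponents_on K" for a b
  proof
    fix x
    show "a x = b x"
    proof (cases "x \<in> K")
      case True
      have "multiplicity (q x) (N c) = c x" for c
      proof -
        have Nc: "N c = (\<Prod>r\<in>q ` K. r ^ c (the_inv_into K q r))"
          unfolding N_def by (subst prod.reindex[OF q(1)]) (simp add: the_inv_into_f_f[OF q(1)])
        then show ?thesis
          using True K q by (subst Nc, subst multiplicity_prod_prime_powers) (auto simp: the_inv_into_f_f[OF q(1)])
      qed
      then show ?thesis using that(1) by metis
    qed (use that in \<open>auto simp: exponents_on_def\<close>)
  qed
  \<comment> \<open>\<open>U h\<close> collects the exponents whose point has another
    representation, possibly over a different base point, with a smaller value of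
    \<open>N\<close>.\<close>
  define U where "U h = {a \<in> exponents_on K. \<exists>h'\<in>H. \<exists>a'\<in>exponents_on K.
    h' + comb a' = h + comb a \<and> N a' < N a}" for h
  define X where "X h = exponents_on K - U h" for h
  have up: "(\<lambda>x. a x + b x) \<in> U h" if a: "a \<in> U h" and b: "b \<in> exponents_on K" for a b h
  proof -
    obtain h' a' where *: "h' \<in> H" "a' \<in> exponents_on K" "h' + comb a' = h + comb a" "N a' < N a"
      using a unfolding U_def by blast
    have "h' + comb (\<lambda>x. a' x + b x) = h + comb (\<lambda>x. a x + b x)"
      using *(3) by (simp add: comb_add flip: add.assoc)
    moreover have "N (\<lambda>x. a' x + b x) < N (\<lambda>x. a x + b x)"
      using *(4) N_pos by (simp add: N_add)
    moreover have "(\<lambda>x. a' x + b x) \<in> exponents_on K" "(\<lambda>x. a x + b x) \<in> exponents_on K"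
      using a b * by (auto simp: U_def exponents_on_def)
    ultimately show ?thesis using *(1) unfolding U_def by blast
  qed
  have "\<exists>F\<subseteq>U h. finite F \<and> (\<forall>a\<in>U h. \<exists>b\<in>F. \<forall>x\<in>K. b x \<le> a x)" for h
    using dickson[OF K, of "U h" "\<lambda>a. a"] by simp
  then obtain F where F: "\<And>h. F h \<subseteq> U h" "\<And>h. finite (F h)"
    "\<And>h a. a \<in> U h \<Longrightarrow> \<exists>b\<in>F h. \<forall>x\<in>K. b x \<le> a x" by metis
  \<comment> \<open>\<open>C\<close> bounds the coordinates of the finitely many generators
    \<open>F h\<close> of the up-closed sets \<open>U h\<close>. Whether an exponent dominates a
    generator is thus not affected by cutting its coordinates at \<open>C\<close>.\<close>
  define C where "C = (\<Sum>h\<in>H. \<Sum>b\<in>F h. \<Sum>x\<in>K. b x)"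
  have C: "b x \<le> C" if "h \<in> H" "b \<in> F h" for h b x
  proof (cases "x \<in> K")
    case True
    have "b x \<le> (\<Sum>x\<in>K. b x)" using True K by (simp add: member_le_sum)
    also have "\<dots> \<le> (\<Sum>b\<in>F h. \<Sum>x\<in>K. b x)"
      by (rule member_le_sum[where f = "\<lambda>b. \<Sum>x\<in>K. b x"]) (use that F(2) in auto)
    also have "\<dots> \<le> C" unfolding C_def
      by (rule member_le_sum[where f = "\<lambda>h. \<Sum>b\<in>F h. \<Sum>x\<in>K. b x"]) (use that H in auto)
    finally show ?thesis .
  next
    case False
    then show ?thesis using that F(1) by (force simp: U_def exponents_on_def)
  qed
  have sat: "a \<in> X h \<longleftrightarrow> (\<lambda>x. min C (a x)) \<in> X h" if "h \<in> H" "a \<in> exponents_on K" for a h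
  proof -
    have m: "(\<lambda>x. min C (a x)) \<in> exponents_on K" using that(2) by (auto simp: exponents_on_def)
    have 1: "a \<in> U h" if "(\<lambda>x. min C (a x)) \<in> U h"
    proof -
      have "(\<lambda>x. a x - min C (a x)) \<in> exponents_on K"
        using \<open>a \<in> exponents_on K\<close> by (auto simp: exponents_on_def)
      then show ?thesis using up[OF that, of "\<lambda>x. a x - min C (a x)"] by simp
    qed
    have 2: "(\<lambda>x. min C (a x)) \<in> U h" if "a \<in> U h"
    proof -
      obtain b where b: "b \<in> F h" "\<forall>x\<in>K. b x \<le> a x" using F(3)[OF \<open>a \<in> U h\<close>] by blast
      have bU: "b \<in> U h" using F(1) b(1) by blast
      have le: "b x \<le> min C (a x)" for x
        using b C[OF \<open>h \<in> H\<close> b(1), of x] bU by (cases "x \<in> K") (auto simp: U_def exponents_on_def)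
      have "(\<lambda>x. min C (a x) - b x) \<in> exponents_on K" using m by (auto simp: exponents_on_def)
      from up[OF bU this] show ?thesis using le by simp
    qed
    show ?thesis using 1 2 m that(2) by (auto simp: X_def)
  qed
  define P where "P = Sigma H (\<lambda>h. {b. b \<in> X h \<and> (\<forall>x. b x \<le> C)})"
  have fB: "finite {b. b \<in> X h \<and> (\<forall>x. b x \<le> C)}" for h
  proof (rule finite_subset)
    show "{b. b \<in> X h \<and> (\<forall>x. b x \<le> C)} \<subseteq> {f. \<forall>x. (x \<in> K \<longrightarrow> f x \<in> {..C}) \<and> (x \<notin> K \<longrightarrow> f x = 0)}"
      by (auto simp: exponents_on_def X_def)
    show "finite {f. \<forall>x. (x \<in> K \<longrightarrow> f x \<in> {..C}) \<and> (x \<notin> K \<longrightarrow> f x = (0::nat))}"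
      by (rule finite_set_of_finite_funs) (use K in auto)
  qed
  have fP: "finite P" unfolding P_def using fB H by blast
  have inj: "h = h' \<and> a = a'"
    if "h \<in> H" "h' \<in> H" "a \<in> X h" "a' \<in> X h'" "h + comb a = h' + comb a'" for h h' a a'
  proof -
    have "\<not> N a' < N a" "\<not> N a < N a'"
      using that(3,4) that(1,2) that(5) that(5)[symmetric] unfolding X_def U_def by blast+
    then have "a = a'" using that by (intro N_inj) (auto simp: X_def)
    then show ?thesis using that(5) by simp
  qed
  have UN: "{h + comb a | h a. h \<in> H} = (\<Union>h\<in>H. (\<lambda>a. h + comb a) ` X h)"
  proof (intro equalityI subsetI)
    fix y assume "y \<in> {h + comb a | h a. h \<in> H}"
    then obtain h a where y: "h \<in> H" "y = h + comb a" by blast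
    let ?R = "\<lambda>n. \<exists>h\<in>H. \<exists>a\<in>exponents_on K. y = h + comb a \<and> n = N a"
    have "comb (\<lambda>x. if x \<in> K then a x else 0) = comb a" by (simp add: comb_def)
    then have "?R (N (\<lambda>x. if x \<in> K then a x else 0))"
      using y by (intro bexI[of _ h] bexI[of _ "\<lambda>x. if x \<in> K then a x else 0"]) (auto simp: exponents_on_def)
    then have "?R (LEAST n. ?R n)" by (rule LeastI)
    then obtain h' a' where *: "h' \<in> H" "a' \<in> exponents_on K" "y = h' + comb a'" "N a' = (LEAST n. ?R n)"
      by auto
    have "a' \<in> X h'"
    proof (rule ccontr)
      assume "a' \<notin> X h'"
      then obtain h2 a2 where "h2 \<in> H" "a2 \<in> exponents_on K" "h2 + comb a2 = h' + comb a'" "N a2 < N a'"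
        using * by (auto simp: X_def U_def)
      then have "?R (N a2)" using * by metis
      then have "N a' \<le> N a2" unfolding *(4) by (rule Least_le)
      then show False using \<open>N a2 < N a'\<close> by simp
    qed
    then show "y \<in> (\<Union>h\<in>H. (\<lambda>a. h + comb a) ` X h)" using * by blast
  qed auto
  \<comment> \<open>\<open>P\<close> and \<open>C\<close> are fixed before the weight
    \<open>w\<close>, so one finite expression serves all values of the complex variable at
    once.\<close>
  show ?thesis
  proof (intro exI[of _ P] exI[of _ C] conjI allI impI)
    show "finite P" by (rule fP)
    show "fst ` P \<subseteq> H" by (auto simp: P_def)
    fix w :: "'v \<Rightarrow> complex"
    assume w1: "\<forall>x\<in>K. norm (w x) < 1"
      and w: "\<forall>h\<in>H. \<forall>a. w (h + (\<Sum>x\<in>K. real (a x) *\<^sub>R x)) = w h * (\<Prod>x\<in>K. w x ^ a x)"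
    let ?t = "\<lambda>b. (\<Prod>x\<in>K. w x ^ b x) * (\<Prod>x | x \<in> K \<and> b x = C. 1 / (1 - w x))"
    have "(w has_sum (\<Sum>h\<in>H. w h * (\<Sum>b | b \<in> X h \<and> (\<forall>x. b x \<le> C). ?t b))) (\<Union>h\<in>H. (\<lambda>a. h + comb a) ` X h)"
    proof (rule sum_has_sum[OF H])
      fix h assume h: "h \<in> H"
      have "((\<lambda>a. w h * (\<Prod>x\<in>K. w x ^ a x)) has_sum (w h * (\<Sum>b | b \<in> X h \<and> (\<forall>x. b x \<le> C). ?t b))) (X h)"
        using w1 by (intro has_sum_cmult_right has_sum_monomials_saturated[OF K] sat[OF h]) (auto simp: X_def)
      then have "((\<lambda>a. w (h + comb a)) has_sum (w h * (\<Sum>b | b \<in> X h \<and> (\<forall>x. b x \<le> C). ?t b))) (X h)"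
        using w h by (simp add: comb_def)
      then show "(w has_sum (w h * (\<Sum>b | b \<in> X h \<and> (\<forall>x. b x \<le> C). ?t b))) ((\<lambda>a. h + comb a) ` X h)"
        using inj[OF h h] by (subst has_sum_reindex) (auto simp: inj_on_def o_def)
    next
      fix h h' assume "h \<in> H" "h' \<in> H" "h \<noteq> h'"
      then show "(\<lambda>a. h + comb a) ` X h \<inter> (\<lambda>a. h' + comb a) ` X h' = {}"
        using inj[of h h'] by auto
    qed
    moreover have "(\<Sum>h\<in>H. w h * (\<Sum>b | b \<in> X h \<and> (\<forall>x. b x \<le> C). ?t b)) = (\<Sum>(h, b)\<in>P. w h * ?t b)"
      unfolding P_def by (subst sum.Sigma[symmetric]) (use H fB in \<open>auto simp: sum_distrib_left\<close>)
    ultimately show "(w has_sum (\<Sum>(h, b)\<in>P. w h * ?t b)) {h + (\<Sum>x\<in>K. real (a x) *\<^sub>R x) | h a. h \<in> H}"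
      using UN by (simp add: comb_def)
  qed
qed


section \<open>Integer vectors and rational cones\<close>

lemma int_vec_inner: "int_vec x \<Longrightarrow> int_vec y \<Longrightarrow> x \<bullet> y \<in> \<int>"
  unfolding int_vec_def inner_vec_def by (auto intro!: Ints_sum)

lemma int_vec_add: "int_vec x \<Longrightarrow> int_vec y \<Longrightarrow> int_vec (x + y)"
  and int_vec_diff: "int_vec x \<Longrightarrow> int_vec y \<Longrightarrow> int_vec (x - y)"
  by (auto simp: int_vec_def)

lemma int_vec_axis: "int_vec (axis i 1)"
  by (auto simp: int_vec_def axis_def)

lemma int_vec_sum: "(\<And>x. x \<in> A \<Longrightarrow> int_vec (f x)) \<Longrightarrow> int_vec (\<Sum>x\<in>A. f x)"
  by (auto simp: int_vec_def intro!: Ints_sum)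

lemma int_vec_scale_nat: "int_vec x \<Longrightarrow> int_vec (real a *\<^sub>R x)"
  by (auto simp: int_vec_def)

lemma primitive_vec_int_vec: "primitive_vec k \<Longrightarrow> int_vec k"
  by (auto simp: primitive_vec_def int_vec_def)

lemma primitive_vec_nonzero: "primitive_vec k \<Longrightarrow> k \<noteq> 0"
  by (auto simp: primitive_vec_def)

lemma finite_bounded_int_vec: "finite {h :: real ^ 'n. int_vec h \<and> (\<forall>i. \<bar>h $ i\<bar> \<le> B)}"
proof (rule finite_subset)
  have fin: "finite (PiE UNIV (\<lambda>_ :: 'n. {-\<lceil>B\<rceil>..\<lceil>B\<rceil>}))" by (intro finite_PiE) auto
  then show "finite ((\<lambda>f. \<chi> i. real_of_int (f i)) ` PiE UNIV (\<lambda>_ :: 'n. {-\<lceil>B\<rceil>..\<lceil>B\<rceil>}))" by simp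
  show "{h :: real ^ 'n. int_vec h \<and> (\<forall>i. \<bar>h $ i\<bar> \<le> B)} \<subseteq>
    (\<lambda>f. \<chi> i. real_of_int (f i)) ` PiE UNIV (\<lambda>_. {-\<lceil>B\<rceil>..\<lceil>B\<rceil>})"
  proof
    fix h :: "real ^ 'n" assume "h \<in> {h. int_vec h \<and> (\<forall>i. \<bar>h $ i\<bar> \<le> B)}"
    then have h: "int_vec h" "\<And>i. \<bar>h $ i\<bar> \<le> B" by auto
    have fl: "real_of_int \<lfloor>h $ i\<rfloor> = h $ i" for i
    proof -
      have "h $ i \<in> \<int>" using h(1) by (simp add: int_vec_def)
      then show ?thesis by (elim Ints_cases) simp
    qed
    show "h \<in> (\<lambda>f. \<chi> i. real_of_int (f i)) ` PiE UNIV (\<lambda>_. {-\<lceil>B\<rceil>..\<lceil>B\<rceil>})"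
    proof (rule image_eqI)
      show "h = (\<chi> i. real_of_int \<lfloor>h $ i\<rfloor>)" by (simp add: vec_eq_iff fl)
      have "- \<lceil>B\<rceil> \<le> \<lfloor>h $ i\<rfloor> \<and> \<lfloor>h $ i\<rfloor> \<le> \<lceil>B\<rceil>" for i
        using h(2)[of i] fl[of i] by linarith
      then show "(\<lambda>i. \<lfloor>h $ i\<rfloor>) \<in> PiE UNIV (\<lambda>_. {-\<lceil>B\<rceil>..\<lceil>B\<rceil>})" by auto
    qed
  qed
qed

lemma finite_int_vec_bounded_comb:
  fixes B :: "(real ^ 'n::finite) set"
  shows "finite {h. int_vec h \<and> (\<exists>c. (\<forall>x\<in>B. 0 \<le> c x \<and> c x \<le> 1) \<and> h = (\<Sum>x\<in>B. c x *\<^sub>R x))}"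
proof (rule finite_subset[OF subsetI finite_bounded_int_vec])
  fix h assume "h \<in> {h. int_vec h \<and> (\<exists>c. (\<forall>x\<in>B. 0 \<le> c x \<and> c x \<le> 1) \<and> h = (\<Sum>x\<in>B. c x *\<^sub>R x))}"
  then obtain c where c: "int_vec h" "\<And>x. x \<in> B \<Longrightarrow> 0 \<le> c x \<and> c x \<le> 1" "h = (\<Sum>x\<in>B. c x *\<^sub>R x)" by blast
  have "\<bar>h $ i\<bar> \<le> (\<Sum>x\<in>B. \<Sum>j\<in>UNIV. \<bar>x $ j\<bar>)" for i
  proof -
    have "\<bar>h $ i\<bar> \<le> (\<Sum>x\<in>B. \<bar>c x * x $ i\<bar>)" unfolding c(3) by (simp add: sum_abs)
    also have "\<dots> \<le> (\<Sum>x\<in>B. \<bar>x $ i\<bar>)"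
      using c(2) by (intro sum_mono) (auto simp: abs_mult mult_left_le_one_le)
    also have "\<dots> \<le> (\<Sum>x\<in>B. \<Sum>j\<in>UNIV. \<bar>x $ j\<bar>)" by (intro sum_mono, rule member_le_sum[of i UNIV]) auto
    finally show ?thesis .
  qed
  then show "h \<in> {h. int_vec h \<and> (\<forall>i. \<bar>h $ i\<bar> \<le> (\<Sum>x\<in>B. \<Sum>j\<in>UNIV. \<bar>x $ j\<bar>))}" using c(1) by simp
qed

text \<open>The ratio is a quotient of integer coordinates. In lowest terms its denominator divides
  every coordinate of \<open>r\<close> and its numerator every coordinate of \<open>r'\<close>, so
  primitivity makes both equal to one.\<close>

lemma primitive_vec_multiple_unique:
  assumes "primitive_vec r" "primitive_vec r'" "c > 0" "r' = c *\<^sub>R r"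
  shows "r' = r"
proof -
  obtain y z where y: "\<And>i. r $ i = of_int (y i)" "Gcd (range y) = (1::int)"
    and z: "\<And>i. r' $ i = of_int (z i)" "Gcd (range z) = (1::int)"
    using assms(1,2) unfolding primitive_vec_def by blast
  have zy: "of_int (z i) = c * of_int (y i)" for i
    using assms(4) y(1)[of i] z(1)[of i] by simp
  obtain j where j: "y j \<noteq> 0" using y(2) by (metis Gcd_0_iff image_subset_iff insertCI zero_neq_one)
  have "c = of_int (z j) / of_int (y j)" using zy[of j] j by simp
  then have "c \<in> \<rat>" by simp
  then obtain a b where ab: "b > 0" "coprime a b" "c = of_int a / of_int b" by (rule Rats_cases')
  have eq: "b * z i = a * y i" for i
  proof -
    have "of_int (b * z i) = (of_int (a * y i) :: real)" using zy[of i] ab by simp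
    then show ?thesis by linarith
  qed
  have "b dvd y i" for i
    using eq[of i] ab(2) by (metis coprime_commute coprime_dvd_mult_right_iff dvd_triv_left)
  then have "b dvd 1" unfolding y(2)[symmetric] by (intro Gcd_greatest) auto
  have "a dvd z i" for i
    using eq[of i] ab(2) by (metis coprime_dvd_mult_right_iff dvd_triv_left)
  then have "a dvd 1" unfolding z(2)[symmetric] by (intro Gcd_greatest) auto
  have "a > 0" using assms(3) ab by (simp add: zero_less_divide_iff)
  then have "c = 1" using \<open>a dvd 1\<close> \<open>b dvd 1\<close> ab by simp
  then show ?thesis using assms(4) by simp
qed

lemma ex_primitive_vec:
  assumes "int_vec z" "z \<noteq> 0"
  shows "\<exists>r d. primitive_vec r \<and> d > 0 \<and> z = d *\<^sub>R r"
proof -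
  have "\<forall>i. \<exists>y. z $ i = real_of_int y" using assms(1) by (auto simp: int_vec_def elim: Ints_cases)
  then obtain y where y: "\<And>i. z $ i = real_of_int (y i)" by metis
  define d where "d = Gcd (range y)"
  have "d \<noteq> 0"
  proof
    assume "d = 0"
    then have "y i = 0" for i unfolding d_def by (auto simp: Gcd_0_iff)
    then show False using assms(2) y by (simp add: vec_eq_iff)
  qed
  moreover have "d \<ge> 0" by (simp add: d_def)
  ultimately have d: "d > 0" by simp
  have dvd: "d dvd y i" for i unfolding d_def by auto
  define x where "x i = y i div d" for i
  have yx: "y i = d * x i" for i using dvd by (simp add: x_def)
  have "range y = (*) d ` range x" using yx by auto
  then have "d = normalize (d * Gcd (range x))" unfolding d_def using Gcd_mult[of d "range x"] d_def by simp
  then have "Gcd (range x) = 1" using d by (simp add: abs_mult)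
  then have "primitive_vec (\<chi> i. real_of_int (x i))" unfolding primitive_vec_def by auto
  moreover have "z = real_of_int d *\<^sub>R (\<chi> i. real_of_int (x i))"
    using y yx by (simp add: vec_eq_iff)
  ultimately show ?thesis using d by (intro exI[of _ "\<chi> i. real_of_int (x i)"] exI[of _ "real_of_int d"]) auto
qed

lemma strict_cone_single: "strict_cone {r} = {c *\<^sub>R r | c. c > 0}"
proof (intro equalityI subsetI)
  fix x assume "x \<in> {c *\<^sub>R r | c. c > 0}"
  then obtain c where "c > 0" "x = c *\<^sub>R r" by blast
  then show "x \<in> strict_cone {r}"
    unfolding strict_cone_def by (intro CollectI exI[of _ "\<lambda>_. c"]) simp
qed (auto simp: strict_cone_def)

section \<open>Cells and rays of a cone given by linear inequalities\<close>

definition halfspace_cone :: "(real ^ 'n) set \<Rightarrow> (real ^ 'n) set" where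
  "halfspace_cone L = {k. \<forall>l\<in>L. 0 \<le> l \<bullet> k}"

definition tight :: "(real ^ 'n) set \<Rightarrow> real ^ 'n \<Rightarrow> (real ^ 'n) set" where
  "tight L k = {l \<in> L. l \<bullet> k = 0}"

text \<open>For \<open>k\<close> in the cone this is the relative interior of the smallest face that
  contains \<open>k\<close>.\<close>

definition cell :: "(real ^ 'n) set \<Rightarrow> real ^ 'n \<Rightarrow> (real ^ 'n) set" where
  "cell L k = {k' \<in> halfspace_cone L. tight L k' = tight L k}"

definition cell_rays :: "(real ^ 'n) set \<Rightarrow> (real ^ 'n) set" where
  "cell_rays L = {r \<in> halfspace_cone L. primitive_vec r \<and> cell L r = strict_cone {r}}"

lemma tight_scale: "c > 0 \<Longrightarrow> tight L (c *\<^sub>R k) = tight L k"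
  by (auto simp: tight_def)

lemma halfspace_cone_scale: "c > 0 \<Longrightarrow> c *\<^sub>R k \<in> halfspace_cone L \<longleftrightarrow> k \<in> halfspace_cone L"
  by (auto simp: halfspace_cone_def zero_le_mult_iff)

text \<open>A simultaneous Dirichlet approximation of a large multiple lies in the same cell.\<close>

lemma ex_int_vec_in_cell:
  fixes k :: "real ^ 'n::finite"
  assumes L: "finite L" "\<And>l. l \<in> L \<Longrightarrow> int_vec l" and k: "k \<in> halfspace_cone L"
  shows "\<exists>z \<in> cell L k. int_vec z"
proof -
  define T where "T l = (\<Sum>i\<in>UNIV. \<bar>l $ i\<bar>)" for l :: "real ^ 'n"
  define E where "E l = (if l \<bullet> k = 0 then 1 else l \<bullet> k)" for l
  have E: "E l > 0" if "l \<in> L" for l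
    using k that unfolding E_def halfspace_cone_def by (auto simp: less_le)
  define N where "N = Suc (nat \<lceil>\<Sum>l\<in>L. T l / E l\<rceil>)"
  have N: "T l / real N < E l" if l: "l \<in> L" for l
  proof -
    have "T l / E l \<le> (\<Sum>l\<in>L. T l / E l)"
      by (rule member_le_sum[where f = "\<lambda>l. T l / E l"])
        (use l L(1) E in \<open>auto simp: T_def intro!: divide_nonneg_pos sum_nonneg\<close>)
    also have "\<dots> < real N" unfolding N_def by linarith
    finally show ?thesis using E[OF l] by (simp add: field_simps N_def)
  qed
  obtain e where e: "bij_betw e {..<CARD('n)} (UNIV :: 'n set)"
    using bij_betw_from_nat_into_finite[of "UNIV :: 'n set"] by auto
  obtain q p where q: "0 < q" and p: "\<And>i. i < CARD('n) \<Longrightarrow> \<bar>of_int q * (k $ e i) - of_int (p i)\<bar> < 1 / real N"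
    using Dirichlet_approx_simult[of N "CARD('n)" "\<lambda>i. k $ e i"] unfolding N_def by (metis zero_less_Suc)
  define z where "z = (\<chi> i. real_of_int (p (the_inv_into {..<CARD('n)} e i)))"
  have z: "\<bar>of_int q * k $ i - z $ i\<bar> < 1 / real N" for i
  proof -
    have "i \<in> e ` {..<CARD('n)}" using e by (auto simp: bij_betw_def)
    then obtain m where m: "m < CARD('n)" "i = e m" by auto
    then show ?thesis using p[OF m(1)] e by (simp add: z_def bij_betw_def the_inv_into_f_f)
  qed
  have iz: "int_vec z" by (simp add: z_def int_vec_def)
  have close: "\<bar>of_int q * (l \<bullet> k) - l \<bullet> z\<bar> < E l" if l: "l \<in> L" for l
  proof -
    have "of_int q * (l \<bullet> k) - l \<bullet> z = (\<Sum>i\<in>UNIV. l $ i * (of_int q * k $ i - z $ i))"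
      by (simp add: inner_vec_def sum_distrib_left sum_subtractf algebra_simps)
    also have "\<bar>\<dots>\<bar> \<le> (\<Sum>i\<in>UNIV. \<bar>l $ i\<bar> * (1 / real N))"
    proof (rule order_trans[OF sum_abs], rule sum_mono)
      fix i
      show "\<bar>l $ i * (of_int q * k $ i - z $ i)\<bar> \<le> \<bar>l $ i\<bar> * (1 / real N)"
        unfolding abs_mult by (rule mult_left_mono[OF less_imp_le[OF z]]) simp
    qed
    also have "\<dots> = T l / real N" by (simp add: T_def sum_divide_distrib)
    also have "\<dots> < E l" by (rule N[OF l])
    finally show ?thesis .
  qed
  have zero: "l \<bullet> z = 0" if l: "l \<in> L" "l \<bullet> k = 0" for l
    using close[OF l(1)] l(2) int_vec_inner[OF L(2)[OF l(1)] iz] by (auto simp: E_def elim!: Ints_cases)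
  have pos: "l \<bullet> z > 0" if l: "l \<in> L" "l \<bullet> k \<noteq> 0" for l
  proof -
    have "l \<bullet> k > 0" using k l by (auto simp: halfspace_cone_def less_le)
    then have "of_int q * (l \<bullet> k) \<ge> l \<bullet> k" using q by (simp add: mult_le_cancel_right1)
    then show ?thesis using close[OF l(1)] l(2) by (simp add: E_def)
  qed
  have "z \<in> cell L k"
    unfolding cell_def halfspace_cone_def tight_def using zero pos by (force simp: less_imp_le)
  then show ?thesis using iz by blast
qed

text \<open>Walk from \<open>k\<close> in direction \<open>d\<close> until the first constraint that
  decreases along \<open>d\<close> becomes tight. The constraints tight at \<open>k\<close> are
  orthogonal to \<open>d\<close> and remain tight.\<close>

lemma halfspace_cone_move:
  assumes L: "finite L" and k: "k \<in> halfspace_cone L"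
    and d: "\<And>l. l \<in> tight L k \<Longrightarrow> l \<bullet> d = 0" and ex: "\<exists>l\<in>L. l \<bullet> d < 0"
  shows "\<exists>t>0. k + t *\<^sub>R d \<in> halfspace_cone L \<and> tight L k \<subset> tight L (k + t *\<^sub>R d)"
proof -
  let ?A = "{l\<in>L. l \<bullet> d < 0}"
  let ?q = "\<lambda>l. (l \<bullet> k) / - (l \<bullet> d)"
  have fin: "finite (?q ` ?A)" "?q ` ?A \<noteq> {}" using L ex by auto
  define t where "t = Min (?q ` ?A)"
  have "t \<in> ?q ` ?A" unfolding t_def by (rule Min_in[OF fin])
  then obtain l0 where l0: "l0 \<in> L" "l0 \<bullet> d < 0" "t = ?q l0" by auto
  have kpos: "l \<bullet> k > 0" if "l \<in> L" "l \<bullet> d < 0" for l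
  proof -
    have "l \<bullet> k \<noteq> 0" using d[of l] that by (auto simp: tight_def)
    moreover have "0 \<le> l \<bullet> k" using k that by (auto simp: halfspace_cone_def)
    ultimately show ?thesis by linarith
  qed
  have t: "t > 0" unfolding l0(3) by (rule divide_pos_pos) (use kpos[OF l0(1,2)] l0(2) in auto)
  have le: "t \<le> ?q l" if "l \<in> L" "l \<bullet> d < 0" for l
    unfolding t_def by (rule Min_le[OF fin(1)]) (use that in auto)
  have "l \<bullet> (k + t *\<^sub>R d) \<ge> 0" if l: "l \<in> L" for l
  proof (cases "l \<bullet> d < 0")
    case True
    then have "t * - (l \<bullet> d) \<le> l \<bullet> k"
      using le[OF l True] pos_le_divide_eq[of "- (l \<bullet> d)" t "l \<bullet> k"] by linarith
    then show ?thesis by (simp add: inner_add_right)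
  next
    case False
    then show ?thesis using k l t by (auto simp: halfspace_cone_def inner_add_right)
  qed
  moreover have "l0 \<in> tight L (k + t *\<^sub>R d)" "l0 \<notin> tight L k"
  proof -
    have "t * (l0 \<bullet> d) = - (l0 \<bullet> k)" unfolding l0(3) using l0(2) by simp
    then show "l0 \<in> tight L (k + t *\<^sub>R d)" using l0(1) by (simp add: tight_def inner_add_right)
    show "l0 \<notin> tight L k" using kpos[OF l0(1,2)] by (simp add: tight_def)
  qed
  moreover have "tight L k \<subseteq> tight L (k + t *\<^sub>R d)"
    using d by (auto simp: tight_def inner_add_right)
  ultimately show ?thesis using t by (intro exI[of _ t]) (auto simp: halfspace_cone_def)
qed

text \<open>The unit vectors among the constraints place the cone in the nonnegative orthant. The
  cone is therefore pointed, and \<open>sigma\<close> is positive on it away from the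
  origin.\<close>

locale integral_cone =
  fixes L :: "(real ^ 'n::finite) set"
  assumes finite_L: "finite L" and int_L: "\<And>l. l \<in> L \<Longrightarrow> int_vec l"
    and axis_L: "\<And>i. axis i 1 \<in> L"
begin

lemma nonneg: "k \<in> halfspace_cone L \<Longrightarrow> 0 \<le> k $ i"
  using axis_L[of i] by (auto simp: halfspace_cone_def inner_axis')

lemma sigma_pos:
  assumes "k \<in> halfspace_cone L" "k \<noteq> 0"
  shows "sigma k > 0"
proof -
  obtain i where "k $ i \<noteq> 0" using assms(2) by (auto simp: vec_eq_iff)
  then have "k $ i > 0" using nonneg[OF assms(1), of i] by linarith
  then show ?thesis unfolding sigma_def by (intro sum_pos2[of UNIV i]) (auto simp: nonneg[OF assms(1)])
qed

text \<open>A ray is determined by its set of tight constraints, and its primitive generator is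
  unique.\<close>

lemma finite_cell_rays: "finite (cell_rays L)"
proof (rule finite_imageD)
  show "finite (tight L ` cell_rays L)"
    by (rule finite_subset[of _ "Pow L"]) (auto simp: tight_def finite_L)
  show "inj_on (tight L) (cell_rays L)"
  proof (rule inj_onI)
    fix r r' assume r: "r \<in> cell_rays L" "r' \<in> cell_rays L" "tight L r = tight L r'"
    then have "r' \<in> strict_cone {r}" unfolding cell_rays_def cell_def by auto
    then obtain c where "c > 0" "r' = c *\<^sub>R r" by (auto simp: strict_cone_single)
    then show "r = r'" using primitive_vec_multiple_unique[of r r' c] r(1,2) by (simp add: cell_rays_def)
  qed
qed

text \<open>A point whose cell is not a ray lies on a segment of constant \<open>sigma\<close> that joins two points of
  smaller cells.\<close>

lemma decompose:
  assumes "k \<in> halfspace_cone L"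
  shows "\<exists>c. (\<forall>r. 0 \<le> c r) \<and> k = (\<Sum>r\<in>cell_rays L. c r *\<^sub>R r)"
  using assms
proof (induction "card (L - tight L k)" arbitrary: k rule: less_induct)
  case less
  note k = less.prems
  show ?case
  proof (cases "k = 0")
    case True
    then show ?thesis by (intro exI[of _ "\<lambda>_. 0"]) auto
  next
    case k0: False
    show ?thesis
    proof (cases "cell L k \<subseteq> strict_cone {k}")
      case True
      \<comment> \<open>A cell that is a half-line has a rational direction because it contains a
        lattice point.\<close>
      obtain z where z: "z \<in> cell L k" "int_vec z"
        using ex_int_vec_in_cell[OF finite_L int_L k] by blast
      then obtain c where c: "c > 0" "z = c *\<^sub>R k" using True by (auto simp: strict_cone_single)
      obtain r d where r: "primitive_vec r" "d > 0" "z = d *\<^sub>R r"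
        using ex_primitive_vec[OF z(2)] c k0 by auto
      have "r = (1 / d) *\<^sub>R (d *\<^sub>R r)" using r(2) by simp
      also have "\<dots> = (c / d) *\<^sub>R k" unfolding r(3)[symmetric] c(2) by simp
      finally have rk1: "r = (c / d) *\<^sub>R k" .
      have "k = (1 / c) *\<^sub>R (c *\<^sub>R k)" using c(1) by simp
      also have "\<dots> = (d / c) *\<^sub>R r" unfolding c(2)[symmetric] r(3) by simp
      finally have rk3: "k = (d / c) *\<^sub>R r" .
      have rk2: "c / d > 0" "d / c > 0" using c(1) r(2) by simp_all
      have "r \<in> halfspace_cone L" unfolding rk1 halfspace_cone_scale[OF rk2(1)] by (rule k)
      moreover have "cell L r = cell L k" unfolding cell_def rk1 tight_scale[OF rk2(1)] ..
      moreover have "strict_cone {k} \<subseteq> cell L k"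
        using k by (auto simp: strict_cone_single cell_def tight_scale halfspace_cone_scale)
      moreover have "strict_cone {k} = strict_cone {r}"
      proof (intro equalityI subsetI)
        fix x assume "x \<in> strict_cone {k}"
        then obtain t where "t > 0" "x = t *\<^sub>R k" by (auto simp: strict_cone_single)
        then have "t * (d / c) > 0" and "x = (t * (d / c)) *\<^sub>R r"
          using mult_pos_pos[OF _ rk2(2)] arg_cong[OF rk3, of "\<lambda>y. t *\<^sub>R y"] by simp_all
        then show "x \<in> strict_cone {r}" unfolding strict_cone_single by blast
      next
        fix x assume "x \<in> strict_cone {r}"
        then obtain t where "t > 0" "x = t *\<^sub>R r" by (auto simp: strict_cone_single)
        then have "t * (c / d) > 0" and "x = (t * (c / d)) *\<^sub>R k"
          using mult_pos_pos[OF _ rk2(1)] arg_cong[OF rk1, of "\<lambda>y. t *\<^sub>R y"] by simp_all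
        then show "x \<in> strict_cone {k}" unfolding strict_cone_single by blast
      qed
      ultimately have "r \<in> cell_rays L" using r True by (auto simp: cell_rays_def)
      then have "(\<Sum>x\<in>cell_rays L. (if x = r then d / c else 0) *\<^sub>R x) = (d / c) *\<^sub>R r"
        using finite_cell_rays by (simp add: if_distrib[of "\<lambda>c. c *\<^sub>R _"] cong: if_cong)
      then show ?thesis using rk3 rk2
        by (intro exI[of _ "\<lambda>x. if x = r then d / c else 0"] conjI allI) (simp_all del: if_distrib)
    next
      case False
      then obtain k' where k': "k' \<in> cell L k" "k' \<notin> strict_cone {k}" by blast
      have k'h: "k' \<in> halfspace_cone L" using k' by (simp add: cell_def)
      obtain i where "k $ i \<noteq> 0" using k0 by (auto simp: vec_eq_iff)
      then have "axis i 1 \<notin> tight L k" by (simp add: tight_def inner_axis')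
      then have "axis i 1 \<notin> tight L k'" using k' by (simp add: cell_def)
      then have "k' \<noteq> 0" using axis_L by (auto simp: tight_def)
      then have s: "sigma k' > 0" "sigma k > 0" using sigma_pos k k'h k0 by auto
      \<comment> \<open>Scaling \<open>k'\<close> to the value of \<open>sigma\<close> at
        \<open>k\<close> makes the coordinates of \<open>d\<close> sum to zero. Since
        \<open>d\<close> is nonzero, it has coordinates of both signs, so the line through
        \<open>k\<close> leaves the orthant, and hence the cone, in both directions.\<close>
      define c where "c = sigma k / sigma k'"
      have c: "c > 0" using s by (simp add: c_def)
      define d where "d = c *\<^sub>R k' - k"
      have "d \<noteq> 0"
      proof
        assume "d = 0"
        then have "c *\<^sub>R k' = k" by (simp add: d_def)
        then have "k' = (1 / c) *\<^sub>R k" using c by (simp flip: \<open>c *\<^sub>R k' = k\<close>)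
        moreover have "1 / c > 0" using c by simp
        ultimately show False using k'(2) unfolding strict_cone_single by blast
      qed
      have "sigma d = c * sigma k' - sigma k"
        by (simp add: d_def sigma_def sum_subtractf sum_distrib_left)
      then have d0: "(\<Sum>i\<in>UNIV. d $ i) = 0" using s by (simp add: c_def sigma_def)
      obtain j where j: "d $ j \<noteq> 0" using \<open>d \<noteq> 0\<close> by (auto simp: vec_eq_iff)
      have neg: "\<exists>i. d $ i < 0"
      proof (rule ccontr)
        assume "\<nexists>i. d $ i < 0"
        then have "\<forall>i\<in>UNIV. d $ i = 0" using d0 by (subst (asm) sum_nonneg_eq_0_iff) (auto simp: not_less)
        then show False using j by simp
      qed
      have pos: "\<exists>i. d $ i > 0"
      proof (rule ccontr)
        assume "\<nexists>i. d $ i > 0"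
        moreover have "(\<Sum>i\<in>UNIV. - (d $ i)) = 0" using d0 by (simp add: sum_negf)
        ultimately have "\<forall>i\<in>UNIV. - (d $ i) = 0" by (subst (asm) sum_nonneg_eq_0_iff) (auto simp: not_less)
        then show False using j by simp
      qed
      have tz: "l \<bullet> d = 0" if "l \<in> tight L k" for l
      proof -
        have "l \<in> tight L k'" using that k' by (simp add: cell_def)
        then show ?thesis using that by (simp add: d_def tight_def inner_diff_right)
      qed
      have "\<exists>l\<in>L. l \<bullet> d < 0" using neg axis_L by (auto simp: inner_axis' intro!: bexI[of _ "axis _ 1"])
      then obtain t where t: "t > 0" "k + t *\<^sub>R d \<in> halfspace_cone L" "tight L k \<subset> tight L (k + t *\<^sub>R d)"
        using halfspace_cone_move[OF finite_L k tz] by blast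
      have "\<exists>l\<in>L. l \<bullet> (- d) < 0" using pos axis_L by (auto simp: inner_axis' intro!: bexI[of _ "axis _ 1"])
      then obtain u where u: "u > 0" "k + u *\<^sub>R (- d) \<in> halfspace_cone L" "tight L k \<subset> tight L (k + u *\<^sub>R (- d))"
        using halfspace_cone_move[OF finite_L k, of "- d"] tz by auto
      have smaller: "card (L - tight L k') < card (L - tight L k)" if "tight L k \<subset> tight L k'" for k'
        using that finite_L by (intro psubset_card_mono) (auto simp: tight_def)
      obtain a where a: "\<forall>r. 0 \<le> a r" "k + t *\<^sub>R d = (\<Sum>r\<in>cell_rays L. a r *\<^sub>R r)"
        using less.hyps[OF smaller[OF t(3)] t(2)] by blast
      obtain b where b: "\<forall>r. 0 \<le> b r" "k + u *\<^sub>R (- d) = (\<Sum>r\<in>cell_rays L. b r *\<^sub>R r)"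
        using less.hyps[OF smaller[OF u(3)] u(2)] by blast
      have "(u + t) *\<^sub>R k = u *\<^sub>R (k + t *\<^sub>R d) + t *\<^sub>R (k + u *\<^sub>R (- d))"
        by (simp add: algebra_simps)
      also have "\<dots> = (\<Sum>r\<in>cell_rays L. (u * a r + t * b r) *\<^sub>R r)"
        unfolding a(2) b(2) by (simp add: scaleR_sum_right sum.distrib scaleR_left_distrib)
      finally have *: "(u + t) *\<^sub>R k = (\<Sum>r\<in>cell_rays L. (u * a r + t * b r) *\<^sub>R r)" .
      have "k = (1 / (u + t)) *\<^sub>R ((u + t) *\<^sub>R k)" using t(1) u(1) by simp
      also have "\<dots> = (1 / (u + t)) *\<^sub>R (\<Sum>r\<in>cell_rays L. (u * a r + t * b r) *\<^sub>R r)"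
        by (simp only: *)
      also have "\<dots> = (\<Sum>r\<in>cell_rays L. ((u * a r + t * b r) / (u + t)) *\<^sub>R r)"
        by (simp add: scaleR_sum_right)
      finally show ?thesis using a(1) b(1) t(1) u(1)
        by (intro exI[of _ "\<lambda>r. (u * a r + t * b r) / (u + t)"]) auto
    qed
  qed
qed

text \<open>For \<open>k\<close> in the cone, the closure of its cell is the face on which the
  constraints tight at \<open>k\<close> stay tight; these are the primitive generators of the rays
  of that face.\<close>

definition closure_rays :: "real ^ 'n \<Rightarrow> (real ^ 'n) set" where
  "closure_rays k = {r \<in> cell_rays L. tight L k \<subseteq> tight L r}"

text \<open>A sum of nonnegative terms vanishes only if every term does, so tightness depends on the
  support of the coefficients and not on their size.\<close>

lemma nonneg_comb_tight:
  assumes R: "finite R" "R \<subseteq> halfspace_cone L" and c: "\<And>r. r \<in> R \<Longrightarrow> 0 \<le> c r"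
  shows "(\<Sum>r\<in>R. c r *\<^sub>R r) \<in> halfspace_cone L"
    and "tight L (\<Sum>r\<in>R. c r *\<^sub>R r) = {l \<in> L. \<forall>r\<in>R. c r \<noteq> 0 \<longrightarrow> l \<bullet> r = 0}"
proof -
  have 0: "0 \<le> c r * (l \<bullet> r)" if "l \<in> L" "r \<in> R" for l r
    using R c that by (auto simp: halfspace_cone_def subset_iff)
  have eq: "l \<bullet> (\<Sum>r\<in>R. c r *\<^sub>R r) = (\<Sum>r\<in>R. c r * (l \<bullet> r))" for l
    by (simp add: inner_sum_right)
  show "(\<Sum>r\<in>R. c r *\<^sub>R r) \<in> halfspace_cone L"
    unfolding halfspace_cone_def by (auto simp: eq intro!: sum_nonneg 0)
  have "l \<bullet> (\<Sum>r\<in>R. c r *\<^sub>R r) = 0 \<longleftrightarrow> (\<forall>r\<in>R. c r \<noteq> 0 \<longrightarrow> l \<bullet> r = 0)" if "l \<in> L" for l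
    unfolding eq using 0[OF that] by (subst sum_nonneg_eq_0_iff[OF R(1)]) auto
  then show "tight L (\<Sum>r\<in>R. c r *\<^sub>R r) = {l \<in> L. \<forall>r\<in>R. c r \<noteq> 0 \<longrightarrow> l \<bullet> r = 0}"
    unfolding tight_def by blast
qed

lemma finite_closure_rays: "finite (closure_rays k)"
  using finite_cell_rays by (simp add: closure_rays_def)

lemma closure_rays_subset: "closure_rays k \<subseteq> halfspace_cone L"
  by (auto simp: closure_rays_def cell_rays_def)

lemma int_vec_closure_rays: "r \<in> closure_rays k \<Longrightarrow> int_vec r"
  by (auto simp: closure_rays_def cell_rays_def primitive_vec_int_vec)

lemma cell_add_closure_rays:
  assumes h: "h \<in> cell L k" and a: "\<And>r. r \<in> closure_rays k \<Longrightarrow> 0 \<le> a r"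
  shows "h + (\<Sum>r\<in>closure_rays k. a r *\<^sub>R r) \<in> cell L k"
proof -
  let ?y = "\<Sum>r\<in>closure_rays k. a r *\<^sub>R r"
  note y = nonneg_comb_tight[OF finite_closure_rays closure_rays_subset a]
  have hh: "h \<in> halfspace_cone L" "tight L h = tight L k" using h by (auto simp: cell_def)
  have "h + ?y \<in> halfspace_cone L"
    using hh(1) y(1) by (auto simp: halfspace_cone_def inner_add_right)
  moreover have "tight L k \<subseteq> tight L ?y"
  proof
    fix l assume l: "l \<in> tight L k"
    then have "l \<bullet> r = 0" if "r \<in> closure_rays k" for r
      using that by (auto simp: closure_rays_def tight_def)
    then show "l \<in> tight L ?y" using l by (simp add: tight_def inner_sum_right)
  qed
  then have "tight L (h + ?y) = tight L k"
    using hh y(1) unfolding hh(2)[symmetric]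
    by (auto simp: tight_def halfspace_cone_def inner_add_right add_nonneg_eq_0_iff)
  ultimately show ?thesis by (simp add: cell_def)
qed

text \<open>Gordan's lemma for a relatively open cone: its lattice points are finitely generated as
  a set acted on by the monoid of the ray generators of the closure.\<close>

lemma int_vec_cell_generated:
  assumes k0: "k0 \<in> halfspace_cone L"
  shows "\<exists>H. finite H \<and> H \<subseteq> {k \<in> cell L k0. int_vec k} \<and>
    {k \<in> cell L k0. int_vec k} = {h + (\<Sum>r\<in>closure_rays k0. real (a r) *\<^sub>R r) | h a. h \<in> H}"
proof -
  let ?K = "closure_rays k0" and ?M = "{k \<in> cell L k0. int_vec k}"
  note fK = finite_closure_rays[of k0]
  define H where "H = {h \<in> ?M. \<exists>m. (\<forall>r\<in>?K. 0 \<le> m r \<and> m r \<le> 1) \<and> h = (\<Sum>r\<in>?K. m r *\<^sub>R r)}"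
  have "finite H"
    by (rule finite_subset[OF _ finite_int_vec_bounded_comb[of ?K]]) (auto simp: H_def)
  moreover have "?M = {h + (\<Sum>r\<in>?K. real (a r) *\<^sub>R r) | h a. h \<in> H}"
  proof (intro equalityI subsetI)
    fix k assume k: "k \<in> ?M"
    then have kh: "k \<in> halfspace_cone L" "tight L k = tight L k0" by (auto simp: cell_def)
    obtain c where c: "\<forall>r. 0 \<le> c r" "k = (\<Sum>r\<in>cell_rays L. c r *\<^sub>R r)"
      using decompose[OF kh(1)] by blast
    have sub: "cell_rays L \<subseteq> halfspace_cone L" by (auto simp: cell_rays_def)
    have t1: "tight L k = {l \<in> L. \<forall>r\<in>cell_rays L. c r \<noteq> 0 \<longrightarrow> l \<bullet> r = 0}"
      using nonneg_comb_tight(2)[OF finite_cell_rays sub, of c] c by simp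
    have in_K: "r \<in> ?K" if "r \<in> cell_rays L" "c r \<noteq> 0" for r
      using that t1 kh(2) by (auto simp: closure_rays_def tight_def)
    have kK: "k = (\<Sum>r\<in>?K. c r *\<^sub>R r)"
      unfolding c(2) by (rule sum.mono_neutral_right[OF finite_cell_rays])
        (use in_K in \<open>auto simp: closure_rays_def\<close>)
    \<comment> \<open>Rounding with the ceiling minus one leaves a remainder in (0, 1] for every
      positive coefficient and 0 for the coefficient 0. The support is kept, so the remainder stays
      in the same cell; with the floor it could drop to the boundary.\<close>
    define a where "a r = nat \<lceil>c r\<rceil> - 1" for r
    define m where "m r = c r - real (a r)" for r
    have m: "0 \<le> m r" "m r \<le> 1" "m r = 0 \<longleftrightarrow> c r = 0" for r
      using c(1)[rule_format, of r] unfolding m_def a_def by linarith+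
    define h where "h = (\<Sum>r\<in>?K. m r *\<^sub>R r)"
    have kh2: "k = h + (\<Sum>r\<in>?K. real (a r) *\<^sub>R r)"
      unfolding kK h_def by (simp add: m_def scaleR_left_diff_distrib sum_subtractf)
    have "int_vec h"
    proof -
      have "h = k - (\<Sum>r\<in>?K. real (a r) *\<^sub>R r)" using kh2 by simp
      then show ?thesis using k
        by (simp add: int_vec_diff int_vec_sum int_vec_scale_nat int_vec_closure_rays)
    qed
    moreover have "h \<in> cell L k0"
    proof -
      note comb = nonneg_comb_tight[OF finite_closure_rays closure_rays_subset]
      have "tight L k = {l \<in> L. \<forall>r\<in>?K. c r \<noteq> 0 \<longrightarrow> l \<bullet> r = 0}"
        unfolding kK by (rule comb(2)) (simp add: c(1))
      moreover have "tight L h = {l \<in> L. \<forall>r\<in>?K. m r \<noteq> 0 \<longrightarrow> l \<bullet> r = 0}"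
        unfolding h_def by (rule comb(2)) (rule m(1))
      moreover have "h \<in> halfspace_cone L"
        unfolding h_def by (rule comb(1)) (rule m(1))
      ultimately show ?thesis using kh(2) by (simp add: cell_def m(3))
    qed
    moreover have "\<forall>r\<in>?K. 0 \<le> m r \<and> m r \<le> 1" using m by simp
    ultimately have "h \<in> H" using h_def unfolding H_def by blast
    then show "k \<in> {h + (\<Sum>r\<in>?K. real (a r) *\<^sub>R r) | h a. h \<in> H}" using kh2 by blast
  next
    fix k assume "k \<in> {h + (\<Sum>r\<in>?K. real (a r) *\<^sub>R r) | h a. h \<in> H}"
    then obtain h a where *: "h \<in> H" "k = h + (\<Sum>r\<in>?K. real (a r) *\<^sub>R r)" by blast
    then have h: "h \<in> cell L k0" "int_vec h" by (auto simp: H_def)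
    have "k \<in> cell L k0" unfolding *(2) by (rule cell_add_closure_rays[OF h(1)]) simp
    moreover have "int_vec k" unfolding *(2)
      by (intro int_vec_add h(2) int_vec_sum int_vec_scale_nat int_vec_closure_rays)
    ultimately show "k \<in> ?M" by simp
  qed
  moreover have "H \<subseteq> ?M" by (auto simp: H_def)
  ultimately show ?thesis by blast
qed

end


section \<open>Newton polyhedra and their dual partition\<close>

definition min_verts :: "(real ^ 'n) set \<Rightarrow> real ^ 'n \<Rightarrow> (real ^ 'n) set" where
  "min_verts V k = {v \<in> V. \<forall>v'\<in>V. k \<bullet> v \<le> k \<bullet> v'}"

lemma orthant_inner_nonneg: "k \<in> orthant \<Longrightarrow> w \<in> orthant \<Longrightarrow> 0 \<le> k \<bullet> w"
  by (auto simp: orthant_def inner_vec_def intro!: sum_nonneg)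

lemma diff_inner: "(x - y) \<bullet> k = k \<bullet> x - k \<bullet> (y :: 'a::real_inner)"
  by (subst inner_commute) (rule inner_diff_right)

lemma convex_orthant: "convex orthant"
  by (auto simp: convex_def orthant_def)

text \<open>Common axioms for the two polyhedra, of which one is built from orthants and the other
  from lattice points. The inclusion in the hull of \<open>V\<close> plus the orthant places minima
  at points of \<open>V\<close>; the points \<open>v + axis i 1\<close> detect which coordinates of
  \<open>k\<close> vanish.\<close>

locale newton_polyhedron =
  fixes \<Gamma> V :: "(real ^ 'n::finite) set"
  assumes finite_V: "finite V" and V_nonempty: "V \<noteq> {}" and V_sub: "V \<subseteq> \<Gamma>"
    and V_axis: "\<And>v i. v \<in> V \<Longrightarrow> v + axis i 1 \<in> \<Gamma>"
    and sub_sum: "\<Gamma> \<subseteq> {c + w | c w. c \<in> convex hull V \<and> w \<in> orthant}"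
    and int_V: "\<And>v. v \<in> V \<Longrightarrow> int_vec v"
begin

lemma min_verts_nonempty: "min_verts V k \<noteq> {}"
proof -
  have "Min ((\<bullet>) k ` V) \<in> (\<bullet>) k ` V" using finite_V V_nonempty by (intro Min_in) auto
  then obtain v where "v \<in> V" "k \<bullet> v = Min ((\<bullet>) k ` V)" by auto
  then have "v \<in> min_verts V k" using finite_V by (auto simp: min_verts_def)
  then show ?thesis by blast
qed

lemma inner_ge:
  assumes k: "k \<in> orthant" and v: "v \<in> min_verts V k" and x: "x \<in> \<Gamma>"
  shows "k \<bullet> v \<le> k \<bullet> x"
proof -
  obtain c w where cw: "x = c + w" "c \<in> convex hull V" "w \<in> orthant" using x sub_sum by blast
  have "convex hull V \<subseteq> {y. k \<bullet> v \<le> k \<bullet> y}"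
    by (rule hull_minimal) (use v in \<open>auto simp: min_verts_def convex_halfspace_ge\<close>)
  then have "k \<bullet> v \<le> k \<bullet> c" using cw(2) by blast
  then show ?thesis using orthant_inner_nonneg[OF k cw(3)] by (simp add: cw(1) inner_add_right)
qed

lemma supp_min_eq:
  assumes k: "k \<in> orthant" and v: "v \<in> min_verts V k"
  shows "supp_min \<Gamma> k = k \<bullet> v"
proof -
  have "v \<in> \<Gamma>" using v V_sub by (auto simp: min_verts_def)
  then show ?thesis unfolding supp_min_def
    by (intro cInf_eq_minimum) (use inner_ge[OF k v] in auto)
qed

lemma first_meet_verts:
  assumes k: "k \<in> orthant"
  shows "v \<in> min_verts V k \<longleftrightarrow> v \<in> V \<and> v \<in> first_meet \<Gamma> k"
proof -
  obtain v0 where v0: "v0 \<in> min_verts V k" using min_verts_nonempty by blast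
  show ?thesis
    using supp_min_eq[OF k v0] supp_min_eq[OF k, of v] v0 V_sub
    by (auto simp: first_meet_def min_verts_def)
qed

lemma first_meet_axis:
  fixes k :: "real ^ 'n"
  assumes k: "k \<in> orthant" and v: "v \<in> min_verts V k"
  shows "v + axis i 1 \<in> first_meet \<Gamma> k \<longleftrightarrow> k $ i = 0"
  using supp_min_eq[OF k v] V_axis[of v i] v
  by (auto simp: first_meet_def min_verts_def inner_add_right inner_axis)

text \<open>Write a point of the face as a convex combination of \<open>V\<close> plus a vector of
  the orthant. Its excess over the minimum is a sum of nonnegative terms and is zero, so only
  minimal elements of \<open>V\<close> carry weight and the orthant part is supported where
  \<open>k\<close> vanishes. Both conditions are the same for \<open>k'\<close>.\<close>

lemma first_meet_subset:
  fixes k k' :: "real ^ 'n"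
  assumes k: "k \<in> orthant" and k': "k' \<in> orthant"
    and m: "min_verts V k = min_verts V k'" and z: "\<And>i. k $ i = 0 \<longleftrightarrow> k' $ i = 0"
  shows "first_meet \<Gamma> k \<subseteq> first_meet \<Gamma> k'"
proof
  fix x assume x: "x \<in> first_meet \<Gamma> k"
  obtain v where v: "v \<in> min_verts V k" using min_verts_nonempty by blast
  have xG: "x \<in> \<Gamma>" and xk: "k \<bullet> x = k \<bullet> v"
    using x supp_min_eq[OF k v] by (auto simp: first_meet_def)
  obtain c w where cw: "x = c + w" "c \<in> convex hull V" "w \<in> orthant" using xG sub_sum by blast
  obtain u where u: "\<And>y. y \<in> V \<Longrightarrow> 0 \<le> u y" "(\<Sum>y\<in>V. u y) = 1" "(\<Sum>y\<in>V. u y *\<^sub>R y) = c"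
    using cw(2) unfolding convex_hull_finite[OF finite_V] by blast
  have dec: "q \<bullet> x = q \<bullet> v + (\<Sum>y\<in>V. u y * (q \<bullet> y - q \<bullet> v)) + q \<bullet> w" for q
  proof -
    have "q \<bullet> c = (\<Sum>y\<in>V. u y * (q \<bullet> y))" by (simp add: u(3)[symmetric] inner_sum_right)
    also have "\<dots> = (\<Sum>y\<in>V. u y * (q \<bullet> y - q \<bullet> v)) + (\<Sum>y\<in>V. u y) * (q \<bullet> v)"
      by (simp add: sum_distrib_right right_diff_distrib sum_subtractf)
    finally show ?thesis by (simp add: cw(1) inner_add_right u(2))
  qed
  have t: "0 \<le> u y * (k \<bullet> y - k \<bullet> v)" if "y \<in> V" for y
    using u(1)[OF that] v that by (auto simp: min_verts_def)
  have "(\<Sum>y\<in>V. u y * (k \<bullet> y - k \<bullet> v)) \<ge> 0" using t by (rule sum_nonneg)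
  then have s0: "(\<Sum>y\<in>V. u y * (k \<bullet> y - k \<bullet> v)) = 0" and w0: "k \<bullet> w = 0"
    using dec[of k] xk orthant_inner_nonneg[OF k cw(3)] by linarith+
  have uy: "u y = 0 \<or> k \<bullet> y = k \<bullet> v" if "y \<in> V" for y
    using s0 that t by (subst (asm) sum_nonneg_eq_0_iff[OF finite_V]) auto
  have wi: "k $ i * w $ i = 0" for i
    using w0 k cw(3) unfolding inner_vec_def
    by (subst (asm) sum_nonneg_eq_0_iff) (auto simp: orthant_def)
  have v': "v \<in> min_verts V k'" using v m by simp
  have "u y * (k' \<bullet> y - k' \<bullet> v) = 0" if y: "y \<in> V" for y
  proof (cases "u y = 0")
    case False
    then have "k \<bullet> y = k \<bullet> v" using uy[OF y] by simp
    then have "y \<in> min_verts V k" using v y by (simp add: min_verts_def)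
    then have "y \<in> min_verts V k'" using m by simp
    then have "k' \<bullet> y = k' \<bullet> v" using v' by (simp add: min_verts_def antisym)
    then show ?thesis by simp
  qed simp
  then have "(\<Sum>y\<in>V. u y * (k' \<bullet> y - k' \<bullet> v)) = 0" by (rule sum.neutral[OF ballI])
  moreover have "k' $ i * w $ i = 0" for i using wi[of i] z[of i] by auto
  then have "k' \<bullet> w = 0" unfolding inner_vec_def by (intro sum.neutral ballI) (simp only: inner_real_def)
  ultimately have "k' \<bullet> x = k' \<bullet> v" using dec[of k'] by simp
  then show "x \<in> first_meet \<Gamma> k'" using xG supp_min_eq[OF k' v'] by (simp add: first_meet_def)
qed

text \<open>Equality of faces becomes equality of finite data. This makes the partition finite and
  lets linear equations and inequalities describe its members.\<close>

lemma first_meet_eq_iff: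
  fixes k k' :: "real ^ 'n"
  assumes k: "k \<in> orthant" and k': "k' \<in> orthant"
  shows "first_meet \<Gamma> k = first_meet \<Gamma> k' \<longleftrightarrow>
    min_verts V k = min_verts V k' \<and> (\<forall>i. k $ i = 0 \<longleftrightarrow> k' $ i = 0)"
proof
  assume eq: "first_meet \<Gamma> k = first_meet \<Gamma> k'"
  have m: "min_verts V k = min_verts V k'"
    using first_meet_verts[OF k] first_meet_verts[OF k'] eq by auto
  obtain v where v: "v \<in> min_verts V k" using min_verts_nonempty by blast
  show "min_verts V k = min_verts V k' \<and> (\<forall>i. k $ i = 0 \<longleftrightarrow> k' $ i = 0)"
    using first_meet_axis[OF k v] first_meet_axis[OF k', of v] m v eq by auto
next
  assume "min_verts V k = min_verts V k' \<and> (\<forall>i. k $ i = 0 \<longleftrightarrow> k' $ i = 0)"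
  then show "first_meet \<Gamma> k = first_meet \<Gamma> k'"
    using first_meet_subset[OF k k'] first_meet_subset[OF k' k] by blast
qed

lemma poly_face_first_meet:
  assumes k: "k \<in> orthant"
  shows "poly_face \<Gamma> (first_meet \<Gamma> k)"
proof -
  obtain v where v: "v \<in> min_verts V k" using min_verts_nonempty by blast
  note m = supp_min_eq[OF k v]
  show ?thesis
  proof (cases "k = 0")
    case True
    then have "first_meet \<Gamma> k = \<Gamma>" using m by (auto simp: first_meet_def)
    then show ?thesis by (simp add: poly_face_def)
  next
    case False
    have "v \<in> first_meet \<Gamma> k" using first_meet_verts[OF k] v by blast
    then show ?thesis unfolding poly_face_def
      using False inner_ge[OF k v] m
      by (intro disjI2 exI[of _ k] exI[of _ "k \<bullet> v"]) (auto simp: first_meet_def)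
  qed
qed

end

section \<open>The common refinement of the two dual partitions\<close>

locale newton_pair = A: newton_polyhedron \<Gamma> V + B: newton_polyhedron \<Gamma>' W
  for \<Gamma> V \<Gamma>' W :: "(real ^ 'n::finite) set"
begin

definition dual_cell :: "real ^ 'n \<Rightarrow> (real ^ 'n) set" where
  "dual_cell k0 = {k \<in> orthant. first_meet \<Gamma> k = first_meet \<Gamma> k0 \<and> first_meet \<Gamma>' k = first_meet \<Gamma>' k0}"

text \<open>These inequalities cut out a cone on which both support functions are linear, given by
  \<open>v\<close> and \<open>w\<close>. The zero vector arising from \<open>y = v\<close> or
  \<open>y = w\<close> is a constraint that is tight everywhere.\<close>

definition facet_normals :: "real ^ 'n \<Rightarrow> real ^ 'n \<Rightarrow> (real ^ 'n) set" where
  "facet_normals v w = range (\<lambda>i. axis i 1) \<union> (\<lambda>y. y - v) ` V \<union> (\<lambda>y. y - w) ` W"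

lemma dual_cell_eq: "dual_cell k0 =
    dual_cone \<Gamma> (first_meet \<Gamma> k0) \<inter> dual_cone \<Gamma>' (first_meet \<Gamma>' k0)"
  by (auto simp: dual_cell_def dual_cone_def)

lemma dual_cell_partition:
  "{\<delta>. \<delta> \<noteq> {} \<and> (\<exists>\<tau> \<tau>'. poly_face \<Gamma> \<tau> \<and> poly_face \<Gamma>' \<tau>' \<and> \<delta> = dual_cone \<Gamma> \<tau> \<inter> dual_cone \<Gamma>' \<tau>')}
    = dual_cell ` orthant" (is "?P = _")
proof (intro equalityI subsetI)
  fix \<delta> assume "\<delta> \<in> ?P"
  then obtain \<tau> \<tau>' k where *: "\<delta> = dual_cone \<Gamma> \<tau> \<inter> dual_cone \<Gamma>' \<tau>'" "k \<in> \<delta>" by blast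
  then have "k \<in> orthant" "first_meet \<Gamma> k = \<tau>" "first_meet \<Gamma>' k = \<tau>'" by (auto simp: dual_cone_def)
  then show "\<delta> \<in> dual_cell ` orthant" using *(1) dual_cell_eq[of k] by auto
next
  fix \<delta> assume "\<delta> \<in> dual_cell ` orthant"
  then obtain k where k: "k \<in> orthant" "\<delta> = dual_cell k" by blast
  moreover have "k \<in> dual_cell k" using k(1) by (simp add: dual_cell_def)
  ultimately show "\<delta> \<in> ?P"
    using A.poly_face_first_meet[OF k(1)] B.poly_face_first_meet[OF k(1)] dual_cell_eq[of k] by blast
qed

lemma dual_cell_iff:
  assumes k: "k \<in> orthant" and k0: "k0 \<in> orthant"
  shows "k \<in> dual_cell k0 \<longleftrightarrow> min_verts V k = min_verts V k0 \<and> min_verts W k = min_verts W k0 \<and>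
    {i. k $ i = 0} = {i. k0 $ i = 0}"
proof -
  have "{i. k $ i = 0} = {i. k0 $ i = 0} \<longleftrightarrow> (\<forall>i. k $ i = 0 \<longleftrightarrow> k0 $ i = 0)" by blast
  then show ?thesis
    unfolding dual_cell_def mem_Collect_eq A.first_meet_eq_iff[OF k k0] B.first_meet_eq_iff[OF k k0]
    using k by blast
qed

text \<open>A cell is determined by two sets of minimal vertices and a set of vanishing coordinates,
  and there are finitely many such triples.\<close>

lemma finite_dual_cells: "finite (dual_cell ` orthant)"
proof -
  let ?d = "\<lambda>k :: real ^ 'n. (min_verts V k, min_verts W k, {i. k $ i = 0})"
  have "?d ` orthant \<subseteq> Pow V \<times> Pow W \<times> UNIV" by (auto simp: min_verts_def)
  then have fin: "finite (?d ` orthant)"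
    by (rule finite_subset) (auto simp: A.finite_V B.finite_V)
  have "dual_cell k = dual_cell k'" if "k \<in> orthant" "k' \<in> orthant" "?d k = ?d k'" for k k'
  proof -
    have "k \<in> dual_cell k'" using dual_cell_iff[OF that(1,2)] that(3) by simp
    then show ?thesis by (simp add: dual_cell_def)
  qed
  then have "dual_cell ` orthant = (\<lambda>y. dual_cell (SOME k. k \<in> orthant \<and> ?d k = y)) ` ?d ` orthant"
    (is "_ = ?R")
  proof (intro equalityI subsetI)
    assume *: "\<And>k k'. k \<in> orthant \<Longrightarrow> k' \<in> orthant \<Longrightarrow> ?d k = ?d k' \<Longrightarrow> dual_cell k = dual_cell k'"
    have some: "dual_cell (SOME k'. k' \<in> orthant \<and> ?d k' = ?d k) = dual_cell k" if "k \<in> orthant" for k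
    proof -
      have "(SOME k'. k' \<in> orthant \<and> ?d k' = ?d k) \<in> orthant \<and> ?d (SOME k'. k' \<in> orthant \<and> ?d k' = ?d k) = ?d k"
        by (rule someI[of "\<lambda>k'. k' \<in> orthant \<and> ?d k' = ?d k" k]) (use that in simp)
      then show ?thesis using *[OF _ that] by blast
    qed
    show "\<delta> \<in> ?R" if \<delta>: "\<delta> \<in> dual_cell ` orthant" for \<delta>
    proof -
      obtain k where k: "k \<in> orthant" "\<delta> = dual_cell k" using \<delta> by blast
      show ?thesis using some[OF k(1)] k by (intro image_eqI[of _ _ "?d k"] imageI) auto
    qed
    show "\<delta> \<in> dual_cell ` orthant" if \<delta>: "\<delta> \<in> ?R" for \<delta>
    proof -
      obtain k where k: "k \<in> orthant" "\<delta> = dual_cell (SOME k'. k' \<in> orthant \<and> ?d k' = ?d k)" using \<delta> by blast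
      show ?thesis using some[OF k(1)] k by auto
    qed
  qed
  then show ?thesis using fin by simp
qed

lemma integral_cone_facet_normals:
  assumes "v \<in> V" "w \<in> W"
  shows "integral_cone (facet_normals v w)"
proof
  show "finite (facet_normals v w)"
    unfolding facet_normals_def using A.finite_V B.finite_V by auto
  show "int_vec l" if "l \<in> facet_normals v w" for l
    using that assms A.int_V B.int_V
    by (auto simp: facet_normals_def intro: int_vec_axis int_vec_diff)
qed (auto simp: facet_normals_def)

lemma halfspace_cone_facet_normals:
  assumes "v \<in> V" "w \<in> W"
  shows "k \<in> halfspace_cone (facet_normals v w) \<longleftrightarrow>
    k \<in> orthant \<and> v \<in> min_verts V k \<and> w \<in> min_verts W k"
proof -
  have "k \<in> halfspace_cone (facet_normals v w) \<longleftrightarrow>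
    (\<forall>i. 0 \<le> axis i 1 \<bullet> k) \<and> (\<forall>y\<in>V. 0 \<le> (y - v) \<bullet> k) \<and> (\<forall>y\<in>W. 0 \<le> (y - w) \<bullet> k)"
    unfolding halfspace_cone_def facet_normals_def by blast
  moreover have "axis i 1 \<bullet> k = k $ i" for i by (simp add: inner_axis')
  ultimately show ?thesis using assms
    by (simp add: orthant_def min_verts_def diff_inner)
qed

text \<open>The bridge from faces to inequalities: within this cone the constraint
  \<open>y - v\<close> is tight exactly when \<open>y\<close> is minimal as well, and a unit vector
  is tight exactly when the coordinate vanishes.\<close>

lemma dual_cell_eq_cell:
  assumes vw: "v \<in> V" "w \<in> W" and k0: "k0 \<in> halfspace_cone (facet_normals v w)"
  shows "dual_cell k0 = cell (facet_normals v w) k0"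
proof -
  let ?L = "facet_normals v w"
  have same: "min_verts V k = min_verts V k0 \<and> min_verts W k = min_verts W k0 \<and> {i. k $ i = 0} = {i. k0 $ i = 0}
    \<longleftrightarrow> tight ?L k = tight ?L k0" if k: "k \<in> halfspace_cone ?L" for k
  proof -
    have mv: "min_verts V q = {y \<in> V. (y - v) \<bullet> q = 0}" "min_verts W q = {y \<in> W. (y - w) \<bullet> q = 0}"
      if "q \<in> halfspace_cone ?L" for q
      using that unfolding halfspace_cone_facet_normals[OF vw]
      by (auto simp: min_verts_def diff_inner intro: antisym)
    have "tight ?L k = tight ?L k0 \<longleftrightarrow> (\<forall>l\<in>?L. l \<bullet> k = 0 \<longleftrightarrow> l \<bullet> k0 = 0)"
      by (auto simp: tight_def)
    also have "\<dots> \<longleftrightarrow> (\<forall>i. axis i 1 \<bullet> k = 0 \<longleftrightarrow> axis i 1 \<bullet> k0 = 0) \<and>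
      (\<forall>y\<in>V. (y - v) \<bullet> k = 0 \<longleftrightarrow> (y - v) \<bullet> k0 = 0) \<and> (\<forall>y\<in>W. (y - w) \<bullet> k = 0 \<longleftrightarrow> (y - w) \<bullet> k0 = 0)"
      unfolding facet_normals_def by blast
    also have "\<dots> \<longleftrightarrow> {i. k $ i = 0} = {i. k0 $ i = 0} \<and> min_verts V k = min_verts V k0 \<and> min_verts W k = min_verts W k0"
      unfolding mv[OF k] mv[OF k0] by (auto simp: inner_axis')
    finally show ?thesis by blast
  qed
  note hs = halfspace_cone_facet_normals[OF vw]
  have o0: "k0 \<in> orthant" using k0 hs by blast
  have "k \<in> dual_cell k0 \<longleftrightarrow> k \<in> cell ?L k0" for k
  proof
    assume k: "k \<in> dual_cell k0"
    then have ko: "k \<in> orthant" by (simp add: dual_cell_def)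
    have *: "min_verts V k = min_verts V k0 \<and> min_verts W k = min_verts W k0 \<and> {i. k $ i = 0} = {i. k0 $ i = 0}"
      using dual_cell_iff[OF ko o0] k by simp
    then have kh: "k \<in> halfspace_cone ?L" using k0 ko unfolding hs by simp
    show "k \<in> cell ?L k0" using same[OF kh] * kh by (simp add: cell_def)
  next
    assume "k \<in> cell ?L k0"
    then have kh: "k \<in> halfspace_cone ?L" "tight ?L k = tight ?L k0" by (auto simp: cell_def)
    then have "k \<in> orthant" using hs by blast
    then show "k \<in> dual_cell k0" using dual_cell_iff[OF _ o0] same[OF kh(1)] kh(2) by blast
  qed
  then show ?thesis by blast
qed

lemma ex_facet_normals:
  assumes "k \<in> orthant"
  shows "\<exists>v\<in>V. \<exists>w\<in>W. k \<in> halfspace_cone (facet_normals v w)"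
proof -
  obtain v w where "v \<in> min_verts V k" "w \<in> min_verts W k"
    using A.min_verts_nonempty B.min_verts_nonempty by blast
  moreover from this have "v \<in> V" "w \<in> W" by (auto simp: min_verts_def)
  ultimately show ?thesis using halfspace_cone_facet_normals assms by blast
qed

lemma supp_min_linear:
  assumes "v \<in> V" "w \<in> W" "k \<in> halfspace_cone (facet_normals v w)"
  shows "supp_min \<Gamma> k = k \<bullet> v" "supp_min \<Gamma>' k = k \<bullet> w"
  using assms A.supp_min_eq B.supp_min_eq halfspace_cone_facet_normals by blast+

text \<open>Generators of a simplicial partition may lie on the boundary of the cell; by this
  inclusion the exponent is given by the same linear form there.\<close>

lemma closure_dual_cell:
  assumes "v \<in> V" "w \<in> W" "k0 \<in> halfspace_cone (facet_normals v w)"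
  shows "closure (dual_cell k0) \<subseteq> halfspace_cone (facet_normals v w)"
proof (rule closure_minimal)
  show "dual_cell k0 \<subseteq> halfspace_cone (facet_normals v w)"
    unfolding dual_cell_eq_cell[OF assms] by (auto simp: cell_def)
  have "halfspace_cone (facet_normals v w) = (\<Inter>l\<in>facet_normals v w. {k. l \<bullet> k \<ge> 0})"
    by (auto simp: halfspace_cone_def)
  then show "closed (halfspace_cone (facet_normals v w))"
    by (auto intro!: closed_INT closed_halfspace_ge)
qed

end

section \<open>The Newton polyhedra of a polynomial and of a monomial ideal\<close>

lemma int_vec_expvec: "int_vec (expvec \<omega>)"
  by (simp add: int_vec_def expvec_def)

lemma expvec_orthant: "expvec \<omega> \<in> orthant"
  by (simp add: orthant_def expvec_def)

lemma newton_polyhedron_hullI: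
  assumes "finite V" "V \<noteq> {}" "V \<subseteq> S" "\<And>v i. v \<in> V \<Longrightarrow> v + axis i 1 \<in> S"
    and S: "\<And>x. x \<in> S \<Longrightarrow> \<exists>v\<in>V. \<exists>w\<in>orthant. x = v + w" and "\<And>v. v \<in> V \<Longrightarrow> int_vec v"
  shows "newton_polyhedron (convex hull S) V"
proof
  show "V \<subseteq> convex hull S" using order_trans[OF assms(3) hull_subset] .
  show "v + axis i 1 \<in> convex hull S" if "v \<in> V" for v i
    using hull_inc[OF assms(4)[OF that]] .
  let ?T = "\<Union>x\<in>convex hull V. \<Union>y\<in>orthant. {x + y}"
  have "convex hull S \<subseteq> ?T"
  proof (rule hull_minimal)
    show "S \<subseteq> ?T"
    proof
      fix x assume "x \<in> S"
      then obtain v w where "v \<in> V" "w \<in> orthant" "x = v + w" using S by blast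
      moreover have "v \<in> convex hull V" using \<open>v \<in> V\<close> hull_inc by metis
      ultimately show "x \<in> ?T" by blast
    qed
    show "convex ?T" by (rule convex_sums[OF convex_convex_hull convex_orthant])
  qed
  then show "convex hull S \<subseteq> {c + w |c w. c \<in> convex hull V \<and> w \<in> orthant}" by blast
qed (use assms in auto)

lemma newton_polyhedron_poly:
  assumes "g \<noteq> 0"
  shows "newton_polyhedron (newton_poly g) (expvec ` Poly_Mapping.keys g)"
  unfolding newton_poly_def
proof (rule newton_polyhedron_hullI)
  show "expvec ` Poly_Mapping.keys g \<noteq> {}" using assms by simp
  have 0: "(0 :: real ^ 'a) \<in> orthant" "axis i 1 \<in> orthant" for i :: 'a by (auto simp: orthant_def axis_def)
  show "expvec ` Poly_Mapping.keys g \<subseteq> (\<Union>\<omega>\<in>Poly_Mapping.keys g. {expvec \<omega> + v |v. v \<in> orthant})"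
    using 0(1) by (force intro: exI[of _ 0])
  show "v + axis i 1 \<in> (\<Union>\<omega>\<in>Poly_Mapping.keys g. {expvec \<omega> + v |v. v \<in> orthant})"
    if "v \<in> expvec ` Poly_Mapping.keys g" for v i
    using that 0(2)[of i] by auto
  show "\<exists>v\<in>expvec ` Poly_Mapping.keys g. \<exists>w\<in>orthant. x = v + w"
    if "x \<in> (\<Union>\<omega>\<in>Poly_Mapping.keys g. {expvec \<omega> + v |v. v \<in> orthant})" for x
    using that by blast
qed (auto simp: int_vec_expvec)

lemma monomial_ideal_mult:
  fixes I :: "('n, 'a::comm_ring_1) mpoly set"
  assumes "monomial_ideal I" "f \<in> I"
  shows "h * f \<in> I"
proof -
  interpret Modules.module "(*) :: ('n, 'a) mpoly \<Rightarrow> _" by standard (auto simp: algebra_simps)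
  obtain A where A: "I = span ((\<lambda>\<omega>. Poly_Mapping.single \<omega> 1) ` A)"
    using assms(1) unfolding monomial_ideal_def by blast
  show ?thesis using assms(2) unfolding A by (rule span_scale)
qed

text \<open>The polynomials whose exponents all dominate a generating exponent are closed under
  addition and under multiplication by polynomials, and they contain the generators; hence they
  contain the span.\<close>

lemma monomial_ideal_keys:
  fixes I :: "('n, 'a::comm_ring_1) mpoly set"
  assumes "monomial_ideal I" "f \<in> I" "\<omega> \<in> Poly_Mapping.keys f"
  shows "Poly_Mapping.single \<omega> 1 \<in> I"
proof -
  interpret Modules.module "(*) :: ('n, 'a) mpoly \<Rightarrow> _" by standard (auto simp: algebra_simps)
  obtain A where A: "I = span ((\<lambda>\<omega>. Poly_Mapping.single \<omega> 1) ` A)"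
    using assms(1) unfolding monomial_ideal_def by blast
  define P where "P f \<longleftrightarrow> (\<forall>\<omega>\<in>Poly_Mapping.keys f. \<exists>\<alpha>\<in>A. \<exists>\<beta>. \<omega> = \<alpha> + \<beta>)" for f :: "('n, 'a) mpoly"
  have "f \<in> span ((\<lambda>\<omega>. Poly_Mapping.single \<omega> 1) ` A)" using assms(2) A by simp
  then have "P f"
  proof (rule span_induct)
    show "P x" if "x \<in> (\<lambda>\<omega>. Poly_Mapping.single \<omega> 1) ` A" for x
      using that by (auto simp: P_def split: if_splits intro!: exI[of _ 0])
    show "subspace (Collect P)"
    proof (rule subspaceI)
      show "0 \<in> Collect P" by (simp add: P_def)
      show "x + y \<in> Collect P" if "x \<in> Collect P" "y \<in> Collect P" for x y
        using that Poly_Mapping.keys_add[of x y] unfolding P_def by blast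
      show "c * x \<in> Collect P" if x: "x \<in> Collect P" for c x
        unfolding P_def
      proof (intro CollectI ballI)
        fix \<omega> assume "\<omega> \<in> Poly_Mapping.keys (c * x)"
        then obtain a b where ab: "\<omega> = a + b" "b \<in> Poly_Mapping.keys x" using keys_mult[of c x] by blast
        then obtain \<alpha> \<beta> where "\<alpha> \<in> A" "b = \<alpha> + \<beta>" using x unfolding P_def by blast
        then show "\<exists>\<alpha>\<in>A. \<exists>\<beta>. \<omega> = \<alpha> + \<beta>"
          using ab(1) by (intro bexI[of _ \<alpha>] exI[of _ "a + \<beta>"]) (auto simp: ac_simps)
      qed
    qed
  qed
  then obtain \<alpha> \<beta> where ab: "\<alpha> \<in> A" "\<omega> = \<alpha> + \<beta>" using assms(3) unfolding P_def by blast
  have "Poly_Mapping.single \<alpha> 1 \<in> I" unfolding A using ab(1) by (intro span_base) auto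
  from monomial_ideal_mult[OF assms(1) this, of "Poly_Mapping.single \<beta> 1"]
  show ?thesis by (simp add: mult_single ab(2) add.commute)
qed

text \<open>The finite set given by Dickson's lemma serves twice: as the vertex set of the
  polyhedron, and later as the set of monomials at which \<open>ideal_abs\<close> is
  attained.\<close>

lemma newton_polyhedron_ideal:
  fixes I :: "('n::finite, 'a::comm_ring_1) mpoly set"
  assumes I: "monomial_ideal I" "I \<noteq> {0}"
  shows "\<exists>F. finite F \<and> F \<subseteq> {\<omega>. Poly_Mapping.single \<omega> 1 \<in> I} \<and>
    (\<forall>\<omega>. Poly_Mapping.single \<omega> 1 \<in> I \<longrightarrow>
      (\<exists>\<alpha>\<in>F. \<forall>i. Poly_Mapping.lookup \<alpha> i \<le> Poly_Mapping.lookup \<omega> i)) \<and>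
    newton_polyhedron (newton_ideal I) (expvec ` F)"
proof -
  let ?U = "{\<omega> :: 'n \<Rightarrow>\<^sub>0 nat. Poly_Mapping.single \<omega> 1 \<in> I}"
  obtain F where F: "F \<subseteq> ?U" "finite F"
    "\<forall>a\<in>?U. \<exists>b\<in>F. \<forall>x\<in>UNIV. Poly_Mapping.lookup b x \<le> Poly_Mapping.lookup a x"
    using dickson[of "UNIV :: 'n set" ?U Poly_Mapping.lookup] by auto
  interpret Modules.module "(*) :: ('n, 'a) mpoly \<Rightarrow> _" by standard (auto simp: algebra_simps)
  have "0 \<in> I"
  proof -
    obtain A where "I = module.span (*) ((\<lambda>\<omega>. Poly_Mapping.single \<omega> 1) ` A)"
      using I(1) unfolding monomial_ideal_def by blast
    then show ?thesis by (simp add: span_zero)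
  qed
  then obtain f where "f \<in> I" "f \<noteq> 0" using I(2) by blast
  then obtain \<omega> where "\<omega> \<in> ?U" using monomial_ideal_keys[OF I(1)] by (metis keys_eq_empty all_not_in_conv mem_Collect_eq)
  then have "F \<noteq> {}" using F(3) by blast
  have "newton_polyhedron (newton_ideal I) (expvec ` F)"
    unfolding newton_ideal_def
  proof (rule newton_polyhedron_hullI)
    show "expvec ` F \<subseteq> expvec ` ?U" using F(1) by blast
    show "v + axis i 1 \<in> expvec ` ?U" if v: "v \<in> expvec ` F" for v i
    proof -
      obtain \<omega> where w: "\<omega> \<in> F" "v = expvec \<omega>" using v by blast
      have "Poly_Mapping.single (Poly_Mapping.single i 1) 1 * Poly_Mapping.single \<omega> 1 \<in> I"
        using w(1) F(1) by (intro monomial_ideal_mult[OF I(1)]) auto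
      then have "Poly_Mapping.single i 1 + \<omega> \<in> ?U" by (simp add: mult_single)
      moreover have "v + axis i 1 = expvec (Poly_Mapping.single i 1 + \<omega>)"
        by (simp add: w(2) expvec_def vec_eq_iff axis_def lookup_add lookup_single when_def)
      ultimately show ?thesis by blast
    qed
    show "\<exists>v\<in>expvec ` F. \<exists>w\<in>orthant. x = v + w" if x: "x \<in> expvec ` ?U" for x
    proof -
      obtain a where a: "a \<in> ?U" "x = expvec a" using x by blast
      then obtain b where b: "b \<in> F" "\<forall>i. Poly_Mapping.lookup b i \<le> Poly_Mapping.lookup a i"
        using F(3) by auto
      have "x - expvec b \<in> orthant" using b(2) by (simp add: a(2) orthant_def expvec_def)
      then show ?thesis using b(1) by (intro bexI[of _ "expvec b"] bexI[of _ "x - expvec b"]) auto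
    qed
  qed (use F \<open>F \<noteq> {}\<close> in \<open>auto simp: int_vec_expvec\<close>)
  then show ?thesis using F by (intro exI[of _ F]) simp
qed


section \<open>Divisibility and residues of p-adic integers\<close>

abbreviation uniformizer :: "'p::prime_card padic_int" where
  "uniformizer \<equiv> of_nat CARD('p)"

lemma padic_int_eqI: "(\<And>k. Rep_padic_int x k = Rep_padic_int y k) \<Longrightarrow> x = y"
  by (metis Rep_padic_int_inject ext)

lemma Rep_padic_int_of_nat:
  "Rep_padic_int (of_nat n :: 'p::prime_card padic_int) k = int n mod int CARD('p) ^ k"
  by (induction n) (simp_all add: plus_padic_int.rep_eq one_padic_int.rep_eq mod_simps)

lemma CARD_gt_1: "CARD('p::prime_card) > 1"
  using prime_gt_1_nat[OF prime_card[where 'a='p]] .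

lemma Rep_padic_int_bounds:
  fixes x :: "'p::prime_card padic_int"
  shows "0 \<le> Rep_padic_int x k" "Rep_padic_int x k < int CARD('p) ^ k"
proof -
  have "Rep_padic_int x k = Rep_padic_int x k mod int CARD('p) ^ k"
    using Rep_padic_int_mod[of k k x] by simp
  moreover have "int CARD('p) ^ k > 0" using CARD_gt_1[where 'p='p] by simp
  ultimately show "0 \<le> Rep_padic_int x k" "Rep_padic_int x k < int CARD('p) ^ k"
    using pos_mod_sign[of "int CARD('p) ^ k"] pos_mod_bound[of "int CARD('p) ^ k"] by metis+
qed

lemma uniformizer_power: "uniformizer ^ k = (of_nat (CARD('p) ^ k) :: 'p::prime_card padic_int)"
  by (simp only: of_nat_power)

lemma uniformizer_nonzero: "(uniformizer :: 'p::prime_card padic_int) \<noteq> 0"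
proof
  assume "(uniformizer :: 'p padic_int) = 0"
  then have "Rep_padic_int (uniformizer :: 'p padic_int) 2 = 0" by simp
  then have "int CARD('p) mod int CARD('p) ^ 2 = 0" by (simp only: Rep_padic_int_of_nat)
  moreover have "int CARD('p) < int CARD('p) ^ 2" using CARD_gt_1[where 'p='p] by (simp add: power2_eq_square)
  ultimately show False using CARD_gt_1[where 'p='p] by simp
qed

lemma uniformizer_power_dvd_iff:
  fixes x :: "'p::prime_card padic_int"
  shows "uniformizer ^ k dvd x \<longleftrightarrow> Rep_padic_int x k = 0"
proof
  assume "uniformizer ^ k dvd x"
  then obtain y where "x = uniformizer ^ k * y" by blast
  then have "x = of_nat (CARD('p) ^ k) * y" by (simp only: uniformizer_power)
  then have "Rep_padic_int x k = (int (CARD('p) ^ k) mod int CARD('p) ^ k * Rep_padic_int y k) mod int CARD('p) ^ k"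
    by (simp only: times_padic_int.rep_eq Rep_padic_int_of_nat)
  then show "Rep_padic_int x k = 0" by simp
next
  assume x: "Rep_padic_int x k = 0"
  let ?q = "int CARD('p)"
  have q: "?q > 0" using CARD_gt_1[where 'p='p] by simp
  \<comment> \<open>Division by p^k loses k digits, so the quotient modulo p^m is read off from
    \<open>x\<close> modulo p^(m+k).\<close>
  define y where "y m = Rep_padic_int x (m + k) div ?q ^ k" for m
  have dvd: "?q ^ k dvd Rep_padic_int x (m + k)" for m
    using x Rep_padic_int_eq_0_iff[of k "m + k" x] by simp
  then have xy: "Rep_padic_int x (m + k) = ?q ^ k * y m" for m by (simp add: y_def)
  have coh: "y m = y (Suc m) mod ?q ^ m" for m
  proof -
    have "?q ^ k * y m = (?q ^ k * y (Suc m)) mod (?q ^ k * ?q ^ m)"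
      using Rep_padic_int_mod[of "m + k" "Suc m + k" x] unfolding xy by (simp add: power_add mult.commute)
    also have "\<dots> = ?q ^ k * (y (Suc m) mod ?q ^ m)" by (rule mult_mod_right[symmetric])
    finally show ?thesis using q by simp
  qed
  define Y where "Y = (Abs_padic_int y :: 'p padic_int)"
  have Y: "Rep_padic_int Y m = y m" for m
    unfolding Y_def by (subst Abs_padic_int_inverse, intro CollectI allI, rule coh, rule refl)
  have "x = uniformizer ^ k * Y"
  proof (rule padic_int_eqI)
    fix m
    have "Rep_padic_int x m = Rep_padic_int x (m + k) mod ?q ^ m"
      using Rep_padic_int_mod[of m "m + k" x] by simp
    also have "\<dots> = (int (CARD('p) ^ k) mod ?q ^ m * Rep_padic_int Y m) mod ?q ^ m"
      by (simp add: xy Y mod_mult_left_eq)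
    also have "\<dots> = Rep_padic_int (uniformizer ^ k * Y) m"
      unfolding uniformizer_power by (simp only: times_padic_int.rep_eq Rep_padic_int_of_nat)
    finally show "Rep_padic_int x m = Rep_padic_int (uniformizer ^ k * Y) m" .
  qed
  then show "uniformizer ^ k dvd x" by simp
qed

lemma padic_int_abs_le_iff:
  fixes x :: "'p::prime_card padic_int"
  shows "padic_int_abs x \<le> inverse (real CARD('p) ^ k) \<longleftrightarrow> uniformizer ^ k dvd x"
proof (cases "x = 0")
  case False
  have p: "real CARD('p) > 1" by (rule prime_card_gt_1)
  have "padic_int_abs x \<le> inverse (real CARD('p) ^ k) \<longleftrightarrow> real CARD('p) ^ k \<le> real CARD('p) ^ padic_int_val x"
    using False p by (simp add: padic_int_abs_def inverse_le_iff_le)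
  also have "\<dots> \<longleftrightarrow> k \<le> padic_int_val x" using p by simp
  finally show ?thesis using padic_int_val_ge_iff[OF False] uniformizer_power_dvd_iff by metis
qed (simp add: padic_int_abs_def)

lemma padic_int_abs_eqI:
  fixes x :: "'p::prime_card padic_int"
  assumes "uniformizer ^ k dvd x" "\<not> uniformizer ^ Suc k dvd x"
  shows "padic_int_abs x = inverse (real CARD('p) ^ k)"
proof -
  have x: "x \<noteq> 0" using assms(2) by auto
  have "k \<le> padic_int_val x" "\<not> Suc k \<le> padic_int_val x"
    using assms unfolding padic_int_val_ge_iff[OF x] uniformizer_power_dvd_iff by auto
  then have "padic_int_val x = k" by linarith
  then show ?thesis using x by (simp add: padic_int_abs_def)
qed

lemma padic_int_abs_power: "padic_int_abs (x ^ n) = padic_int_abs (x :: 'p::prime_card padic_int) ^ n"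
proof (induction n)
  case 0
  have "padic_int_abs (1 :: 'p padic_int) * padic_int_abs (1 :: 'p padic_int) = padic_int_abs (1 :: 'p padic_int)"
    by (simp flip: padic_int_abs_mult)
  then show ?case by simp
qed (simp add: padic_int_abs_mult)

section \<open>Reduction modulo p, units and integral points of the field\<close>

lemma residue_hom:
  fixes x y :: "'p::prime_card padic_int"
  shows "residue_mod_p (x + y) = residue_mod_p x + residue_mod_p y"
    and "residue_mod_p (x - y) = residue_mod_p x - residue_mod_p y"
    and "residue_mod_p (x * y) = residue_mod_p x * residue_mod_p y"
    and "residue_mod_p (0 :: 'p padic_int) = 0" and "residue_mod_p (1 :: 'p padic_int) = 1"
proof -
  have m: "of_int (a mod int CARD('p)) = (of_int a :: 'p mod_ring)" for a
    using of_int_mod_CHAR[where 'a="'p mod_ring", of a] by simp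
  show "residue_mod_p (x + y) = residue_mod_p x + residue_mod_p y"
    "residue_mod_p (x - y) = residue_mod_p x - residue_mod_p y"
    "residue_mod_p (x * y) = residue_mod_p x * residue_mod_p y"
    "residue_mod_p (0 :: 'p padic_int) = 0" "residue_mod_p (1 :: 'p padic_int) = 1"
    by (simp_all add: residue_mod_p_def padic_int_rep_eqs m power_one_right del: of_int_mod_CHAR)
qed

lemma residue_power: "residue_mod_p (x ^ n) = residue_mod_p x ^ n"
  by (induction n) (simp_all add: residue_hom)

lemma residue_sum: "residue_mod_p (\<Sum>x\<in>A. f x) = (\<Sum>x\<in>A. residue_mod_p (f x))"
  by (induction A rule: infinite_finite_induct) (simp_all add: residue_hom)

lemma residue_prod: "residue_mod_p (\<Prod>x\<in>A. f x) = (\<Prod>x\<in>A. residue_mod_p (f x))"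
  by (induction A rule: infinite_finite_induct) (simp_all add: residue_hom)

lemma residue_of_nat: "residue_mod_p (of_nat n) = of_nat n"
  by (induction n) (simp_all add: residue_hom)

lemma residue_eq_0_iff:
  fixes x :: "'p::prime_card padic_int"
  shows "residue_mod_p x = 0 \<longleftrightarrow> uniformizer dvd x"
proof -
  obtain n where n: "Rep_padic_int x 1 = int n"
    using Rep_padic_int_bounds(1)[of x 1] by (metis nonneg_int_cases)
  have lt: "n < CARD('p)" using Rep_padic_int_bounds(2)[of x 1] n by simp
  have "residue_mod_p x = of_nat n" using n by (simp add: residue_mod_p_def)
  moreover have "(of_nat n :: 'p mod_ring) = 0 \<longleftrightarrow> n = 0"
    using of_nat_0_mod_ring_dvd[where 'a='p, of n] lt by (metis dvd_imp_le linorder_not_less not_gr_zero of_nat_0)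
  ultimately show ?thesis using uniformizer_power_dvd_iff[of 1 x] n by simp
qed

lemma residue_uniformizer: "residue_mod_p (uniformizer :: 'p::prime_card padic_int) = 0"
  by (simp add: residue_eq_0_iff)

lemma residue_of_nat_inj:
  assumes "s < CARD('p::prime_card)" "t < CARD('p)" "(of_nat s :: 'p mod_ring) = of_nat t"
  shows "s = t"
proof -
  have "s = t" if "s \<le> t" "t < CARD('p)" "(of_nat s :: 'p mod_ring) = of_nat t" for s t
  proof -
    have "(of_nat (t - s) :: 'p mod_ring) = 0" using that by (simp add: of_nat_diff)
    then have "CARD('p) dvd t - s" by (rule of_nat_0_mod_ring_dvd)
    then have "t - s = 0" using that by (metis dvd_imp_le less_imp_diff_less linorder_not_less neq0_conv)
    then show ?thesis using that by simp
  qed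
  then show ?thesis using assms by (metis nat_le_linear)
qed

text \<open>An inverse modulo p^k exists by coprimality, and it is unique modulo p^k; uniqueness
  makes the inverses chosen at the different levels coherent.\<close>

lemma ex_padic_int_inverse:
  fixes u :: "'p::prime_card padic_int"
  assumes "residue_mod_p u \<noteq> 0"
  shows "\<exists>w. u * w = 1"
proof -
  let ?q = "int CARD('p)"
  have prime: "prime ?q" by (rule prime_card_int)
  have cop: "coprime (Rep_padic_int u k) (?q ^ k)" for k
  proof (cases "k = 0")
    case False
    have "\<not> ?q dvd Rep_padic_int u k"
      using assms Rep_padic_int_eq_0_iff[of 1 k u] False uniformizer_power_dvd_iff[of 1 u]
      by (simp add: residue_eq_0_iff)
    then have "coprime ?q (Rep_padic_int u k)" using prime by (rule prime_imp_coprime[rotated])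
    then show ?thesis by (simp add: coprime_commute)
  qed simp
  have "\<exists>w. (Rep_padic_int u k * w) mod ?q ^ k = 1 mod ?q ^ k" for k
    using cong_solve_coprime_int[OF cop[of k]] unfolding cong_def by blast
  then obtain w0 where w0: "\<And>k. (Rep_padic_int u k * w0 k) mod ?q ^ k = 1 mod ?q ^ k" by metis
  define w where "w k = w0 k mod ?q ^ k" for k
  have w: "(Rep_padic_int u k * w k) mod ?q ^ k = 1 mod ?q ^ k" for k
    using w0[of k] by (simp add: w_def mod_mult_right_eq)
  have coh: "w k = w (Suc k) mod ?q ^ k" for k
  proof -
    have d: "?q ^ k dvd ?q ^ Suc k" by simp
    have "(Rep_padic_int u k * w (Suc k)) mod ?q ^ k = (Rep_padic_int u (Suc k) * w (Suc k)) mod ?q ^ k"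
      using Rep_padic_int_mod[of k "Suc k" u] by (metis le_Suc_eq mod_mult_left_eq order_refl)
    also have "\<dots> = ((Rep_padic_int u (Suc k) * w (Suc k)) mod ?q ^ Suc k) mod ?q ^ k"
      by (simp only: mod_mod_cancel[OF d])
    also have "\<dots> = 1 mod ?q ^ k" unfolding w by (rule mod_mod_cancel[OF d])
    finally have "[Rep_padic_int u k * w (Suc k) = Rep_padic_int u k * w k] (mod ?q ^ k)"
      using w[of k] by (simp add: cong_def)
    then have "[w (Suc k) = w k] (mod ?q ^ k)"
      using cong_mult_lcancel[OF cop[of k]] by blast
    then show ?thesis by (simp add: cong_def w_def)
  qed
  have Rep: "Rep_padic_int (Abs_padic_int w :: 'p padic_int) m = w m" for m
    by (subst Abs_padic_int_inverse, intro CollectI allI, rule coh, rule refl)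
  have "u * Abs_padic_int w = 1"
    by (rule padic_int_eqI) (simp add: times_padic_int.rep_eq one_padic_int.rep_eq Rep w)
  then show ?thesis by blast
qed

lemma padic_int_decompose:
  fixes x :: "'p::prime_card padic_int"
  assumes "x \<noteq> 0"
  shows "\<exists>k u. x = uniformizer ^ k * u \<and> residue_mod_p u \<noteq> 0"
proof -
  let ?k = "padic_int_val x"
  have "uniformizer ^ ?k dvd x" "\<not> uniformizer ^ Suc ?k dvd x"
    using padic_int_val_ge_iff[OF assms, of ?k] padic_int_val_ge_iff[OF assms, of "Suc ?k"]
    unfolding uniformizer_power_dvd_iff by auto
  moreover from this obtain u where u: "x = uniformizer ^ ?k * u" by blast
  ultimately have "\<not> uniformizer dvd u"
    using mult_dvd_mono[of "uniformizer ^ ?k" "uniformizer ^ ?k" uniformizer u] by (metis dvd_refl power_Suc2)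
  then show ?thesis using u residue_eq_0_iff by blast
qed

lemma dvd_of_abs_le:
  fixes a b :: "'p::prime_card padic_int"
  assumes "padic_int_abs a \<le> padic_int_abs b" "b \<noteq> 0"
  shows "b dvd a"
proof -
  obtain k u where b: "b = uniformizer ^ k * u" "residue_mod_p u \<noteq> 0"
    using padic_int_decompose[OF assms(2)] by blast
  obtain w where w: "u * w = 1" using ex_padic_int_inverse[OF b(2)] by blast
  have "padic_int_abs b \<le> inverse (real CARD('p) ^ k)"
    unfolding padic_int_abs_le_iff using b by simp
  then have "uniformizer ^ k dvd a" using assms(1) padic_int_abs_le_iff order_trans by blast
  then obtain c where "a = uniformizer ^ k * c" by blast
  then have "a = b * (w * c)" using w b by (metis mult.assoc mult.left_commute mult_1)
  then show ?thesis by simp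
qed

lemma of_padic_int_hom:
  fixes x y :: "'p::prime_card padic_int"
  shows "of_padic_int (x + y) = of_padic_int x + of_padic_int y"
    and "of_padic_int (x * y) = of_padic_int x * of_padic_int y"
    and "of_padic_int (x - y) = of_padic_int x - of_padic_int y"
    and "of_padic_int (0 :: 'p padic_int) = 0" and "of_padic_int (1 :: 'p padic_int) = 1"
proof -
  show "of_padic_int (x + y) = of_padic_int x + of_padic_int y" by transfer simp
  show "of_padic_int (x * y) = of_padic_int x * of_padic_int y" by transfer simp
  show "of_padic_int (x - y) = of_padic_int x - of_padic_int y" by transfer simp
  show "of_padic_int (0 :: 'p padic_int) = 0" by transfer (simp add: Zero_fract_def)
  show "of_padic_int (1 :: 'p padic_int) = 1" by transfer (simp add: One_fract_def)
qed

lemma of_padic_int_power: "of_padic_int (x ^ n) = of_padic_int x ^ n"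
  by (induction n) (simp_all add: of_padic_int_hom)

lemma of_padic_int_sum: "of_padic_int (\<Sum>x\<in>A. f x) = (\<Sum>x\<in>A. of_padic_int (f x))"
  by (induction A rule: infinite_finite_induct) (simp_all add: of_padic_int_hom)

lemma of_padic_int_prod: "of_padic_int (\<Prod>x\<in>A. f x) = (\<Prod>x\<in>A. of_padic_int (f x))"
  by (induction A rule: infinite_finite_induct) (simp_all add: of_padic_int_hom)

lemma of_padic_int_eq_iff: "of_padic_int x = of_padic_int y \<longleftrightarrow> x = y"
proof -
  have "of_padic_int x = of_padic_int y \<longleftrightarrow> padic_abs (of_padic_int (x - y)) = 0"
    by (simp add: of_padic_int_hom)
  also have "\<dots> \<longleftrightarrow> x = y" unfolding padic_abs_of_padic_int by simp
  finally show ?thesis .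
qed

lemma padic_int_abs_le_1: "padic_int_abs x \<le> 1"
  using padic_int_abs_le_iff[of x 0] by simp

text \<open>A fraction of absolute value at most one has a numerator divisible by its denominator.
  Integrality thus becomes a condition on \<open>padic_abs\<close>, from which \<open>Zp_vec\<close>
  is seen to be Borel.\<close>

lemma range_of_padic_int: "q \<in> range of_padic_int \<longleftrightarrow> padic_abs q \<le> 1"
proof
  assume "q \<in> range of_padic_int"
  then show "padic_abs q \<le> 1" by (auto simp: padic_abs_of_padic_int padic_int_abs_le_1)
next
  assume q: "padic_abs q \<le> 1"
  have "\<exists>a b. b \<noteq> 0 \<and> q * of_padic_int b = of_padic_int a"
  proof transfer
    fix q :: "'a padic_int fract"
    obtain a b where "q = Fract a b" "b \<noteq> 0" by (cases q)
    then show "\<exists>a b. b \<noteq> 0 \<and> q * Fract b 1 = Fract a 1"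
      by (intro exI[of _ a] exI[of _ b]) (simp add: eq_fract)
  qed
  then obtain a b where ab: "b \<noteq> 0" "q * of_padic_int b = of_padic_int a" by blast
  have "padic_int_abs a = padic_abs q * padic_int_abs b"
    using arg_cong[OF ab(2), of padic_abs] by (simp add: padic_abs_mult padic_abs_of_padic_int)
  then have "padic_int_abs a \<le> padic_int_abs b" using q by (simp add: mult_left_le_one_le)
  then obtain c where "a = b * c" using dvd_of_abs_le ab(1) by blast
  then have "q * of_padic_int b = of_padic_int c * of_padic_int b"
    using ab(2) by (simp add: of_padic_int_hom)
  moreover have "of_padic_int b \<noteq> 0" using ab(1) of_padic_int_eq_iff[of b 0] by (simp add: of_padic_int_hom)
  ultimately have "q = of_padic_int c" by simp
  then show "q \<in> range of_padic_int" by simp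
qed

section \<open>Evaluation of polynomials\<close>

definition monom_eval :: "'a::comm_ring_1 ^ 'n \<Rightarrow> ('n::finite \<Rightarrow>\<^sub>0 nat) \<Rightarrow> 'a" where
  "monom_eval a \<omega> = (\<Prod>i\<in>UNIV. (a $ i) ^ Poly_Mapping.lookup \<omega> i)"

lemma mpoly_eval_superset:
  assumes "finite K" "Poly_Mapping.keys f \<subseteq> K"
  shows "mpoly_eval a f = (\<Sum>\<omega>\<in>K. Poly_Mapping.lookup f \<omega> * monom_eval a \<omega>)"
  unfolding mpoly_eval_def monom_eval_def
  by (rule sum.mono_neutral_left) (use assms in \<open>auto simp: in_keys_iff\<close>)

lemma mpoly_eval_add: "mpoly_eval a (f + g) = mpoly_eval a f + mpoly_eval a g"
proof -
  let ?K = "Poly_Mapping.keys f \<union> Poly_Mapping.keys g"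
  have "mpoly_eval a h = (\<Sum>\<omega>\<in>?K. Poly_Mapping.lookup h \<omega> * monom_eval a \<omega>)" if "Poly_Mapping.keys h \<subseteq> ?K" for h
    using that by (intro mpoly_eval_superset) auto
  then show ?thesis
    using Poly_Mapping.keys_add[of f g] by (simp add: lookup_add distrib_right sum.distrib)
qed

lemma mpoly_eval_0: "mpoly_eval a 0 = 0"
  by (simp add: mpoly_eval_def)

lemma mpoly_eval_sum: "mpoly_eval a (\<Sum>x\<in>A. f x) = (\<Sum>x\<in>A. mpoly_eval a (f x))"
  by (induction A rule: infinite_finite_induct) (simp_all add: mpoly_eval_0 mpoly_eval_add)

lemma mpoly_eval_single: "mpoly_eval a (Poly_Mapping.single \<omega> c) = c * monom_eval a \<omega>"
  by (subst mpoly_eval_superset[of "{\<omega>}"]) (auto split: if_splits)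

lemma eval_Qp_of_padic_int:
  fixes f :: "('n::finite, 'p::prime_card padic_int) mpoly"
  shows "eval_Qp f (\<chi> i. of_padic_int (u $ i)) = of_padic_int (mpoly_eval u f)"
proof -
  have "Poly_Mapping.keys (Poly_Mapping.map of_padic_int f) \<subseteq> Poly_Mapping.keys f"
    by (auto simp: in_keys_iff map.rep_eq when_def of_padic_int_hom)
  then have "eval_Qp f (\<chi> i. of_padic_int (u $ i)) = (\<Sum>\<omega>\<in>Poly_Mapping.keys f.
      Poly_Mapping.lookup (Poly_Mapping.map of_padic_int f) \<omega> * monom_eval (\<chi> i. of_padic_int (u $ i)) \<omega>)"
    by (intro mpoly_eval_superset) auto
  also have "\<dots> = of_padic_int (mpoly_eval u f)"
    unfolding mpoly_eval_def monom_eval_def of_padic_int_sum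
    by (intro sum.cong) (auto simp: map.rep_eq when_def of_padic_int_hom of_padic_int_prod of_padic_int_power in_keys_iff)
  finally show ?thesis .
qed

lemma lookup_reduce_face_part:
  fixes g :: "('n::finite, 'p::prime_card padic_int) mpoly"
  shows "Poly_Mapping.lookup (reduce_mod_p (face_part g \<tau>)) \<omega> =
    (if \<omega> \<in> Poly_Mapping.keys g \<and> expvec \<omega> \<in> \<tau> then residue_mod_p (Poly_Mapping.lookup g \<omega>) else 0)"
proof -
  have "Poly_Mapping.lookup (face_part g \<tau>) \<omega> =
    (\<Sum>\<alpha>\<in>{\<alpha> \<in> Poly_Mapping.keys g. expvec \<alpha> \<in> \<tau>}. (if \<alpha> = \<omega> then Poly_Mapping.lookup g \<omega> else 0))"
    unfolding face_part_def lookup_sum by (intro sum.cong) (auto simp: lookup_single when_def)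
  also have "\<dots> = (if \<omega> \<in> Poly_Mapping.keys g \<and> expvec \<omega> \<in> \<tau> then Poly_Mapping.lookup g \<omega> else 0)"
    by (subst sum.delta) auto
  finally show ?thesis by (simp add: map.rep_eq when_def residue_hom)
qed

lemma keys_reduce_face_part:
  "Poly_Mapping.keys (reduce_mod_p (face_part g \<tau>)) \<subseteq> {\<omega> \<in> Poly_Mapping.keys g. expvec \<omega> \<in> \<tau>}"
  by (auto simp: in_keys_iff lookup_reduce_face_part split: if_splits)

text \<open>The sum runs over the exponents of \<open>g\<close> and not over those of the reduction,
  because coefficients divisible by p disappear on reduction.\<close>

lemma eval_reduce_face_part:
  "mpoly_eval a (reduce_mod_p (face_part g \<tau>)) =
    (\<Sum>\<omega> | \<omega> \<in> Poly_Mapping.keys g \<and> expvec \<omega> \<in> \<tau>. residue_mod_p (Poly_Mapping.lookup g \<omega>) * monom_eval a \<omega>)"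
  by (subst mpoly_eval_superset[OF _ keys_reduce_face_part])
    (auto simp: lookup_reduce_face_part intro!: sum.cong)

text \<open>The value of the partial derivative of a monomial over an arbitrary ring, so that it can
  be compared before and after reduction modulo p. If the variable does not occur, the truncated
  exponent does no harm, as the leading factor is zero.\<close>

definition monom_deriv_eval :: "'n \<Rightarrow> 'a::comm_ring_1 ^ 'n \<Rightarrow> ('n::finite \<Rightarrow>\<^sub>0 nat) \<Rightarrow> 'a" where
  "monom_deriv_eval i a \<omega> = of_nat (Poly_Mapping.lookup \<omega> i) * (a $ i) ^ (Poly_Mapping.lookup \<omega> i - 1) *
     (\<Prod>j\<in>UNIV - {i}. (a $ j) ^ Poly_Mapping.lookup \<omega> j)"

lemma monom_eval_split:
  "monom_eval a \<omega> = (a $ i) ^ Poly_Mapping.lookup \<omega> i * (\<Prod>j\<in>UNIV - {i}. (a $ j) ^ Poly_Mapping.lookup \<omega> j)"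
  unfolding monom_eval_def by (rule prod.remove) auto

lemma eval_deriv_reduce_face_part:
  "mpoly_eval a (mpoly_deriv i (reduce_mod_p (face_part g \<tau>))) =
    (\<Sum>\<omega> | \<omega> \<in> Poly_Mapping.keys g \<and> expvec \<omega> \<in> \<tau>.
       residue_mod_p (Poly_Mapping.lookup g \<omega>) * monom_deriv_eval i a \<omega>)"
proof -
  let ?f = "reduce_mod_p (face_part g \<tau>)"
  have "mpoly_eval a (mpoly_deriv i ?f) =
    (\<Sum>\<omega>\<in>Poly_Mapping.keys ?f. Poly_Mapping.lookup ?f \<omega> * monom_deriv_eval i a \<omega>)"
    unfolding mpoly_deriv_def mpoly_eval_sum mpoly_eval_single
  proof (rule sum.cong)
    fix \<omega>
    have "monom_eval a (\<omega> - Poly_Mapping.single i 1) = (a $ i) ^ (Poly_Mapping.lookup \<omega> i - 1) *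
        (\<Prod>j\<in>UNIV - {i}. (a $ j) ^ Poly_Mapping.lookup \<omega> j)"
      unfolding monom_eval_split[of a _ i]
      by (intro arg_cong2[where f = "(*)"] prod.cong) (auto simp: lookup_minus lookup_single when_def)
    then show "of_nat (Poly_Mapping.lookup \<omega> i) * Poly_Mapping.lookup ?f \<omega> * monom_eval a (\<omega> - Poly_Mapping.single i 1)
      = Poly_Mapping.lookup ?f \<omega> * monom_deriv_eval i a \<omega>"
      by (simp add: monom_deriv_eval_def ac_simps)
  qed simp
  also have "\<dots> = (\<Sum>\<omega> | \<omega> \<in> Poly_Mapping.keys g \<and> expvec \<omega> \<in> \<tau>. Poly_Mapping.lookup ?f \<omega> * monom_deriv_eval i a \<omega>)"
    by (rule sum.mono_neutral_left) (use keys_reduce_face_part[of g \<tau>] in \<open>auto simp: in_keys_iff\<close>)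
  also have "\<dots> = (\<Sum>\<omega> | \<omega> \<in> Poly_Mapping.keys g \<and> expvec \<omega> \<in> \<tau>.
       residue_mod_p (Poly_Mapping.lookup g \<omega>) * monom_deriv_eval i a \<omega>)"
    by (rule sum.cong) (auto simp: lookup_reduce_face_part)
  finally show ?thesis .
qed

text \<open>A first-order Taylor expansion without denominators. For an increment divisible by p^j
  with j >= 1, the remainder is divisible by p^(2j) and hence by p^(j+1), as the Hensel step
  requires.\<close>

lemma power_add_expand:
  fixes x h :: "'a::comm_ring_1"
  shows "\<exists>r. (x + h) ^ e = x ^ e + h * (of_nat e * x ^ (e - 1)) + h ^ 2 * r"
proof (induction e)
  case (Suc e)
  then obtain r where r: "(x + h) ^ e = x ^ e + h * (of_nat e * x ^ (e - 1)) + h ^ 2 * r" by blast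
  have "(x + h) ^ Suc e = (x + h) * (x ^ e + h * (of_nat e * x ^ (e - 1)) + h ^ 2 * r)" by (simp add: r)
  also have "\<dots> = x ^ Suc e + h * (of_nat e * (x * x ^ (e - 1)) + x ^ e) +
      h ^ 2 * (of_nat e * x ^ (e - 1) + (x + h) * r)"
    by (simp add: algebra_simps power2_eq_square)
  also have "of_nat e * (x * x ^ (e - 1)) = of_nat e * x ^ e"
    by (cases e) auto
  finally have "(x + h) ^ Suc e = x ^ Suc e + h * (of_nat (Suc e) * x ^ (Suc e - 1)) +
      h ^ 2 * (of_nat e * x ^ (e - 1) + (x + h) * r)"
    by (simp add: algebra_simps)
  then show ?case by blast
qed (auto intro: exI[of _ 0])

lemma monom_eval_add_axis:
  fixes u :: "'a::comm_ring_1 ^ 'n::finite"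
  shows "\<exists>r. monom_eval (u + axis i h) \<omega> = monom_eval u \<omega> + h * monom_deriv_eval i u \<omega> + h ^ 2 * r"
proof -
  let ?e = "Poly_Mapping.lookup \<omega> i" and ?P = "\<Prod>j\<in>UNIV - {i}. (u $ j) ^ Poly_Mapping.lookup \<omega> j"
  obtain r where r: "(u $ i + h) ^ ?e = (u $ i) ^ ?e + h * (of_nat ?e * (u $ i) ^ (?e - 1)) + h ^ 2 * r"
    using power_add_expand by blast
  have "(\<Prod>j\<in>UNIV - {i}. ((u + axis i h) $ j) ^ Poly_Mapping.lookup \<omega> j) = ?P"
    by (rule prod.cong) (auto simp: axis_def)
  then have "monom_eval (u + axis i h) \<omega> = (u $ i + h) ^ ?e * ?P"
    unfolding monom_eval_split[of _ \<omega> i] by (simp add: axis_def)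
  also have "\<dots> = monom_eval u \<omega> + h * monom_deriv_eval i u \<omega> + h ^ 2 * (r * ?P)"
    unfolding r monom_deriv_eval_def monom_eval_split[of u \<omega> i] by (simp add: algebra_simps)
  finally show ?thesis by blast
qed


section \<open>Measurability on the p-adic affine space\<close>

lemma tendsto_padic_add:
  fixes f h :: "'a \<Rightarrow> 'p::prime_card padic"
  assumes "(f \<longlongrightarrow> a) F" "(h \<longlongrightarrow> b) F"
  shows "((\<lambda>x. f x + h x) \<longlongrightarrow> a + b) F"
proof (rule tendstoI)
  fix e :: real assume "e > 0"
  then have "\<forall>\<^sub>F x in F. dist (f x) a < e" "\<forall>\<^sub>F x in F. dist (h x) b < e"
    using assms tendstoD by blast+
  then show "\<forall>\<^sub>F x in F. dist (f x + h x) (a + b) < e"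
  proof eventually_elim
    case (elim x)
    have "dist (f x + h x) (a + b) = padic_abs ((f x - a) + (h x - b))"
      by (simp add: dist_padic_def algebra_simps)
    also have "\<dots> < e"
      using padic_abs_ultrametric[of "f x - a" "h x - b"] elim by (simp add: dist_padic_def)
    finally show ?case .
  qed
qed

lemma tendsto_padic_mult:
  fixes f h :: "'a \<Rightarrow> 'p::prime_card padic"
  assumes "(f \<longlongrightarrow> a) F" "(h \<longlongrightarrow> b) F"
  shows "((\<lambda>x. f x * h x) \<longlongrightarrow> a * b) F"
proof (rule tendstoI)
  fix e :: real assume e: "e > 0"
  define A where "A = padic_abs a + 1"
  define B where "B = padic_abs b + 1"
  have AB: "A > 0" "B > 0" by (simp_all add: A_def B_def add_nonneg_pos)
  have "\<forall>\<^sub>F x in F. dist (f x) a < e / B" "\<forall>\<^sub>F x in F. dist (h x) b < e / A" "\<forall>\<^sub>F x in F. dist (h x) b < 1"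
    using e AB assms by (auto intro!: tendstoD)
  then show "\<forall>\<^sub>F x in F. dist (f x * h x) (a * b) < e"
  proof eventually_elim
    case (elim x)
    have "padic_abs (h x) \<le> max (padic_abs (h x - b)) (padic_abs b)"
      using padic_abs_ultrametric[of "h x - b" b] by simp
    then have hB: "padic_abs (h x) \<le> B" using elim(3) unfolding B_def dist_padic_def
      by (smt (verit) padic_abs_nonneg)
    have "padic_abs ((f x - a) * h x) \<le> padic_abs (f x - a) * B"
      unfolding padic_abs_mult by (rule mult_left_mono[OF hB]) simp
    also have "\<dots> < e / B * B" using elim(1) AB by (intro mult_strict_right_mono) (auto simp: dist_padic_def)
    finally have 1: "padic_abs ((f x - a) * h x) < e" using AB by simp
    have "padic_abs (a * (h x - b)) \<le> A * padic_abs (h x - b)"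
      unfolding padic_abs_mult by (rule mult_right_mono) (simp_all add: A_def)
    also have "\<dots> < A * (e / A)" using elim(2) AB by (intro mult_strict_left_mono) (auto simp: dist_padic_def)
    finally have 2: "padic_abs (a * (h x - b)) < e" using AB by simp
    have "dist (f x * h x) (a * b) = padic_abs ((f x - a) * h x + a * (h x - b))"
      by (simp add: dist_padic_def algebra_simps)
    also have "\<dots> < e"
      using padic_abs_ultrametric[of "(f x - a) * h x" "a * (h x - b)"] 1 2 by simp
    finally show ?case .
  qed
qed

lemma tendsto_padic_sum:
  fixes f :: "'b \<Rightarrow> 'a \<Rightarrow> 'p::prime_card padic"
  assumes "\<And>i. i \<in> S \<Longrightarrow> (f i \<longlongrightarrow> a i) F"
  shows "((\<lambda>x. \<Sum>i\<in>S. f i x) \<longlongrightarrow> (\<Sum>i\<in>S. a i)) F"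
  using assms by (induction S rule: infinite_finite_induct) (auto intro: tendsto_padic_add)

lemma tendsto_padic_power:
  fixes f :: "'a \<Rightarrow> 'p::prime_card padic"
  assumes "(f \<longlongrightarrow> a) F"
  shows "((\<lambda>x. f x ^ n) \<longlongrightarrow> a ^ n) F"
  using assms by (induction n) (auto intro: tendsto_padic_mult)

lemma tendsto_padic_prod:
  fixes f :: "'b \<Rightarrow> 'a \<Rightarrow> 'p::prime_card padic"
  assumes "\<And>i. i \<in> S \<Longrightarrow> (f i \<longlongrightarrow> a i) F"
  shows "((\<lambda>x. \<Prod>i\<in>S. f i x) \<longlongrightarrow> (\<Prod>i\<in>S. a i)) F"
  using assms by (induction S rule: infinite_finite_induct) (auto intro: tendsto_padic_mult)

lemma tendsto_padic_abs:
  fixes f :: "'a \<Rightarrow> 'p::prime_card padic"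
  assumes "(f \<longlongrightarrow> a) F"
  shows "((\<lambda>x. padic_abs (f x)) \<longlongrightarrow> padic_abs a) F"
proof (rule tendstoI)
  fix e :: real assume "e > 0"
  then have "\<forall>\<^sub>F x in F. dist (f x) a < e" using assms tendstoD by blast
  then show "\<forall>\<^sub>F x in F. dist (padic_abs (f x)) (padic_abs a) < e"
  proof eventually_elim
    case (elim x)
    have "padic_abs (f x) \<le> max (padic_abs (f x - a)) (padic_abs a)"
      using padic_abs_ultrametric[of "f x - a" a] by simp
    moreover have "padic_abs a \<le> max (padic_abs (f x - a)) (padic_abs (f x))"
      using padic_abs_ultrametric[of "a - f x" "f x"] padic_abs_minus[of "f x - a"] by simp
    moreover have "padic_abs (f x - a) \<ge> 0" "padic_abs (f x) \<ge> 0" "padic_abs a \<ge> 0" by simp_all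
    ultimately have "\<bar>padic_abs (f x) - padic_abs a\<bar> \<le> padic_abs (f x - a)"
      by linarith
    then show ?case using elim by (simp add: dist_padic_def dist_real_def)
  qed
qed

lemma borel_measurable_abs_eval:
  fixes f :: "('n::finite, 'p::prime_card padic) mpoly"
  shows "(\<lambda>x. padic_abs (mpoly_eval x f)) \<in> borel_measurable borel"
proof (rule borel_measurable_continuous_onI)
  show "continuous_on UNIV (\<lambda>x. padic_abs (mpoly_eval x f))"
    unfolding continuous_on_def mpoly_eval_def
    by (intro ballI tendsto_padic_abs tendsto_padic_sum tendsto_padic_mult tendsto_padic_prod
        tendsto_padic_power tendsto_const tendsto_vec_nth tendsto_ident_at)
qed

lemma borel_measurable_abs_coordinate:
  "(\<lambda>x :: 'p::prime_card padic ^ 'n. padic_abs (x $ i + c)) \<in> borel_measurable borel"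
proof (rule borel_measurable_continuous_onI)
  show "continuous_on UNIV (\<lambda>x :: 'p padic ^ 'n. padic_abs (x $ i + c))"
    unfolding continuous_on_def
    by (intro ballI tendsto_padic_abs tendsto_padic_add tendsto_const tendsto_vec_nth tendsto_ident_at)
qed

lemma measurable_translate:
  "(\<lambda>x :: 'p::prime_card padic ^ 'n::finite. a + x) \<in> borel \<rightarrow>\<^sub>M borel"
proof (rule borel_measurable_continuous_onI)
  show "continuous_on UNIV (\<lambda>x :: 'p padic ^ 'n. a + x)"
    unfolding continuous_on_def
    by (intro ballI vec_tendstoI) (auto intro!: tendsto_padic_add tendsto_vec_nth tendsto_ident_at)
qed

section \<open>Borel sets of integral points\<close>

definition embed_vec :: "'p::prime_card padic_int ^ 'n \<Rightarrow> 'p padic ^ 'n" where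
  "embed_vec u = (\<chi> i. of_padic_int (u $ i))"

lemma inj_embed_vec: "inj embed_vec"
  by (rule injI) (simp add: embed_vec_def vec_eq_iff of_padic_int_eq_iff)

lemma range_embed_vec: "range embed_vec = Zp_vec"
proof (intro equalityI subsetI)
  fix x assume "x \<in> (Zp_vec :: ('p::prime_card padic ^ 'n) set)"
  then have "\<forall>i. \<exists>y. x $ i = of_padic_int y" unfolding Zp_vec_def by blast
  then obtain y where "\<And>i. x $ i = of_padic_int (y i)" by metis
  then have "x = embed_vec (\<chi> i. y i)" by (simp add: embed_vec_def vec_eq_iff)
  then show "x \<in> range embed_vec" by simp
qed (auto simp: embed_vec_def Zp_vec_def)

lemma embed_vec_add: "embed_vec (u + v) = embed_vec u + embed_vec v"
  by (simp add: embed_vec_def vec_eq_iff of_padic_int_hom)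

lemma eval_embed_vec: "padic_abs (eval_Qp f (embed_vec u)) = padic_int_abs (mpoly_eval u f)"
  by (simp add: embed_vec_def eval_Qp_of_padic_int padic_abs_of_padic_int)

text \<open>Sets of integral vectors are measured through their images in the affine space over the
  field; divisibility arguments can then stay in the ring of p-adic integers.\<close>

definition padic_measurable :: "('p::prime_card padic_int ^ 'n::finite) set \<Rightarrow> bool" where
  "padic_measurable S \<longleftrightarrow> embed_vec ` S \<in> sets borel"

lemma sets_Zp_vec: "(Zp_vec :: ('p::prime_card padic ^ 'n::finite) set) \<in> sets borel"
proof -
  have "(Zp_vec :: ('p padic ^ 'n) set) = (\<Inter>i\<in>UNIV. {x. padic_abs (x $ i + 0) \<le> 1})"
    by (auto simp: Zp_vec_def range_of_padic_int)
  also have "\<dots> \<in> sets borel"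
  proof (intro sets.finite_INT)
    fix i :: 'n
    have "{x \<in> space borel. padic_abs (x $ i + 0) \<le> 1} \<in> sets (borel :: ('p padic ^ 'n) measure)"
      by (intro borel_measurable_le borel_measurable_abs_coordinate borel_measurable_const)
    then show "{x :: 'p padic ^ 'n. padic_abs (x $ i + 0) \<le> 1} \<in> sets borel" by simp
  qed auto
  finally show ?thesis .
qed

lemma padic_measurable_UNIV: "padic_measurable UNIV"
  by (simp add: padic_measurable_def range_embed_vec sets_Zp_vec)

lemma padic_measurable_Int:
  "padic_measurable S \<Longrightarrow> padic_measurable T \<Longrightarrow> padic_measurable (S \<inter> T)"
  unfolding padic_measurable_def image_Int[OF inj_embed_vec] by (rule sets.Int)

lemma padic_measurable_diff:
  "padic_measurable S \<Longrightarrow> padic_measurable T \<Longrightarrow> padic_measurable (S - T)"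
  unfolding padic_measurable_def image_set_diff[OF inj_embed_vec] by (rule sets.Diff)

lemma padic_measurable_INT:
  fixes S :: "'i::finite \<Rightarrow> ('p::prime_card padic_int ^ 'n::finite) set"
  assumes "\<And>i. padic_measurable (S i)"
  shows "padic_measurable (\<Inter>i. S i)"
proof -
  have "embed_vec ` (\<Inter>i. S i) = (\<Inter>i. embed_vec ` S i)"
    by (rule image_INT[OF inj_embed_vec]) auto
  also have "\<dots> \<in> sets borel" using assms by (intro sets.finite_INT) (auto simp: padic_measurable_def)
  finally show ?thesis by (simp add: padic_measurable_def)
qed

lemma padic_measurable_UN:
  "countable A \<Longrightarrow> (\<And>a. a \<in> A \<Longrightarrow> padic_measurable (S a)) \<Longrightarrow> padic_measurable (\<Union>a\<in>A. S a)"
  unfolding padic_measurable_def image_UN by (rule sets.countable_UN') auto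

lemma padic_measurable_dvd_eval:
  fixes f :: "('n::finite, 'p::prime_card padic_int) mpoly"
  shows "padic_measurable {u. uniformizer ^ N dvd mpoly_eval u f}"
proof -
  let ?A = "{x \<in> space borel. padic_abs (eval_Qp f x) \<le> inverse (real CARD('p) ^ N)}"
  have "embed_vec ` {u. uniformizer ^ N dvd mpoly_eval u f} = Zp_vec \<inter> ?A"
    unfolding range_embed_vec[symmetric]
    by (auto simp: eval_embed_vec padic_int_abs_le_iff)
  moreover have "?A \<in> sets borel" using borel_measurable_abs_eval by (intro borel_measurable_le) auto
  ultimately show ?thesis unfolding padic_measurable_def using sets_Zp_vec by auto
qed

lemma padic_measurable_dvd_coordinate:
  fixes c :: "'p::prime_card padic_int"
  shows "padic_measurable {u :: 'p padic_int ^ 'n::finite. uniformizer ^ N dvd u $ i - c}"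
proof -
  let ?A = "{x :: 'p padic ^ 'n \<in> space borel. padic_abs (x $ i + of_padic_int (- c)) \<le> inverse (real CARD('p) ^ N)}"
  have "padic_abs (embed_vec u $ i + of_padic_int (- c)) = padic_int_abs (u $ i - c)" for u :: "'p padic_int ^ 'n"
    by (simp add: embed_vec_def padic_abs_of_padic_int flip: of_padic_int_hom)
  then have "embed_vec ` {u :: 'p padic_int ^ 'n. uniformizer ^ N dvd u $ i - c} = Zp_vec \<inter> ?A"
    unfolding range_embed_vec[symmetric] by (auto simp: padic_int_abs_le_iff)
  moreover have "?A \<in> sets borel" using borel_measurable_abs_coordinate by (intro borel_measurable_le) auto
  ultimately show ?thesis unfolding padic_measurable_def using sets_Zp_vec by auto
qed

lemma embed_vec_translate: "embed_vec ` (+) c ` S = (\<lambda>x. embed_vec c + x) ` embed_vec ` S"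
  by (auto simp: image_image embed_vec_add)

lemma padic_measurable_translate:
  assumes "padic_measurable S"
  shows "padic_measurable ((+) c ` S)"
proof -
  have "(\<lambda>x. embed_vec c + x) ` A = (\<lambda>x. - embed_vec c + x) -` A \<inter> space borel" for A :: "('a padic ^ 'b) set"
    by (auto simp: image_iff intro!: bexI[of _ "- embed_vec c + _"])
  moreover have "(\<lambda>x. - embed_vec c + x) -` (embed_vec ` S) \<inter> space borel \<in> sets borel"
    using assms unfolding padic_measurable_def by (rule measurable_sets[OF measurable_translate])
  ultimately show ?thesis unfolding padic_measurable_def embed_vec_translate by simp
qed

section \<open>Volumes\<close>

lemma ex_digit: "\<exists>t<CARD('p::prime_card). uniformizer dvd (y :: 'p padic_int) - of_nat t"
proof -
  obtain t where "t < CARD('p)" "residue_mod_p y = of_nat t"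
    using surj_of_nat_mod_ring[of "residue_mod_p y"] by blast
  then show ?thesis
    by (intro exI[of _ t]) (simp add: residue_hom residue_of_nat flip: residue_eq_0_iff)
qed

definition padic_box :: "'p::prime_card padic_int ^ 'n::finite \<Rightarrow> ('n \<Rightarrow> nat) \<Rightarrow> ('p padic_int ^ 'n) set" where
  "padic_box c l = {u. \<forall>i. uniformizer ^ l i dvd u $ i - c $ i}"

lemma padic_measurable_box: "padic_measurable (padic_box c l)"
proof -
  have "padic_box c l = (\<Inter>i. {u. uniformizer ^ l i dvd u $ i - c $ i})"
    by (auto simp: padic_box_def)
  then show ?thesis by (simp only: padic_measurable_INT padic_measurable_dvd_coordinate)
qed

locale padic_haar =
  fixes \<mu> :: "('p::prime_card padic ^ 'n::finite) measure"
  assumes haar: "normalized_haar \<mu>"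
begin

abbreviation vol :: "('p padic_int ^ 'n) set \<Rightarrow> real" where
  "vol S \<equiv> measure \<mu> (embed_vec ` S)"

lemma sets_haar: "sets \<mu> = sets borel"
  using haar by (simp add: normalized_haar_def)

lemma vol_UNIV: "vol UNIV = 1"
  using haar by (simp add: normalized_haar_def range_embed_vec measure_def)

lemma emeasure_finite:
  assumes "padic_measurable S"
  shows "emeasure \<mu> (embed_vec ` S) < \<infinity>"
proof -
  have "emeasure \<mu> (embed_vec ` S) \<le> emeasure \<mu> Zp_vec"
    by (rule emeasure_mono) (use range_embed_vec sets_Zp_vec sets_haar in auto)
  also have "\<dots> < \<infinity>" using haar by (simp add: normalized_haar_def)
  finally show ?thesis .
qed

lemma vol_translate:
  assumes "padic_measurable S"
  shows "vol ((+) c ` S) = vol S"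
  using haar assms unfolding normalized_haar_def embed_vec_translate padic_measurable_def measure_def
  by simp

lemma vol_UN:
  assumes "finite A" "\<And>a. a \<in> A \<Longrightarrow> padic_measurable (S a)"
    and "\<And>a b x. a \<in> A \<Longrightarrow> b \<in> A \<Longrightarrow> x \<in> S a \<Longrightarrow> x \<in> S b \<Longrightarrow> a = b"
  shows "vol (\<Union>a\<in>A. S a) = (\<Sum>a\<in>A. vol (S a))"
  unfolding image_UN
proof (rule measure_finite_Union[OF assms(1)])
  show "(\<lambda>a. embed_vec ` S a) ` A \<subseteq> sets \<mu>" using assms(2) by (auto simp: padic_measurable_def sets_haar)
  show "disjoint_family_on (\<lambda>a. embed_vec ` S a) A"
    unfolding disjoint_family_on_def
  proof (intro ballI impI)
    fix a b assume ab: "a \<in> A" "b \<in> A" "a \<noteq> b"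
    then have "S a \<inter> S b = {}" using assms(3) by blast
    then show "embed_vec ` S a \<inter> embed_vec ` S b = {}" by (simp flip: image_Int[OF inj_embed_vec])
  qed
  show "emeasure \<mu> (embed_vec ` S a) \<noteq> \<infinity>" if "a \<in> A" for a
    using emeasure_finite[OF assms(2)[OF that]] by simp
qed

text \<open>The counting principle behind both the volumes of boxes and the Hensel step: p disjoint
  translates have equal volume.\<close>

lemma vol_split:
  assumes T: "padic_measurable T"
    and disj: "\<And>s t x y. s < CARD('p) \<Longrightarrow> t < CARD('p) \<Longrightarrow> x \<in> T \<Longrightarrow> y \<in> T \<Longrightarrow> c s + x = c t + y \<Longrightarrow> s = t"
    and S: "S = (\<Union>t<CARD('p). (+) (c t) ` T)"
  shows "vol S = real CARD('p) * vol T"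
proof -
  have "vol S = (\<Sum>t<CARD('p). vol ((+) (c t) ` T))"
    unfolding S
  proof (rule vol_UN)
    show "s = t" if "s \<in> {..<CARD('p)}" "t \<in> {..<CARD('p)}" "x \<in> (+) (c s) ` T" "x \<in> (+) (c t) ` T" for s t x
      using that disj by blast
  qed (simp_all add: padic_measurable_translate T)
  then show ?thesis by (simp add: vol_translate T)
qed

text \<open>Induction on the total number of prescribed digits. Lowering one exponent from e + 1 to
  e gives a box that splits into p translates of the original, one for each value of the digit at
  position e.\<close>

lemma vol_box_0:
  "vol (padic_box 0 l) * real CARD('p) ^ (\<Sum>i\<in>UNIV. l i) = 1"
proof (induction "\<Sum>i\<in>UNIV. l i" arbitrary: l)
  case 0
  then have "l i = 0" for i by simp
  then have "padic_box 0 l = (UNIV :: ('p padic_int ^ 'n) set)" by (simp add: padic_box_def)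
  then show ?case unfolding 0[symmetric] using vol_UNIV by simp
next
  case (Suc N)
  have "\<exists>i. l i \<noteq> 0"
  proof (rule ccontr)
    assume "\<nexists>i. l i \<noteq> 0"
    then show False using Suc(2) by simp
  qed
  then obtain i e where e: "l i = Suc e" by (metis not0_implies_Suc)
  define l' where "l' = l(i := e)"
  have "(\<Sum>j\<in>UNIV. l j) = Suc e + (\<Sum>j\<in>UNIV - {i}. l j)" using sum.remove[of UNIV i l] e by simp
  moreover have "(\<Sum>j\<in>UNIV. l' j) = e + (\<Sum>j\<in>UNIV - {i}. l j)"
    using sum.remove[of UNIV i l'] by (simp add: l'_def)
  ultimately have s: "(\<Sum>j\<in>UNIV. l j) = Suc (\<Sum>j\<in>UNIV. l' j)" by simp
  let ?c = "\<lambda>t. axis i (of_nat t * uniformizer ^ e) :: 'p padic_int ^ 'n"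
  have "vol (padic_box 0 l') = real CARD('p) * vol (padic_box 0 l)"
  proof (rule vol_split[where c = ?c])
    show "s = t" if st: "s < CARD('p)" "t < CARD('p)" "x \<in> padic_box 0 l" "y \<in> padic_box 0 l" "?c s + x = ?c t + y"
      for s t x y
    proof -
      have "uniformizer ^ Suc e dvd x $ i" "uniformizer ^ Suc e dvd y $ i"
        using st(3,4) unfolding padic_box_def e[symmetric] by simp_all
      then obtain x' y' where xy: "x $ i = uniformizer ^ Suc e * x'" "y $ i = uniformizer ^ Suc e * y'"
        unfolding dvd_def by blast
      have "of_nat s * uniformizer ^ e + x $ i = of_nat t * uniformizer ^ e + y $ i"
        using arg_cong[OF st(5), of "\<lambda>v. v $ i"] by (simp add: axis_def)
      then have "uniformizer ^ e * (of_nat s + uniformizer * x') = uniformizer ^ e * (of_nat t + uniformizer * y')"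
        unfolding xy by (simp add: algebra_simps)
      moreover have "(uniformizer :: 'p padic_int) ^ e \<noteq> 0" using uniformizer_nonzero by (rule power_not_zero)
      ultimately have "of_nat s + uniformizer * x' = of_nat t + uniformizer * y'"
        by (simp only: mult_cancel_left) simp
      from arg_cong[OF this, of residue_mod_p] have "(of_nat s :: 'p mod_ring) = of_nat t"
        by (simp add: residue_hom residue_of_nat)
      then show ?thesis by (rule residue_of_nat_inj[OF st(1,2)])
    qed
    show "padic_box 0 l' = (\<Union>t<CARD('p). (+) (?c t) ` padic_box 0 l)"
    proof (intro equalityI subsetI)
      fix u :: "'p padic_int ^ 'n" assume u: "u \<in> padic_box 0 l'"
      then have ui: "uniformizer ^ l' j dvd u $ j" for j unfolding padic_box_def by simp
      obtain y where y: "u $ i = uniformizer ^ e * y" using ui[of i] by (auto simp: l'_def)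
      obtain t where t: "t < CARD('p)" "uniformizer dvd y - of_nat t" using ex_digit by blast
      have "u - ?c t \<in> padic_box 0 l"
        unfolding padic_box_def
      proof (intro CollectI allI)
        fix j
        show "uniformizer ^ l j dvd (u - ?c t) $ j - 0 $ j"
        proof (cases "j = i")
          case True
          have "(u - ?c t) $ i = uniformizer ^ e * (y - of_nat t)" by (simp add: y axis_def algebra_simps)
          then show ?thesis using t(2) True e by (simp add: mult_dvd_mono mult.commute)
        next
          case False
          then show ?thesis using ui[of j] by (simp add: l'_def axis_def)
        qed
      qed
      moreover have "u = ?c t + (u - ?c t)" by simp
      ultimately show "u \<in> (\<Union>t<CARD('p). (+) (?c t) ` padic_box 0 l)" using t(1) by blast
    next
      fix u assume "u \<in> (\<Union>t<CARD('p). (+) (?c t) ` padic_box 0 l)"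
      then obtain t x where x: "x \<in> padic_box 0 l" "u = ?c t + x" by blast
      show "u \<in> padic_box 0 l'" unfolding padic_box_def
      proof (intro CollectI allI)
        fix j
        have xj: "uniformizer ^ l j dvd x $ j" using x(1) by (simp add: padic_box_def)
        show "uniformizer ^ l' j dvd u $ j - 0 $ j"
        proof (cases "j = i")
          case True
          then have "uniformizer ^ e dvd x $ i" using xj e by (metis dvd_mult_right power_Suc)
          then show ?thesis using True by (simp add: l'_def x(2) axis_def dvd_add)
        qed (use xj in \<open>simp add: l'_def x(2) axis_def\<close>)
      qed
    qed
  qed (rule padic_measurable_box)
  moreover have "vol (padic_box 0 l') * real CARD('p) ^ (\<Sum>i\<in>UNIV. l' i) = 1"
    using Suc(1)[of l'] Suc(2) s by simp
  ultimately show ?case unfolding s by (simp add: ac_simps)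
qed

lemma vol_box: "vol (padic_box c l) = inverse (real CARD('p)) ^ (\<Sum>i\<in>UNIV. l i)"
proof -
  have "padic_box c l = (+) c ` padic_box 0 l"
  proof (intro equalityI subsetI)
    fix u assume "u \<in> padic_box c l"
    then have "u - c \<in> padic_box 0 l" by (simp add: padic_box_def)
    then show "u \<in> (+) c ` padic_box 0 l" by (intro image_eqI[of _ _ "u - c"]) simp
  qed (auto simp: padic_box_def)
  then have "vol (padic_box c l) = vol (padic_box 0 l)"
    using vol_translate[OF padic_measurable_box] by metis
  then show ?thesis using vol_box_0[of l] by (simp add: field_simps power_inverse)
qed

lemma padic_integrable:
  fixes f :: "'p padic ^ 'n \<Rightarrow> 'b::{banach, second_countable_topology}"
  assumes "padic_measurable S" "f \<in> borel_measurable borel" "\<And>u. u \<in> S \<Longrightarrow> norm (f (embed_vec u)) \<le> B"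
  shows "set_integrable \<mu> (embed_vec ` S) f"
  unfolding set_integrable_def
proof (rule integrableI_bounded_set_indicator[where B = B])
  show "embed_vec ` S \<in> sets \<mu>" using assms(1) by (simp add: padic_measurable_def sets_haar)
  show "f \<in> borel_measurable \<mu>" using assms(2) measurable_cong_sets[OF sets_haar refl] by blast
  show "emeasure \<mu> (embed_vec ` S) < \<infinity>" by (rule emeasure_finite[OF assms(1)])
  show "AE x in \<mu>. x \<in> embed_vec ` S \<longrightarrow> norm (f x) \<le> B" using assms(3) by auto
qed

lemma padic_integral_const:
  fixes c :: real
  assumes "padic_measurable S" "\<And>u. u \<in> S \<Longrightarrow> f (embed_vec u) = c"
  shows "(LINT x:embed_vec ` S|\<mu>. f x) = c * vol S"
proof -
  have S: "embed_vec ` S \<in> sets \<mu>" using assms(1) by (simp add: padic_measurable_def sets_haar)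
  have "(LINT x:embed_vec ` S|\<mu>. f x) = (LINT x:embed_vec ` S|\<mu>. c)"
    by (rule set_lebesgue_integral_cong[OF S]) (use assms(2) in auto)
  also have "\<dots> = c * vol S"
    using S emeasure_finite[OF assms(1)] by (simp add: set_lebesgue_integral_def sets.Int_space_eq2)
  finally show ?thesis .
qed

end


section \<open>Integrals over cosets of the unit group\<close>

definition scale_vec :: "('n \<Rightarrow> nat) \<Rightarrow> 'p::prime_card padic_int ^ 'n \<Rightarrow> 'p padic_int ^ 'n" where
  "scale_vec k u = (\<chi> i. uniformizer ^ k i * u $ i)"

definition residue_vec :: "'p::prime_card padic_int ^ 'n \<Rightarrow> 'p mod_ring ^ 'n" where
  "residue_vec u = (\<chi> i. residue_mod_p (u $ i))"

text \<open>If all coordinates of \<open>a\<close> are nonzero, these are the vectors whose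
  coordinates have valuations \<open>k\<close> and leading digits \<open>a\<close>.\<close>

definition padic_cell :: "('n \<Rightarrow> nat) \<Rightarrow> 'p::prime_card mod_ring ^ 'n \<Rightarrow> ('p padic_int ^ 'n) set" where
  "padic_cell k a = scale_vec k ` {u. residue_vec u = a}"

lemma ex_residue_vec: "\<exists>u. residue_vec u = a"
proof -
  have "\<forall>i. \<exists>t. a $ i = of_nat t" using surj_of_nat_mod_ring by metis
  then obtain t where "\<And>i. a $ i = of_nat (t i)" by metis
  then have "residue_vec (\<chi> i. of_nat (t i)) = a"
    by (simp add: residue_vec_def residue_of_nat vec_eq_iff)
  then show ?thesis by blast
qed

text \<open>Prescribing the digit at position \<open>k i\<close>, with zeros before it, amounts to
  fixing the coordinate modulo p^(k i + 1).\<close>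

lemma padic_cell_eq_box:
  fixes v :: "'p::prime_card padic_int ^ 'n::finite"
  assumes "residue_vec v = a"
  shows "padic_cell k a = padic_box (scale_vec k v) (\<lambda>i. Suc (k i))"
proof (intro equalityI subsetI)
  fix x assume "x \<in> padic_cell k a"
  then obtain u where u: "x = scale_vec k u" "residue_vec u = a" unfolding padic_cell_def by blast
  have "uniformizer dvd u $ i - v $ i" for i
    using u(2) assms by (simp add: residue_vec_def residue_hom vec_eq_iff flip: residue_eq_0_iff)
  then have "uniformizer ^ k i * uniformizer dvd uniformizer ^ k i * (u $ i - v $ i)" for i
    by (intro mult_dvd_mono) auto
  then show "x \<in> padic_box (scale_vec k v) (\<lambda>i. Suc (k i))"
    by (simp add: padic_box_def u(1) scale_vec_def right_diff_distrib mult.commute)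
next
  fix x assume "x \<in> padic_box (scale_vec k v) (\<lambda>i. Suc (k i))"
  then have "\<forall>i. \<exists>y. x $ i - uniformizer ^ k i * v $ i = uniformizer ^ Suc (k i) * y"
    by (auto simp: padic_box_def scale_vec_def elim!: dvdE)
  then obtain y where y: "\<And>i. x $ i - uniformizer ^ k i * v $ i = uniformizer ^ Suc (k i) * y i" by metis
  define u where "u = (\<chi> i. v $ i + uniformizer * y i)"
  have "x $ i = uniformizer ^ k i * (v $ i + uniformizer * y i)" for i
    using y[of i] by (simp add: algebra_simps)
  then have "x = scale_vec k u" by (simp add: scale_vec_def u_def vec_eq_iff)
  moreover have "residue_vec u = a"
    using assms by (simp add: residue_vec_def u_def residue_hom residue_uniformizer vec_eq_iff)
  ultimately show "x \<in> padic_cell k a" unfolding padic_cell_def by blast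
qed

lemma padic_measurable_cell: "padic_measurable (padic_cell k a)"
  using ex_residue_vec[of a] padic_cell_eq_box padic_measurable_box by metis

lemma unit_not_dvd:
  fixes u :: "'p::prime_card padic_int"
  assumes "residue_mod_p u \<noteq> 0"
  shows "\<not> uniformizer ^ Suc k dvd uniformizer ^ k * u"
proof
  assume "uniformizer ^ Suc k dvd uniformizer ^ k * u"
  then have "uniformizer ^ k * uniformizer dvd uniformizer ^ k * u" by (simp only: power_Suc2)
  then have "uniformizer dvd u"
    using uniformizer_nonzero[where 'p='p] by (subst (asm) dvd_mult_cancel_left) simp
  then show False using assms by (simp add: residue_eq_0_iff)
qed

lemma padic_cell_unique:
  fixes x :: "'p::prime_card padic_int ^ 'n::finite" and a a' :: "'p mod_ring ^ 'n"
  assumes x: "x \<in> padic_cell k a" "x \<in> padic_cell k' a'" and a: "\<And>i. a $ i \<noteq> 0" "\<And>i. a' $ i \<noteq> 0"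
  shows "k = k' \<and> a = a'"
proof -
  obtain u u' where u: "x = scale_vec k u" "residue_vec u = a" "x = scale_vec k' u'" "residue_vec u' = a'"
    using x unfolding padic_cell_def by blast
  have r: "residue_mod_p (u $ i) \<noteq> 0" "residue_mod_p (u' $ i) \<noteq> 0" for i
    using a u(2,4) by (auto simp: residue_vec_def)
  have eq: "uniformizer ^ k i * u $ i = uniformizer ^ k' i * u' $ i" for i
    using arg_cong[OF trans[OF u(1)[symmetric] u(3)], of "\<lambda>v. v $ i"] by (simp add: scale_vec_def)
  have no: "\<not> l < l'" if "uniformizer ^ l * w = uniformizer ^ l' * w'" "residue_mod_p w \<noteq> 0"
    for l l' and w w' :: "'p padic_int"
  proof
    assume "l < l'"
    then have "uniformizer ^ Suc l dvd uniformizer ^ l' * w'"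
      by (intro dvd_mult2 le_imp_power_dvd) simp
    then show False using that unit_not_dvd by metis
  qed
  have k: "k i = k' i" for i
    using no[OF eq[of i] r(1)] no[OF eq[of i, symmetric] r(2)] by simp
  have "u $ i = u' $ i" for i
    using eq[of i] k[of i] uniformizer_nonzero[where 'p='p] by simp
  then have "u = u'" by (simp add: vec_eq_iff)
  then show ?thesis using k u by auto
qed

lemma ex_padic_cell:
  fixes x :: "'p::prime_card padic_int ^ 'n::finite"
  assumes "\<And>i. x $ i \<noteq> 0"
  shows "\<exists>k. \<exists>a :: 'p mod_ring ^ 'n. (\<forall>i. a $ i \<noteq> 0) \<and> x \<in> padic_cell k a"
proof -
  have "\<forall>i. \<exists>k u. x $ i = uniformizer ^ k * u \<and> residue_mod_p u \<noteq> 0"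
    using assms padic_int_decompose by blast
  then obtain k u where ku: "\<And>i. x $ i = uniformizer ^ k i * u i" "\<And>i. residue_mod_p (u i) \<noteq> 0" by metis
  then have "x = scale_vec k (\<chi> i. u i)" by (simp add: scale_vec_def vec_eq_iff)
  then have "x \<in> padic_cell k (residue_vec (\<chi> i. u i))" unfolding padic_cell_def by blast
  moreover have "residue_vec (\<chi> i. u i) $ i \<noteq> 0" for i using ku(2) by (simp add: residue_vec_def)
  ultimately show ?thesis by blast
qed

lemma residue_monom_eval: "residue_mod_p (monom_eval u \<omega>) = monom_eval (residue_vec u) \<omega>"
  by (simp add: monom_eval_def residue_vec_def residue_prod residue_power)

lemma residue_monom_deriv_eval: "residue_mod_p (monom_deriv_eval i u \<omega>) = monom_deriv_eval i (residue_vec u) \<omega>"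
  by (simp add: monom_deriv_eval_def residue_vec_def residue_prod residue_power residue_hom residue_of_nat)

text \<open>The inner product of \<open>k\<close> with the exponent, kept as a natural number so
  that it can serve as an exponent of the uniformizer.\<close>

definition exponent_weight :: "('n::finite \<Rightarrow> nat) \<Rightarrow> ('n \<Rightarrow>\<^sub>0 nat) \<Rightarrow> nat" where
  "exponent_weight k \<omega> = (\<Sum>i\<in>UNIV. k i * Poly_Mapping.lookup \<omega> i)"

lemma monom_eval_scale_vec:
  "monom_eval (scale_vec k u) \<omega> = uniformizer ^ exponent_weight k \<omega> * monom_eval u \<omega>"
  by (simp add: monom_eval_def scale_vec_def exponent_weight_def power_mult_distrib prod.distrib power_sum
      flip: power_mult)

definition torus :: "('p::prime_card mod_ring ^ 'n::finite) set" where
  "torus = {a. \<forall>i. a $ i \<noteq> 0}"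

lemma card_torus: "card (torus :: ('p::prime_card mod_ring ^ 'n::finite) set) = (CARD('p) - 1) ^ CARD('n)"
proof -
  have "bij_betw vec_lambda (PiE (UNIV :: 'n set) (\<lambda>_. UNIV - {0 :: 'p mod_ring})) torus"
    by (rule bij_betwI[where g = vec_nth]) (auto simp: torus_def)
  then have "card (torus :: ('p mod_ring ^ 'n) set) = card (PiE (UNIV :: 'n set) (\<lambda>_. UNIV - {0 :: 'p mod_ring}))"
    by (simp add: bij_betw_same_card)
  also have "\<dots> = (CARD('p) - 1) ^ CARD('n)"
    by (simp add: card_PiE card_Diff_singleton)
  finally show ?thesis .
qed

text \<open>One shell at a time: \<open>m\<close> plays the role of m_g(k) and \<open>\<tau>\<close>
  that of the face F_g(k), and non-degeneracy is stated for this face.\<close>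

locale cell_poly = padic_haar \<mu> for \<mu> :: "('p::prime_card padic ^ 'n::finite) measure" +
  fixes g :: "('n, 'p padic_int) mpoly" and k :: "'n \<Rightarrow> nat" and m :: nat and \<tau> :: "(real ^ 'n) set"
  assumes m_le: "\<And>\<omega>. \<omega> \<in> Poly_Mapping.keys g \<Longrightarrow> m \<le> exponent_weight k \<omega>"
    and face: "\<And>\<omega>. \<omega> \<in> Poly_Mapping.keys g \<Longrightarrow> expvec \<omega> \<in> \<tau> \<longleftrightarrow> exponent_weight k \<omega> = m"
    and nondeg: "\<And>a. a \<in> torus \<Longrightarrow> mpoly_eval a (reduce_mod_p (face_part g \<tau>)) = 0 \<Longrightarrow>
      \<exists>i. mpoly_eval a (mpoly_deriv i (reduce_mod_p (face_part g \<tau>))) \<noteq> 0"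
begin

text \<open>The substitution of p^(k_i) u_i for the variables in \<open>g\<close>, divided by p^m.
  Its coefficients are integral because \<open>m\<close> is the least weight.\<close>

definition scaled_poly :: "'p padic_int ^ 'n \<Rightarrow> 'p padic_int" where
  "scaled_poly u = (\<Sum>\<omega>\<in>Poly_Mapping.keys g. Poly_Mapping.lookup g \<omega> * uniformizer ^ (exponent_weight k \<omega> - m) * monom_eval u \<omega>)"

definition scaled_deriv :: "'n \<Rightarrow> 'p padic_int ^ 'n \<Rightarrow> 'p padic_int" where
  "scaled_deriv i u = (\<Sum>\<omega>\<in>Poly_Mapping.keys g. Poly_Mapping.lookup g \<omega> * uniformizer ^ (exponent_weight k \<omega> - m) * monom_deriv_eval i u \<omega>)"

abbreviation "\<gamma> a \<equiv> mpoly_eval a (reduce_mod_p (face_part g \<tau>))"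

lemma eval_scale_vec: "mpoly_eval (scale_vec k u) g = uniformizer ^ m * scaled_poly u"
proof -
  have "mpoly_eval (scale_vec k u) g =
    (\<Sum>\<omega>\<in>Poly_Mapping.keys g. Poly_Mapping.lookup g \<omega> * (uniformizer ^ exponent_weight k \<omega> * monom_eval u \<omega>))"
    by (subst mpoly_eval_superset[OF finite_keys order_refl]) (simp add: monom_eval_scale_vec)
  also have "\<dots> = uniformizer ^ m * scaled_poly u"
    unfolding scaled_poly_def sum_distrib_left
  proof (rule sum.cong[OF refl])
    fix \<omega> assume "\<omega> \<in> Poly_Mapping.keys g"
    then have "(uniformizer :: 'p padic_int) ^ exponent_weight k \<omega> = uniformizer ^ m * uniformizer ^ (exponent_weight k \<omega> - m)"
      using m_le[of \<omega>] by (simp flip: power_add)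
    then show "Poly_Mapping.lookup g \<omega> * (uniformizer ^ exponent_weight k \<omega> * monom_eval u \<omega>) =
        uniformizer ^ m * (Poly_Mapping.lookup g \<omega> * uniformizer ^ (exponent_weight k \<omega> - m) * monom_eval u \<omega>)"
      by (simp only: ac_simps)
  qed
  finally show ?thesis .
qed

text \<open>Off the face the uniformizer occurs with a positive exponent and reduces to zero, while
  on the face \<open>0 ^ 0\<close> is one. The free function \<open>F\<close> covers both the value
  and the derivatives.\<close>

lemma residue_face_sum:
  "(\<Sum>\<omega>\<in>Poly_Mapping.keys g. residue_mod_p (Poly_Mapping.lookup g \<omega>) * 0 ^ (exponent_weight k \<omega> - m) * F \<omega>) =
   (\<Sum>\<omega> | \<omega> \<in> Poly_Mapping.keys g \<and> expvec \<omega> \<in> \<tau>. residue_mod_p (Poly_Mapping.lookup g \<omega>) * F \<omega>)"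
proof (rule sum.mono_neutral_cong_right)
  show "\<forall>\<omega>\<in>Poly_Mapping.keys g - {\<omega>. \<omega> \<in> Poly_Mapping.keys g \<and> expvec \<omega> \<in> \<tau>}.
    residue_mod_p (Poly_Mapping.lookup g \<omega>) * 0 ^ (exponent_weight k \<omega> - m) * F \<omega> = 0"
  proof
    fix \<omega> assume "\<omega> \<in> Poly_Mapping.keys g - {\<omega>. \<omega> \<in> Poly_Mapping.keys g \<and> expvec \<omega> \<in> \<tau>}"
    then have "exponent_weight k \<omega> - m \<noteq> 0" using m_le[of \<omega>] face[of \<omega>] by auto
    then show "residue_mod_p (Poly_Mapping.lookup g \<omega>) * 0 ^ (exponent_weight k \<omega> - m) * F \<omega> = 0"
      by (simp add: power_0_left)
  qed
qed (auto simp: face)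

lemma residue_scaled_poly: "residue_mod_p (scaled_poly u) = \<gamma> (residue_vec u)"
  unfolding scaled_poly_def residue_sum residue_hom residue_power residue_uniformizer residue_monom_eval
    eval_reduce_face_part by (rule residue_face_sum)

lemma residue_scaled_deriv: "residue_mod_p (scaled_deriv i u) =
    mpoly_eval (residue_vec u) (mpoly_deriv i (reduce_mod_p (face_part g \<tau>)))"
  unfolding scaled_deriv_def residue_sum residue_hom residue_power residue_uniformizer residue_monom_deriv_eval
    eval_deriv_reduce_face_part by (rule residue_face_sum)

lemma scaled_poly_add_axis: "\<exists>r. scaled_poly (u + axis i h) = scaled_poly u + h * scaled_deriv i u + h ^ 2 * r"
proof -
  have "\<forall>\<omega>. \<exists>r. monom_eval (u + axis i h) \<omega> = monom_eval u \<omega> + h * monom_deriv_eval i u \<omega> + h ^ 2 * r"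
    using monom_eval_add_axis by blast
  from choice[OF this] obtain r where
    "\<forall>\<omega>. monom_eval (u + axis i h) \<omega> = monom_eval u \<omega> + h * monom_deriv_eval i u \<omega> + h ^ 2 * r \<omega>" by (rule exE)
  then have r: "monom_eval (u + axis i h) \<omega> = monom_eval u \<omega> + h * monom_deriv_eval i u \<omega> + h ^ 2 * r \<omega>" for \<omega>
    by blast
  let ?b = "\<lambda>\<omega>. Poly_Mapping.lookup g \<omega> * uniformizer ^ (exponent_weight k \<omega> - m)"
  have "scaled_poly (u + axis i h) = scaled_poly u + h * scaled_deriv i u + h ^ 2 * (\<Sum>\<omega>\<in>Poly_Mapping.keys g. ?b \<omega> * r \<omega>)"
    unfolding scaled_poly_def scaled_deriv_def r by (simp add: sum.distrib sum_distrib_left distrib_left ac_simps)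
  then show ?thesis by blast
qed

definition dvd_cell :: "'p mod_ring ^ 'n \<Rightarrow> nat \<Rightarrow> ('p padic_int ^ 'n) set" where
  "dvd_cell a j = {x \<in> padic_cell k a. uniformizer ^ (m + j) dvd mpoly_eval x g}"

lemma padic_measurable_dvd_cell: "padic_measurable (dvd_cell a j)"
proof -
  have "dvd_cell a j = padic_cell k a \<inter> {x. uniformizer ^ (m + j) dvd mpoly_eval x g}" by (auto simp: dvd_cell_def)
  then show ?thesis
    by (simp only: padic_measurable_Int padic_measurable_cell padic_measurable_dvd_eval)
qed

lemma dvd_cell_iff: "x \<in> dvd_cell a j \<longleftrightarrow> (\<exists>u. x = scale_vec k u \<and> residue_vec u = a \<and> uniformizer ^ j dvd scaled_poly u)"
proof -
  have "uniformizer ^ (m + j) dvd uniformizer ^ m * scaled_poly u \<longleftrightarrow> uniformizer ^ j dvd scaled_poly u" for u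
    using uniformizer_nonzero[where 'p='p] unfolding power_add by (subst dvd_mult_cancel_left) simp
  then show ?thesis unfolding dvd_cell_def padic_cell_def by (auto simp: eval_scale_vec)
qed

lemma vol_cell: "vol (padic_cell k a) = inverse (real CARD('p)) ^ ((\<Sum>i\<in>UNIV. k i) + CARD('n))"
proof -
  obtain v where "residue_vec v = a" using ex_residue_vec by blast
  then show ?thesis by (simp add: padic_cell_eq_box vol_box sum_Suc)
qed

lemma dvd_cell_0: "dvd_cell a 0 = padic_cell k a"
  by (auto simp: dvd_cell_iff padic_cell_def)

lemma dvd_cell_1_zero: "\<gamma> a = 0 \<Longrightarrow> dvd_cell a 1 = padic_cell k a"
proof -
  assume "\<gamma> a = 0"
  then have "uniformizer dvd scaled_poly u" if "residue_vec u = a" for u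
    using that by (simp add: residue_scaled_poly flip: residue_eq_0_iff)
  then show ?thesis unfolding set_eq_iff dvd_cell_iff padic_cell_def image_iff power_one_right by blast
qed

lemma dvd_cell_1_nonzero: "\<gamma> a \<noteq> 0 \<Longrightarrow> dvd_cell a 1 = {}"
proof -
  assume "\<gamma> a \<noteq> 0"
  then have "\<not> uniformizer dvd scaled_poly u" if "residue_vec u = a" for u
    using that by (simp add: residue_scaled_poly flip: residue_eq_0_iff)
  then show ?thesis by (auto simp: dvd_cell_iff)
qed

text \<open>The Hensel step: translations by the multiples of \<open>p ^ j\<close> in a direction with nonvanishing
  partial derivative permute the residue classes of the value modulo \<open>p ^ (j + 1)\<close>.\<close>

lemma dvd_Suc_translate:
  assumes j: "j \<ge> 1" and y: "scaled_poly u = uniformizer ^ j * y"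
  shows "uniformizer ^ j dvd scaled_poly (u + axis i (z * uniformizer ^ j))"
    and "uniformizer ^ Suc j dvd scaled_poly (u + axis i (z * uniformizer ^ j)) \<longleftrightarrow>
      residue_mod_p y + residue_mod_p z * residue_mod_p (scaled_deriv i u) = 0"
proof -
  let ?h = "z * uniformizer ^ j"
  obtain r where r: "scaled_poly (u + axis i ?h) = scaled_poly u + ?h * scaled_deriv i u + ?h ^ 2 * r" using scaled_poly_add_axis by blast
  have eq: "scaled_poly (u + axis i ?h) = uniformizer ^ j * (y + z * scaled_deriv i u + uniformizer ^ j * (z ^ 2 * r))"
    unfolding r y by (simp add: algebra_simps power2_eq_square)
  show "uniformizer ^ j dvd scaled_poly (u + axis i ?h)" unfolding eq by simp
  have "uniformizer ^ Suc j dvd scaled_poly (u + axis i ?h) \<longleftrightarrow>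
      uniformizer dvd y + z * scaled_deriv i u + uniformizer ^ j * (z ^ 2 * r)"
    unfolding eq power_Suc2 using uniformizer_nonzero[where 'p='p] by (subst dvd_mult_cancel_left) simp
  also have "\<dots> \<longleftrightarrow> residue_mod_p y + residue_mod_p z * residue_mod_p (scaled_deriv i u) = 0"
    using j by (simp add: residue_hom residue_power residue_uniformizer power_0_left flip: residue_eq_0_iff)
  finally show "uniformizer ^ Suc j dvd scaled_poly (u + axis i ?h) \<longleftrightarrow>
      residue_mod_p y + residue_mod_p z * residue_mod_p (scaled_deriv i u) = 0" .
qed

text \<open>Moving \<open>u\<close> by t p^j in a direction with nonvanishing derivative d changes
  the value by t p^j d modulo p^(j+1). Exactly one of the p digits t makes a value divisible by p^j
  divisible by p^(j+1), which presents the larger set as p translates of the smaller one.\<close>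

lemma vol_dvd_cell_Suc:
  assumes a: "a \<in> torus" "\<gamma> a = 0" and j: "j \<ge> 1"
  shows "vol (dvd_cell a j) = real CARD('p) * vol (dvd_cell a (Suc j))"
proof -
  obtain i where i: "mpoly_eval a (mpoly_deriv i (reduce_mod_p (face_part g \<tau>))) \<noteq> 0"
    using nondeg[OF a] by blast
  have \<rho>: "residue_mod_p (scaled_deriv i u) \<noteq> 0" if "residue_vec u = a" for u
    using i that by (simp add: residue_scaled_deriv)
  have res: "residue_vec (u + axis i (z * uniformizer ^ j)) = residue_vec u" for u and z :: "'p padic_int"
    using j by (simp add: residue_vec_def vec_eq_iff axis_def residue_hom residue_power residue_uniformizer power_0_left)
  have scale: "scale_vec k (u + axis i (z * uniformizer ^ j)) = scale_vec k u + axis i (z * uniformizer ^ (k i + j))"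
    for u and z :: "'p padic_int"
    by (auto simp: scale_vec_def vec_eq_iff axis_def algebra_simps power_add)
  \<comment> \<open>In the coordinates \<open>u\<close> this is the translation by t p^j; the
    additional \<open>k i\<close> comes from \<open>scale_vec\<close>.\<close>
  let ?c = "\<lambda>t. axis i (of_nat t * uniformizer ^ (k i + j)) :: 'p padic_int ^ 'n"
  show ?thesis
  proof (rule vol_split[where c = ?c])
    show "padic_measurable (dvd_cell a (Suc j))" by (rule padic_measurable_dvd_cell)
    show "s = t" if st: "s < CARD('p)" "t < CARD('p)" and xy: "x \<in> dvd_cell a (Suc j)" "y \<in> dvd_cell a (Suc j)" "?c s + x = ?c t + y"
      for s t x y
    proof -
      obtain u w where u: "x = scale_vec k u" "residue_vec u = a" "uniformizer ^ Suc j dvd scaled_poly u"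
        and w: "y = scale_vec k w" "uniformizer ^ Suc j dvd scaled_poly w"
        using xy(1,2) unfolding dvd_cell_iff by blast
      define z :: "'p padic_int" where "z = of_nat s - of_nat t"
      have "scale_vec k w = scale_vec k (u + axis i (z * uniformizer ^ j))"
      proof -
        have "y = x + (?c s - ?c t)" using xy(3) by (simp add: algebra_simps)
        also have "?c s - ?c t = axis i (z * uniformizer ^ (k i + j))"
          by (simp add: z_def vec_eq_iff axis_def left_diff_distrib)
        finally show ?thesis unfolding scale u(1) w(1) .
      qed
      then have "w = u + axis i (z * uniformizer ^ j)"
        using uniformizer_nonzero[where 'p='p] by (simp add: scale_vec_def vec_eq_iff)
      then have dw: "uniformizer ^ Suc j dvd scaled_poly (u + axis i (z * uniformizer ^ j))" using w(2) by simp
      obtain y' where y': "scaled_poly u = uniformizer ^ Suc j * y'" using u(3) by blast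
      have "residue_mod_p (uniformizer * y') + residue_mod_p z * residue_mod_p (scaled_deriv i u) = 0"
        using dvd_Suc_translate(2)[OF j, of u "uniformizer * y'" i z] dw y' by (simp add: ac_simps)
      then have "residue_mod_p z = 0" using \<rho>[OF u(2)] by (simp add: residue_hom residue_uniformizer)
      then have "(of_nat s :: 'p mod_ring) = of_nat t" by (simp add: z_def residue_hom residue_of_nat)
      then show ?thesis using st residue_of_nat_inj by blast
    qed
    show "dvd_cell a j = (\<Union>t<CARD('p). (+) (?c t) ` dvd_cell a (Suc j))"
    proof (intro equalityI subsetI)
      fix x assume "x \<in> dvd_cell a j"
      then obtain u y where u: "x = scale_vec k u" "residue_vec u = a" "scaled_poly u = uniformizer ^ j * y"
        unfolding dvd_cell_iff by blast
      \<comment> \<open>The digit \<open>t\<close> solves the linear congruence y - t d = 0 modulo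
        p, where d is the derivative.\<close>
      obtain t where t: "t < CARD('p)" "residue_mod_p y / residue_mod_p (scaled_deriv i u) = of_nat t"
        using surj_of_nat_mod_ring by blast
      have "residue_mod_p (- of_nat t) = - (of_nat t :: 'p mod_ring)"
        using residue_hom(2)[of 0 "of_nat t :: 'p padic_int"] by (simp add: residue_of_nat residue_hom)
      then have "residue_mod_p y + residue_mod_p (- of_nat t) * residue_mod_p (scaled_deriv i u) = 0"
      proof -
        have "residue_mod_p y = of_nat t * residue_mod_p (scaled_deriv i u)"
          using t(2) nonzero_divide_eq_eq[OF \<rho>[OF u(2)]] by metis
        then show ?thesis using \<open>residue_mod_p (- of_nat t) = - of_nat t\<close> by simp
      qed
      then have "uniformizer ^ Suc j dvd scaled_poly (u + axis i (- of_nat t * uniformizer ^ j))"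
        using dvd_Suc_translate(2)[OF j u(3)] by blast
      then have "scale_vec k (u + axis i (- of_nat t * uniformizer ^ j)) \<in> dvd_cell a (Suc j)"
        unfolding dvd_cell_iff using res[of u "- of_nat t"] u(2) by blast
      moreover have "x = ?c t + scale_vec k (u + axis i (- of_nat t * uniformizer ^ j))"
        unfolding scale u(1) by (simp add: vec_eq_iff axis_def)
      ultimately show "x \<in> (\<Union>t<CARD('p). (+) (?c t) ` dvd_cell a (Suc j))" using t(1) by blast
    next
      fix x assume "x \<in> (\<Union>t<CARD('p). (+) (?c t) ` dvd_cell a (Suc j))"
      then obtain t y0 where y0: "y0 \<in> dvd_cell a (Suc j)" "x = ?c t + y0" by blast
      then obtain u where u: "x = ?c t + scale_vec k u" "residue_vec u = a" "uniformizer ^ Suc j dvd scaled_poly u"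
        unfolding dvd_cell_iff by blast
      obtain y where "scaled_poly u = uniformizer ^ Suc j * y" using u(3) by (rule dvdE)
      then have y: "scaled_poly u = uniformizer ^ j * (uniformizer * y)" by (simp only: power_Suc2 mult.assoc)
      have "x = scale_vec k (u + axis i (of_nat t * uniformizer ^ j))" unfolding scale u(1) by simp
      then show "x \<in> dvd_cell a j" unfolding dvd_cell_iff using dvd_Suc_translate(1)[OF j y, of i "of_nat t"] res[of u "of_nat t"] u(2) by metis
    qed
  qed
qed

text \<open>The geometric decay begins at index one: since the reduction vanishes at
  \<open>a\<close>, the first divisibility holds on the entire cell.\<close>

lemma vol_dvd_cell:
  assumes "a \<in> torus" "\<gamma> a = 0"
  shows "vol (dvd_cell a (Suc j)) = vol (padic_cell k a) * inverse (real CARD('p)) ^ j"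
proof (induction j)
  case 0
  then show ?case using dvd_cell_1_zero[OF assms(2)] by simp
next
  case (Suc j)
  have "vol (dvd_cell a (Suc (Suc j))) = inverse (real CARD('p)) * vol (dvd_cell a (Suc j))"
    using vol_dvd_cell_Suc[OF assms, of "Suc j"] prime_card_gt_1[where 'p='p] by (simp add: field_simps)
  then show ?case using Suc by simp
qed

abbreviation "abs_g x \<equiv> padic_abs (eval_Qp g x)"

lemma abs_g_integrable: "padic_measurable S \<Longrightarrow> set_integrable \<mu> (embed_vec ` S) abs_g"
  by (rule padic_integrable[where B = 1]) (auto simp: borel_measurable_abs_eval eval_embed_vec padic_int_abs_le_1)

definition dvd_cell_integral :: "'p mod_ring ^ 'n \<Rightarrow> nat \<Rightarrow> real" where
  "dvd_cell_integral a j = (LINT x:embed_vec ` dvd_cell a j|\<mu>. abs_g x)"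

lemma dvd_cell_antimono: "dvd_cell a (Suc j) \<subseteq> dvd_cell a j"
  by (auto simp: dvd_cell_def intro: dvd_trans[rotated] le_imp_power_dvd)

lemma abs_g_bounds:
  assumes "x \<in> dvd_cell a j"
  shows "abs_g (embed_vec x) \<le> inverse (real CARD('p)) ^ (m + j)"
    and "x \<notin> dvd_cell a (Suc j) \<Longrightarrow> abs_g (embed_vec x) = inverse (real CARD('p)) ^ (m + j)"
  using assms padic_int_abs_le_iff[of "mpoly_eval x g" "m + j"] padic_int_abs_eqI[of "m + j" "mpoly_eval x g"]
  by (auto simp: dvd_cell_def eval_embed_vec power_inverse)

lemma vol_diff: "padic_measurable S \<Longrightarrow> padic_measurable T \<Longrightarrow> T \<subseteq> S \<Longrightarrow> vol (S - T) = vol S - vol T"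
  unfolding image_set_diff[OF inj_embed_vec]
  by (rule measure_Diff) (use emeasure_finite[of S] in \<open>auto simp: padic_measurable_def sets_haar\<close>)

text \<open>On the part that is removed the valuation of the value of \<open>g\<close> is exactly
  \<open>m + j\<close>, so \<open>abs_g\<close> is constant there.\<close>

lemma dvd_cell_integral_Suc: "dvd_cell_integral a j = inverse (real CARD('p)) ^ (m + j) * (vol (dvd_cell a j) - vol (dvd_cell a (Suc j))) + dvd_cell_integral a (Suc j)"
proof -
  let ?D = "dvd_cell a j - dvd_cell a (Suc j)"
  have D: "padic_measurable ?D" by (intro padic_measurable_diff padic_measurable_dvd_cell)
  have "embed_vec ` dvd_cell a j = embed_vec ` ?D \<union> embed_vec ` dvd_cell a (Suc j)" using dvd_cell_antimono by blast
  moreover have "embed_vec ` ?D \<inter> embed_vec ` dvd_cell a (Suc j) = {}"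
    by (auto dest: injD[OF inj_embed_vec])
  ultimately have "dvd_cell_integral a j = (LINT x:embed_vec ` ?D|\<mu>. abs_g x) + dvd_cell_integral a (Suc j)"
    unfolding dvd_cell_integral_def by (simp add: set_integral_Un abs_g_integrable D padic_measurable_dvd_cell)
  also have "(LINT x:embed_vec ` ?D|\<mu>. abs_g x) = inverse (real CARD('p)) ^ (m + j) * vol ?D"
    by (rule padic_integral_const[OF D]) (use abs_g_bounds in auto)
  also have "vol ?D = vol (dvd_cell a j) - vol (dvd_cell a (Suc j))"
    by (intro vol_diff padic_measurable_dvd_cell dvd_cell_antimono)
  finally show ?thesis .
qed

lemma dvd_cell_integral_bounds: "0 \<le> dvd_cell_integral a j" "dvd_cell_integral a j \<le> inverse (real CARD('p)) ^ (m + j) * vol (dvd_cell a j)"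
proof -
  show "0 \<le> dvd_cell_integral a j" unfolding dvd_cell_integral_def set_lebesgue_integral_def by (rule integral_nonneg_AE) simp
  have "dvd_cell_integral a j \<le> (LINT x:embed_vec ` dvd_cell a j|\<mu>. inverse (real CARD('p)) ^ (m + j))"
    unfolding dvd_cell_integral_def
  proof (rule set_integral_mono)
    show "set_integrable \<mu> (embed_vec ` dvd_cell a j) (\<lambda>x. inverse (real CARD('p)) ^ (m + j))"
      by (rule padic_integrable[OF padic_measurable_dvd_cell, where B = "inverse (real CARD('p)) ^ (m + j)"]) auto
    show "abs_g x \<le> inverse (real CARD('p)) ^ (m + j)" if "x \<in> embed_vec ` dvd_cell a j" for x
      using that abs_g_bounds(1) by blast
  qed (rule abs_g_integrable[OF padic_measurable_dvd_cell])
  also have "\<dots> = inverse (real CARD('p)) ^ (m + j) * vol (dvd_cell a j)"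
    by (rule padic_integral_const[OF padic_measurable_dvd_cell]) simp
  finally show "dvd_cell_integral a j \<le> inverse (real CARD('p)) ^ (m + j) * vol (dvd_cell a j)" .
qed

text \<open>No series is summed: an explicit sequence with the same recursion as the tail integrals
  is subtracted, the difference is constant, and both sequences tend to zero.\<close>

lemma cell_integral_zero:
  assumes "a \<in> torus" "\<gamma> a = 0"
  shows "(LINT x:embed_vec ` padic_cell k a|\<mu>. abs_g x) =
    inverse (real CARD('p)) ^ m * vol (padic_cell k a) / (real CARD('p) + 1)"
proof -
  define q where "q = inverse (real CARD('p))"
  have q: "0 < q" "q < 1" using prime_card_gt_1[where 'p='p] by (auto simp: q_def inverse_less_1_iff)
  define V where "V = vol (padic_cell k a)"
  have V: "V \<ge> 0" by (simp add: V_def)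
  have vP: "vol (dvd_cell a (Suc j)) = V * q ^ j" for j
    using vol_dvd_cell[OF assms, of j] by (simp add: V_def q_def)
  \<comment> \<open>The expected tail: the sum over i > j of q^(m+i) (V q^(i-1) - V q^i) is q^m V (1
    - q) q^(2j+1) / (1 - q^2).\<close>
  define c where "c j = q ^ (m + Suc j) * q ^ j * V / (1 + q)" for j
  have diff: "dvd_cell_integral a (Suc j) - c j = dvd_cell_integral a (Suc (Suc j)) - c (Suc j)" for j
  proof -
    have "c (Suc j) = q ^ (m + Suc j) * q ^ j * V * (q * q) / (1 + q)"
      by (simp add: c_def)
    then have "c j - c (Suc j) = q ^ (m + Suc j) * q ^ j * V * (1 - q * q) / (1 + q)"
      unfolding c_def[of j] by (simp only: right_diff_distrib diff_divide_distrib mult_1_right)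
    also have "(1 - q * q) = (1 - q) * (1 + q)" by (simp add: algebra_simps)
    also have "q ^ (m + Suc j) * q ^ j * V * ((1 - q) * (1 + q)) / (1 + q) = q ^ (m + Suc j) * q ^ j * V * (1 - q)"
      using q by simp
    also have "\<dots> = q ^ (m + Suc j) * (V * q ^ j - V * q ^ Suc j)" by (simp add: algebra_simps)
    finally show ?thesis using dvd_cell_integral_Suc[of a "Suc j"] unfolding vP q_def[symmetric] by linarith
  qed
  have const: "dvd_cell_integral a (Suc j) - c j = dvd_cell_integral a 1 - c 0" for j
    by (induction j) (use diff in simp_all)
  have "(\<lambda>j. q ^ j) \<longlonglongrightarrow> 0" using q by (intro LIMSEQ_realpow_zero) auto
  then have lim: "(\<lambda>j. q ^ (m + 1) * V * (q ^ j * q ^ j)) \<longlonglongrightarrow> q ^ (m + 1) * V * (0 * 0)"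
    by (intro tendsto_mult tendsto_const)
  have "(\<lambda>j. dvd_cell_integral a (Suc j)) \<longlonglongrightarrow> 0"
  proof (rule tendsto_sandwich)
    show "\<forall>\<^sub>F j in sequentially. 0 \<le> dvd_cell_integral a (Suc j)" using dvd_cell_integral_bounds(1) by simp
    show "\<forall>\<^sub>F j in sequentially. dvd_cell_integral a (Suc j) \<le> q ^ (m + 1) * V * (q ^ j * q ^ j)"
    proof (rule always_eventually, rule allI)
      fix j show "dvd_cell_integral a (Suc j) \<le> q ^ (m + 1) * V * (q ^ j * q ^ j)"
        using dvd_cell_integral_bounds(2)[of a "Suc j"] unfolding vP q_def[symmetric] by (simp add: power_add ac_simps)
    qed
    show "(\<lambda>j. q ^ (m + 1) * V * (q ^ j * q ^ j)) \<longlonglongrightarrow> 0" using lim by simp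
  qed simp
  moreover have "c \<longlonglongrightarrow> 0"
  proof -
    have "c = (\<lambda>j. q ^ (m + 1) * V * (q ^ j * q ^ j) / (1 + q))" by (simp add: c_def power_add ac_simps fun_eq_iff)
    moreover have "(\<lambda>j. q ^ (m + 1) * V * (q ^ j * q ^ j) / (1 + q)) \<longlonglongrightarrow> q ^ (m + 1) * V * (0 * 0) / (1 + q)"
      using q by (intro tendsto_divide lim tendsto_const) auto
    ultimately show ?thesis by simp
  qed
  ultimately have "(\<lambda>j. dvd_cell_integral a (Suc j) - c j) \<longlonglongrightarrow> 0 - 0" by (rule tendsto_diff)
  then have "dvd_cell_integral a 1 - c 0 = 0" unfolding const by (simp add: LIMSEQ_const_iff)
  then have "(LINT x:embed_vec ` padic_cell k a|\<mu>. abs_g x) = q ^ m * V * (q / (1 + q))"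
    using dvd_cell_1_zero[OF assms(2)] by (simp add: dvd_cell_integral_def c_def)
  also have "q / (1 + q) = 1 / (real CARD('p) + 1)"
    using prime_card_gt_1[where 'p='p] by (simp add: q_def field_simps)
  finally show ?thesis by (simp add: q_def V_def)
qed

lemma cell_integral_nonzero:
  assumes "\<gamma> a \<noteq> 0"
  shows "(LINT x:embed_vec ` padic_cell k a|\<mu>. abs_g x) = inverse (real CARD('p)) ^ m * vol (padic_cell k a)"
proof (rule padic_integral_const[OF padic_measurable_cell])
  fix x assume "x \<in> padic_cell k a"
  then show "abs_g (embed_vec x) = inverse (real CARD('p)) ^ m"
    using abs_g_bounds(2)[of x a 0] dvd_cell_0[of a] dvd_cell_1_nonzero[OF assms] by simp
qed

definition shell :: "('p padic_int ^ 'n) set" where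
  "shell = (\<Union>a\<in>torus. padic_cell k a)"

lemma padic_measurable_shell: "padic_measurable shell"
  unfolding shell_def by (intro padic_measurable_UN padic_measurable_cell) (simp add: countable_finite)

lemma shell_integral:
  "(LINT x:embed_vec ` shell|\<mu>. abs_g x) = inverse (real CARD('p)) ^ (m + (\<Sum>i\<in>UNIV. k i)) *
    (((real CARD('p) - 1) ^ CARD('n) - real (card {a \<in> torus. \<gamma> a = 0}) * (real CARD('p) / (real CARD('p) + 1)))
      / real CARD('p) ^ CARD('n))"
proof -
  define p where "p = real CARD('p)"
  have p: "p > 1" using prime_card_gt_1[where 'p='p] by (simp add: p_def)
  define W where "W = inverse p ^ m * inverse p ^ ((\<Sum>i\<in>UNIV. k i) + CARD('n))"
  let ?Z = "{a \<in> torus. \<gamma> a = 0}"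
  have fin: "finite (torus :: ('p mod_ring ^ 'n) set)" by simp
  have disj: "embed_vec ` padic_cell k a \<inter> embed_vec ` padic_cell k b = {}"
    if ab: "a \<in> torus" "b \<in> torus" "a \<noteq> b" for a b :: "'p mod_ring ^ 'n"
  proof -
    have "padic_cell k a \<inter> padic_cell k b = {}"
      using padic_cell_unique[of _ k a k b] ab by (auto simp: torus_def)
    then show ?thesis by (simp flip: image_Int[OF inj_embed_vec])
  qed
  have "(LINT x:embed_vec ` shell|\<mu>. abs_g x) = (\<Sum>a\<in>torus. LINT x:embed_vec ` padic_cell k a|\<mu>. abs_g x)"
    unfolding shell_def image_UN
  proof (rule set_integral_finite_Union[OF fin])
    show "disjoint_family_on (\<lambda>a. embed_vec ` padic_cell k a) (torus :: ('p mod_ring ^ 'n) set)"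
      unfolding disjoint_family_on_def by (intro ballI impI) (rule disj)
    show "embed_vec ` padic_cell k a \<in> sets \<mu>" if "a \<in> torus" for a
      using padic_measurable_cell by (simp add: padic_measurable_def sets_haar)
  qed (rule abs_g_integrable[OF padic_measurable_cell])
  also have "\<dots> = (\<Sum>a\<in>torus. if \<gamma> a = 0 then W / (p + 1) else W)"
    by (rule sum.cong) (simp_all add: cell_integral_zero cell_integral_nonzero vol_cell W_def p_def)
  \<comment> \<open>This identity separates the contribution of the zeros of the reduction from a
    main term common to the whole torus.\<close>
  also have "W / (p + 1) = W - W * (p / (p + 1))"
  proof -
    have "W * (p / (p + 1)) + W / (p + 1) = W * ((p + 1) / (p + 1))"
      by (simp only: add_divide_distrib distrib_left times_divide_eq_right mult_1_right)
    then show ?thesis using p by simp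
  qed
  also have "(\<Sum>a\<in>torus. if \<gamma> a = 0 then W - W * (p / (p + 1)) else W) = (\<Sum>a\<in>(torus :: ('p mod_ring ^ 'n) set). W) - (\<Sum>a\<in>torus. if \<gamma> a = 0 then W * (p / (p + 1)) else 0)"
    unfolding sum_subtractf[symmetric] by (rule sum.cong) auto
  also have "(\<Sum>a\<in>torus. if \<gamma> a = 0 then W * (p / (p + 1)) else 0) = real (card ?Z) * (W * (p / (p + 1)))"
    by (subst sum.inter_filter[symmetric, OF fin]) simp
  also have "(\<Sum>a\<in>(torus :: ('p mod_ring ^ 'n) set). W) = (p - 1) ^ CARD('n) * W"
    using CARD_gt_1[where 'p='p] by (simp add: card_torus p_def of_nat_diff)
  finally have "(LINT x:embed_vec ` shell|\<mu>. abs_g x) = W * ((p - 1) ^ CARD('n) - real (card ?Z) * (p / (p + 1)))"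
    by (simp add: algebra_simps)
  also have "W = inverse p ^ (m + (\<Sum>i\<in>UNIV. k i)) / p ^ CARD('n)"
    by (simp add: W_def power_add power_inverse divide_inverse)
  finally show ?thesis by (simp add: p_def)
qed

end


section \<open>The zeta function as a sum over the lattice points of the orthant\<close>

definition nat_vec :: "('n \<Rightarrow> nat) \<Rightarrow> real ^ 'n::finite" where
  "nat_vec k = (\<chi> i. real (k i))"

lemma nat_vec_orthant: "nat_vec k \<in> orthant"
  by (simp add: nat_vec_def orthant_def)

lemma nat_vec_inner: "nat_vec k \<bullet> expvec \<omega> = real (exponent_weight k \<omega>)"
  by (simp add: nat_vec_def expvec_def inner_vec_def exponent_weight_def)

lemma sigma_nat_vec: "sigma (nat_vec k) = real (\<Sum>i\<in>UNIV. k i)"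
  by (simp add: sigma_def nat_vec_def)

section \<open>The absolute value of a monomial ideal at integral points\<close>

lemma padic_int_abs_unit:
  fixes u :: "'p::prime_card padic_int"
  assumes "residue_mod_p u \<noteq> 0"
  shows "padic_int_abs u = 1"
  using padic_int_abs_eqI[of 0 u] assms by (simp add: residue_eq_0_iff)

lemma padic_int_abs_sum_le:
  assumes "\<And>x. x \<in> A \<Longrightarrow> padic_int_abs (f x) \<le> M" "0 \<le> M"
  shows "padic_int_abs (\<Sum>x\<in>A. f x) \<le> M"
  using assms(1)
proof (induction A rule: infinite_finite_induct)
  case (insert x A)
  then have "padic_int_abs (f x) \<le> M" "padic_int_abs (\<Sum>x\<in>A. f x) \<le> M" by auto
  then show ?case using padic_int_abs_ultrametric[of "f x" "\<Sum>x\<in>A. f x"] insert.hyps by simp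
qed (use assms(2) in auto)

lemma padic_int_abs_prod: "padic_int_abs (\<Prod>x\<in>A. f x :: 'p::prime_card padic_int) = (\<Prod>x\<in>A. padic_int_abs (f x))"
proof (induction A rule: infinite_finite_induct)
qed (use padic_int_abs_power[of "1 :: 'p padic_int" 0] in \<open>simp_all add: padic_int_abs_mult\<close>)

lemma padic_int_abs_monom_antimono:
  assumes "\<And>i. Poly_Mapping.lookup \<alpha> i \<le> Poly_Mapping.lookup \<omega> i"
  shows "padic_int_abs (monom_eval u \<omega>) \<le> padic_int_abs (monom_eval u \<alpha>)"
  unfolding monom_eval_def padic_int_abs_prod padic_int_abs_power
  by (intro prod_mono conjI power_decreasing zero_le_power padic_int_abs_nonneg padic_int_abs_le_1 assms)

text \<open>On integral points both the coefficients and the cofactors of a monomial have absolute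
  value at most one, so the ultrametric inequality bounds every element of the ideal by the
  generating monomials.\<close>

lemma ideal_abs_eq_Max:
  fixes I :: "('n::finite, 'p::prime_card padic_int) mpoly set"
  assumes I: "monomial_ideal I" and F: "finite F" "F \<noteq> {}" "F \<subseteq> {\<omega>. Poly_Mapping.single \<omega> 1 \<in> I}"
    and gen: "\<And>\<omega>. Poly_Mapping.single \<omega> 1 \<in> I \<Longrightarrow> \<exists>\<alpha>\<in>F. \<forall>i. Poly_Mapping.lookup \<alpha> i \<le> Poly_Mapping.lookup \<omega> i"
  shows "ideal_abs I (embed_vec u) = Max ((\<lambda>\<omega>. padic_int_abs (monom_eval u \<omega>)) ` F)"
proof -
  let ?M = "Max ((\<lambda>\<omega>. padic_int_abs (monom_eval u \<omega>)) ` F)"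
  have fin: "finite ((\<lambda>\<omega>. padic_int_abs (monom_eval u \<omega>)) ` F)" using F(1) by simp
  have "?M \<in> (\<lambda>\<omega>. padic_int_abs (monom_eval u \<omega>)) ` F" using F by (intro Max_in) auto
  then obtain \<alpha> where \<alpha>: "\<alpha> \<in> F" "?M = padic_int_abs (monom_eval u \<alpha>)" by blast
  have le: "padic_int_abs (monom_eval u \<omega>) \<le> ?M" if w: "Poly_Mapping.single \<omega> 1 \<in> I" for \<omega>
  proof -
    obtain \<beta> where \<beta>: "\<beta> \<in> F" "\<forall>i. Poly_Mapping.lookup \<beta> i \<le> Poly_Mapping.lookup \<omega> i"
      using gen[OF w] by blast
    have "padic_int_abs (monom_eval u \<omega>) \<le> padic_int_abs (monom_eval u \<beta>)"
      by (rule padic_int_abs_monom_antimono) (use \<beta>(2) in simp)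
    also have "\<dots> \<le> ?M" using \<beta>(1) fin by (intro Max_ge) auto
    finally show ?thesis .
  qed
  show ?thesis unfolding ideal_abs_def eval_embed_vec
  proof (rule cSup_eq_maximum)
    have "?M = padic_int_abs (mpoly_eval u (Poly_Mapping.single \<alpha> 1))"
      by (simp add: \<alpha>(2) mpoly_eval_single)
    then show "?M \<in> (\<lambda>f. padic_int_abs (mpoly_eval u f)) ` I" using \<alpha>(1) F(3) by blast
  next
    fix y assume "y \<in> (\<lambda>f. padic_int_abs (mpoly_eval u f)) ` I"
    then obtain f where f: "f \<in> I" "y = padic_int_abs (mpoly_eval u f)" by blast
    show "y \<le> ?M" unfolding f(2) mpoly_eval_superset[OF finite_keys order_refl]
    proof (rule padic_int_abs_sum_le)
      fix \<omega> assume "\<omega> \<in> Poly_Mapping.keys f"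
      then have "padic_int_abs (monom_eval u \<omega>) \<le> ?M" using le monomial_ideal_keys[OF I f(1)] by blast
      moreover have "padic_int_abs (Poly_Mapping.lookup f \<omega> * monom_eval u \<omega>) \<le> padic_int_abs (monom_eval u \<omega>)"
        unfolding padic_int_abs_mult by (rule mult_left_le_one_le) (simp_all add: padic_int_abs_le_1)
      ultimately show "padic_int_abs (Poly_Mapping.lookup f \<omega> * monom_eval u \<omega>) \<le> ?M" by linarith
    qed (simp add: \<alpha>(2))
  qed
qed

section \<open>Decomposition of the integral into shells\<close>

text \<open>Countable additivity of the integral is indexed by natural numbers. The family is
  transported by \<open>to_nat\<close>, with the empty set at indices outside the range, and
  summability of the shell integrals then identifies the ordered sum with the unordered one.\<close>

lemma set_integral_countable_infsum:
  fixes A :: "'i::countable \<Rightarrow> 'a set" and f :: "'a \<Rightarrow> complex"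
  assumes A: "\<And>i. A i \<in> sets M" "\<And>i j. i \<noteq> j \<Longrightarrow> A i \<inter> A j = {}"
    and f: "set_integrable M (\<Union>i. A i) f" and sm: "(\<lambda>i. LINT x:A i|M. f x) summable_on UNIV"
  shows "(LINT x:(\<Union>i. A i)|M. f x) = (\<Sum>\<^sub>\<infinity>i. LINT x:A i|M. f x)"
proof -
  define B where "B n = (if n \<in> range (to_nat :: 'i \<Rightarrow> nat) then A (from_nat n) else {})" for n
  have B_to_nat: "B (to_nat i) = A i" for i by (simp add: B_def)
  have UN: "(\<Union>n. B n) = (\<Union>i. A i)"
  proof (intro equalityI subsetI)
    fix x assume "x \<in> (\<Union>n. B n)"
    then show "x \<in> (\<Union>i. A i)" by (auto simp: B_def split: if_splits)
  next
    fix x assume "x \<in> (\<Union>i. A i)"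
    then obtain i where "x \<in> A i" by blast
    then have "x \<in> B (to_nat i)" by (simp add: B_to_nat)
    then show "x \<in> (\<Union>n. B n)" by blast
  qed
  have disj: "B n \<inter> B m = {}" if nm: "n \<noteq> m" for n m
  proof (cases "n \<in> range (to_nat :: 'i \<Rightarrow> nat) \<and> m \<in> range (to_nat :: 'i \<Rightarrow> nat)")
    case True
    then obtain i j where "n = to_nat (i :: 'i)" "m = to_nat (j :: 'i)" by blast
    then show ?thesis using nm A(2)[of i j] by (auto simp: B_to_nat)
  qed (auto simp: B_def)
  have "(LINT x:(\<Union>i. A i)|M. f x) = suminf (\<lambda>n. LINT x:B n|M. f x)"
    unfolding UN[symmetric]
    by (rule lebesgue_integral_countable_add) (use A f disj UN in \<open>auto simp: B_def\<close>)
  moreover have "((\<lambda>n. LINT x:B n|M. f x) has_sum (\<Sum>\<^sub>\<infinity>i. LINT x:A i|M. f x)) UNIV"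
  proof -
    have "((\<lambda>i. LINT x:B (to_nat i)|M. f x) has_sum (\<Sum>\<^sub>\<infinity>i. LINT x:A i|M. f x)) (UNIV :: 'i set)"
      unfolding B_to_nat using sm by (rule has_sum_infsum)
    then have "((\<lambda>n. LINT x:B n|M. f x) has_sum (\<Sum>\<^sub>\<infinity>i. LINT x:A i|M. f x)) (range (to_nat :: 'i \<Rightarrow> nat))"
      by (subst has_sum_reindex) (auto simp: o_def)
    then show ?thesis
      by (rule has_sum_cong_neutral[THEN iffD1, rotated -1]) (auto simp: B_def set_lebesgue_integral_def)
  qed
  then have "(\<lambda>n. LINT x:B n|M. f x) sums (\<Sum>\<^sub>\<infinity>i. LINT x:A i|M. f x)" by (rule has_sum_imp_sums)
  ultimately show ?thesis by (simp add: sums_iff)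
qed

text \<open>Separates the value zero at base zero, so that measurability follows from that of the
  base.\<close>

lemma of_real_powr_nonneg:
  assumes "0 \<le> r"
  shows "complex_of_real r powr s = (if r = 0 then 0 else exp (s * of_real (ln r)))"
  using assms by (auto simp: powr_def Ln_of_real)

text \<open>The constant of the cell through the lattice point \<open>k\<close>, written directly in
  terms of \<open>k\<close> so that the integral can be computed before any cells are
  formed.\<close>

definition shell_factor :: "('n::finite, 'p::prime_card padic_int) mpoly \<Rightarrow> ('n \<Rightarrow> nat) \<Rightarrow> real" where
  "shell_factor g k = ((real CARD('p) - 1) ^ CARD('n) -
     real (card {a \<in> torus. mpoly_eval a (reduce_mod_p (face_part g (first_meet (newton_poly g) (nat_vec k)))) = 0})
       * (real CARD('p) / (real CARD('p) + 1))) / real CARD('p) ^ CARD('n)"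

text \<open>A crude bound, but uniform in \<open>k\<close>, so the series with these factors is
  dominated by the series of the terms \<open>S_term\<close>.\<close>

lemma shell_factor_bounded:
  fixes g :: "('n::finite, 'p::prime_card padic_int) mpoly"
  shows "\<bar>shell_factor g k\<bar> \<le> real (CARD('p) ^ CARD('n)) + real (card (torus :: ('p mod_ring ^ 'n) set))"
proof -
  define p where "p = real CARD('p)"
  have p: "p > 1" using prime_card_gt_1[where 'p='p] by (simp add: p_def)
  let ?Z = "{a \<in> torus. mpoly_eval a (reduce_mod_p (face_part g (first_meet (newton_poly g) (nat_vec k)))) = 0}"
  have Z: "real (card ?Z) \<le> real (card (torus :: ('p mod_ring ^ 'n) set))"
    by (intro of_nat_mono card_mono) auto
  have 1: "real (card ?Z) * (p / (p + 1)) \<le> real (card ?Z)" "0 \<le> real (card ?Z) * (p / (p + 1))"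
    using p by (auto intro!: mult_left_le simp del: times_divide_eq_right)
  have 2: "0 \<le> (p - 1) ^ CARD('n)" "(p - 1) ^ CARD('n) \<le> p ^ CARD('n)" using p by (auto intro!: power_mono)
  have 3: "p ^ CARD('n) \<ge> 1" using p by simp
  have "\<bar>((p - 1) ^ CARD('n) - real (card ?Z) * (p / (p + 1))) / p ^ CARD('n)\<bar> \<le>
      \<bar>(p - 1) ^ CARD('n) - real (card ?Z) * (p / (p + 1))\<bar>"
    using 3 by (simp add: abs_div divide_le_eq mult_le_cancel_left1)
  also have "\<dots> \<le> p ^ CARD('n) + real (card (torus :: ('p mod_ring ^ 'n) set))"
    using Z 1 2 by linarith
  finally show ?thesis by (simp add: shell_factor_def p_def)
qed

lemma S_term_eq_prod:
  "S_term I g s k = of_real (real CARD('p) powr (- supp_min (newton_poly g) k - sigma k)) *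
     of_real (real CARD('p) powr (- supp_min (newton_ideal I) k)) powr s"
  for g :: "('n::finite, 'p::prime_card padic_int) mpoly"
proof -
  have p: "real CARD('p) > 0" using prime_card_gt_1[where 'p='p] by simp
  have Ln: "Ln (of_nat CARD('p)) = complex_of_real (ln (real CARD('p)))"
    using Ln_of_real[OF p] by simp
  show ?thesis
    unfolding S_term_def p_exponent_def of_real_powr_nonneg[OF powr_ge_zero]
    using p by (simp add: powr_def Ln ln_powr flip: exp_of_real exp_add) (rule arg_cong[where f = exp], simp add: algebra_simps)
qed

lemma supp_min_nonneg:
  assumes "newton_polyhedron \<Gamma> V" "V \<subseteq> orthant" "k \<in> orthant"
  shows "0 \<le> supp_min \<Gamma> k"
proof -
  interpret newton_polyhedron \<Gamma> V by fact
  obtain v where "v \<in> min_verts V k" using min_verts_nonempty by blast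
  then show ?thesis using supp_min_eq[OF assms(3)] assms(2,3)
    by (auto simp: min_verts_def intro!: orthant_inner_nonneg)
qed

lemma norm_S_term_le:
  fixes g :: "('n::finite, 'p::prime_card padic_int) mpoly"
  assumes "0 \<le> supp_min (newton_poly g) k" "0 \<le> supp_min (newton_ideal I) k" "Re s > 0"
  shows "norm (S_term I g s k) \<le> real CARD('p) powr (- sigma k)"
proof -
  have p: "real CARD('p) > 1" by (rule prime_card_gt_1)
  have "norm (S_term I g s k) = real CARD('p) powr Re (- p_exponent I g s k)"
    unfolding S_term_def using norm_powr_real_powr[of "of_nat CARD('p)" "- p_exponent I g s k"] by simp
  also have "\<dots> \<le> real CARD('p) powr (- sigma k)"
  proof (intro powr_mono)
    have "0 \<le> supp_min (newton_ideal I) k * Re s" using assms by simp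
    then show "Re (- p_exponent I g s k) \<le> - sigma k" using assms(1) by (simp add: p_exponent_def)
  qed (use p in simp)
  finally show ?thesis .
qed

lemma summable_geometric_nat_vec:
  "(\<lambda>k :: 'n::finite \<Rightarrow> nat. real CARD('p::prime_card) powr (- sigma (nat_vec k))) summable_on UNIV"
proof -
  define q where "q = inverse (real CARD('p))"
  have q: "0 < q" "q < 1" using prime_card_gt_1[where 'p='p] by (auto simp: q_def inverse_less_1_iff)
  have "(\<lambda>k. norm (\<Prod>i\<in>UNIV. complex_of_real q ^ k i)) summable_on exponents_on (UNIV :: 'n set)"
    using q by (intro has_sum_monomials(2)) auto
  moreover have "exponents_on (UNIV :: 'n set) = UNIV" by (auto simp: exponents_on_def)
  moreover have "norm (\<Prod>i\<in>UNIV. complex_of_real q ^ k i) = real CARD('p) powr (- sigma (nat_vec k))"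
    for k :: "'n \<Rightarrow> nat"
  proof -
    have "norm (\<Prod>i\<in>UNIV. complex_of_real q ^ k i) = (\<Prod>i\<in>UNIV. q ^ k i)"
      using q by (simp add: norm_power flip: prod_norm)
    also have "\<dots> = q ^ (\<Sum>i\<in>UNIV. k i)" by (rule power_sum[symmetric])
    also have "\<dots> = real CARD('p) powr (- sigma (nat_vec k))"
      unfolding sigma_nat_vec powr_minus q_def power_inverse
      using prime_card_gt_1[where 'p='p] by (subst powr_realpow) auto
    finally show ?thesis .
  qed
  ultimately show ?thesis by simp
qed

theorem zeta_int_eq_infsum:
  fixes \<mu> :: "('p::prime_card padic ^ 'n::finite) measure"
    and I :: "('n, 'p padic_int) mpoly set" and g :: "('n, 'p padic_int) mpoly"
  assumes haar: "normalized_haar \<mu>" and I: "monomial_ideal I" "I \<noteq> {0}"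
    and g: "g \<noteq> 0" "nondegenerate g" and s: "Re s > 0"
  shows "set_integrable \<mu> Zp_vec (zeta_integrand I g s)"
    and "zeta_int \<mu> I g s = (\<Sum>\<^sub>\<infinity>k. of_real (shell_factor g k) * S_term I g s (nat_vec k))"
    and "(\<lambda>k. norm (S_term I g s (nat_vec k))) summable_on UNIV"
proof -
  interpret padic_haar \<mu> by standard (rule haar)
  obtain F where F: "finite F" "F \<subseteq> {\<omega>. Poly_Mapping.single \<omega> 1 \<in> I}"
    "\<And>\<omega>. Poly_Mapping.single \<omega> 1 \<in> I \<Longrightarrow> \<exists>\<alpha>\<in>F. \<forall>i. Poly_Mapping.lookup \<alpha> i \<le> Poly_Mapping.lookup \<omega> i"
    "newton_polyhedron (newton_ideal I) (expvec ` F)"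
    using newton_polyhedron_ideal[OF I] by metis
  interpret A: newton_polyhedron "newton_ideal I" "expvec ` F" by (rule F(4))
  interpret B: newton_polyhedron "newton_poly g" "expvec ` Poly_Mapping.keys g"
    by (rule newton_polyhedron_poly[OF g(1)])
  have F_ne: "F \<noteq> {}" using A.V_nonempty by blast
  have ideal_abs_embed: "ideal_abs I (embed_vec u) = Max ((\<lambda>\<omega>. padic_int_abs (monom_eval u \<omega>)) ` F)" for u
    by (rule ideal_abs_eq_Max[OF I(1) F(1) F_ne F(2)]) (rule F(3))
  define q where "q = inverse (real CARD('p))"
  have q: "0 < q" "q < 1" using prime_card_gt_1[where 'p='p] by (auto simp: q_def inverse_less_1_iff)

  \<comment> \<open>\<open>ideal_abs\<close> is a supremum over an infinite set, controlled here on
    integral points. The finite maximum \<open>h\<close> is Borel on the whole space and agrees with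
    it there, so it replaces \<open>ideal_abs\<close> under the integral.\<close>
  define h where "h x = Max ((\<lambda>\<omega>. padic_abs (eval_Qp (Poly_Mapping.single \<omega> (1 :: 'p padic_int)) x)) ` F)" for x
  define Z where "Z x = of_real (h x) powr s * complex_of_real (padic_abs (eval_Qp g x))" for x
  have h_embed: "h (embed_vec u) = ideal_abs I (embed_vec u)" for u
    by (simp add: h_def ideal_abs_embed eval_embed_vec mpoly_eval_single)
  have h_bounds: "0 \<le> ideal_abs I (embed_vec u)" "ideal_abs I (embed_vec u) \<le> 1" for u
  proof -
    have "Max ((\<lambda>\<omega>. padic_int_abs (monom_eval u \<omega>)) ` F) \<in> (\<lambda>\<omega>. padic_int_abs (monom_eval u \<omega>)) ` F"
      using F(1) F_ne by (intro Max_in) auto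
    then show "0 \<le> ideal_abs I (embed_vec u)" "ideal_abs I (embed_vec u) \<le> 1"
      unfolding ideal_abs_embed using padic_int_abs_nonneg padic_int_abs_le_1 by fastforce+
  qed
  have Z_embed: "zeta_integrand I g s (embed_vec u) = Z (embed_vec u)" for u
    by (simp add: zeta_integrand_def Z_def h_embed)
  have h_meas: "h \<in> borel_measurable borel"
    unfolding h_def by (intro borel_measurable_Max F(1) borel_measurable_abs_eval)
  have h_nonneg: "0 \<le> h x" for x
  proof -
    have "h x \<in> (\<lambda>\<omega>. padic_abs (eval_Qp (Poly_Mapping.single \<omega> (1 :: 'p padic_int)) x)) ` F"
      unfolding h_def using F(1) F_ne by (intro Max_in) auto
    then show ?thesis by auto
  qed
  have Z_meas: "Z \<in> borel_measurable borel"
  proof -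
    have "Z = (\<lambda>x. (if h x = 0 then 0 else exp (s * complex_of_real (ln (h x)))) * complex_of_real (padic_abs (eval_Qp g x)))"
      by (simp add: Z_def of_real_powr_nonneg h_nonneg fun_eq_iff)
    moreover note [measurable] = h_meas borel_measurable_abs_eval[of "Poly_Mapping.map of_padic_int g"]
    have "(\<lambda>x. (if h x = 0 then 0 else exp (s * complex_of_real (ln (h x)))) * complex_of_real (padic_abs (eval_Qp g x))) \<in> borel_measurable borel"
      by measurable
    ultimately show ?thesis by simp
  qed
  have Z_bound: "norm (Z (embed_vec u)) \<le> 1" for u
  proof -
    have 1: "norm (complex_of_real (h (embed_vec u)) powr s) \<le> 1"
    proof (cases "h (embed_vec u) = 0")
      case False
      then have pos: "0 < h (embed_vec u)" "h (embed_vec u) \<le> 1"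
        using h_bounds[of u] h_embed[of u] by auto
      then have "norm (complex_of_real (h (embed_vec u)) powr s) = h (embed_vec u) powr Re s"
        by (simp add: norm_powr_real_powr)
      also have "\<dots> \<le> 1" using pos s by (intro powr_le1) auto
      finally show ?thesis .
    qed simp
    have 2: "norm (complex_of_real (padic_abs (eval_Qp g (embed_vec u)))) \<le> 1"
      by (simp add: eval_embed_vec padic_int_abs_le_1)
    show ?thesis unfolding Z_def norm_mult using mult_mono[OF 1 2] by simp
  qed
  have Z_int: "set_integrable \<mu> (embed_vec ` S) Z" if "padic_measurable S" for S
    by (rule padic_integrable[OF that Z_meas Z_bound])
  have "set_integrable \<mu> Zp_vec Z" using Z_int[OF padic_measurable_UNIV] by (simp add: range_embed_vec)
  moreover have Z_Zp: "zeta_integrand I g s x = Z x" if "x \<in> Zp_vec" for x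
    using that Z_embed unfolding range_embed_vec[symmetric] by auto
  ultimately show "set_integrable \<mu> Zp_vec (zeta_integrand I g s)"
    using set_integrable_cong[OF refl refl, of Zp_vec "zeta_integrand I g s" Z \<mu>] by simp

  have poly_nonneg: "0 \<le> supp_min (newton_poly g) (nat_vec k)" "0 \<le> supp_min (newton_ideal I) (nat_vec k)" for k
    by (rule supp_min_nonneg[OF newton_polyhedron_poly[OF g(1)] _ nat_vec_orthant],
        use expvec_orthant in blast,
        rule supp_min_nonneg[OF F(4) _ nat_vec_orthant], use expvec_orthant in blast)
  show summable: "(\<lambda>k. norm (S_term I g s (nat_vec k))) summable_on UNIV"
    by (rule Infinite_Sum.abs_summable_on_comparison_test'[OF summable_geometric_nat_vec[where 'p='p]])
      (intro norm_S_term_le poly_nonneg s)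

  define sh where "sh k = (\<Union>a\<in>(torus :: ('p mod_ring ^ 'n) set). padic_cell k a)" for k :: "'n \<Rightarrow> nat"
  have shell: "(LINT x:embed_vec ` sh k|\<mu>. Z x) = of_real (shell_factor g k) * S_term I g s (nat_vec k)" for k
  proof -
    let ?\<tau> = "first_meet (newton_poly g) (nat_vec k)"
    obtain w where w: "w \<in> min_verts (expvec ` Poly_Mapping.keys g) (nat_vec k)"
      using B.min_verts_nonempty by blast
    then obtain \<omega>0 where \<omega>0: "\<omega>0 \<in> Poly_Mapping.keys g" "w = expvec \<omega>0" by (auto simp: min_verts_def)
    define m where "m = exponent_weight k \<omega>0"
    have sm: "supp_min (newton_poly g) (nat_vec k) = real m"
      using B.supp_min_eq[OF nat_vec_orthant w] by (simp add: \<omega>0(2) nat_vec_inner m_def)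
    have m_le: "m \<le> exponent_weight k \<omega>" if "\<omega> \<in> Poly_Mapping.keys g" for \<omega>
      using w that unfolding \<omega>0(2) by (auto simp: min_verts_def nat_vec_inner m_def)
    have face: "expvec \<omega> \<in> ?\<tau> \<longleftrightarrow> exponent_weight k \<omega> = m" if \<omega>: "\<omega> \<in> Poly_Mapping.keys g" for \<omega>
    proof -
      have "expvec \<omega> \<in> newton_poly g" using B.V_sub \<omega> by blast
      then show ?thesis by (simp add: first_meet_def sm nat_vec_inner)
    qed
    interpret cell_poly \<mu> g k m ?\<tau>
    proof
      fix a :: "'p mod_ring ^ 'n"
      assume "a \<in> torus" "mpoly_eval a (reduce_mod_p (face_part g ?\<tau>)) = 0"
      then show "\<exists>i. mpoly_eval a (mpoly_deriv i (reduce_mod_p (face_part g ?\<tau>))) \<noteq> 0"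
        using g(2) B.poly_face_first_meet[OF nat_vec_orthant, of k] unfolding nondegenerate_def torus_def by blast
    qed (use m_le face in auto)
    obtain v where v: "v \<in> min_verts (expvec ` F) (nat_vec k)" using A.min_verts_nonempty by blast
    then obtain \<alpha> where \<alpha>: "\<alpha> \<in> F" "v = expvec \<alpha>" by (auto simp: min_verts_def)
    define mI where "mI = exponent_weight k \<alpha>"
    have smI: "supp_min (newton_ideal I) (nat_vec k) = real mI"
      using A.supp_min_eq[OF nat_vec_orthant v] by (simp add: \<alpha>(2) nat_vec_inner mI_def)
    have mI_le: "mI \<le> exponent_weight k \<omega>" if "\<omega> \<in> F" for \<omega>
      using v that unfolding \<alpha>(2) by (auto simp: min_verts_def nat_vec_inner mI_def)
    \<comment> \<open>The unit parts of the coordinates give monomials of absolute value one, so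
      only the weights of the exponents remain; the least weight over \<open>F\<close> gives the
      maximum.\<close>
    have abs: "ideal_abs I (embed_vec x) = q ^ mI" if x: "x \<in> sh k" for x
    proof -
      obtain a u where u: "a \<in> torus" "x = scale_vec k u" "residue_vec u = a"
        using x unfolding sh_def padic_cell_def by blast
      have "padic_int_abs (monom_eval u \<omega>) = 1" for \<omega>
      proof (rule padic_int_abs_unit)
        show "residue_mod_p (monom_eval u \<omega>) \<noteq> 0"
          unfolding residue_monom_eval u(3) using u(1) by (simp add: torus_def monom_eval_def)
      qed
      moreover have "padic_int_abs (uniformizer :: 'p padic_int) = q"
        using padic_abs_of_padic_int[of "uniformizer :: 'p padic_int"] padic_int_abs_eqI[of 1 "uniformizer :: 'p padic_int"]
          unit_not_dvd[of "1 :: 'p padic_int" 1] by (simp add: residue_hom q_def)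
      ultimately have mon: "padic_int_abs (monom_eval x \<omega>) = q ^ exponent_weight k \<omega>" for \<omega>
        by (simp add: u(2) monom_eval_scale_vec padic_int_abs_mult padic_int_abs_power)
      show ?thesis unfolding ideal_abs_embed mon
      proof (rule Max_eqI)
        show "q ^ mI \<in> (\<lambda>\<omega>. q ^ exponent_weight k \<omega>) ` F" using \<alpha>(1) by (auto simp: mI_def)
        show "y \<le> q ^ mI" if "y \<in> (\<lambda>\<omega>. q ^ exponent_weight k \<omega>) ` F" for y
          using that mI_le q by (auto intro!: power_decreasing)
      qed (use F(1) in simp)
    qed
    have sets_sh: "embed_vec ` sh k \<in> sets \<mu>"
      using padic_measurable_shell by (simp add: shell_def sh_def padic_measurable_def sets_haar)
    have "(LINT x:embed_vec ` sh k|\<mu>. Z x) =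
        (LINT x:embed_vec ` sh k|\<mu>. complex_of_real (q ^ mI) powr s * complex_of_real (padic_abs (eval_Qp g x)))"
      by (rule set_lebesgue_integral_cong[OF sets_sh]) (use abs h_embed in \<open>auto simp: Z_def\<close>)
    also have "\<dots> = complex_of_real (q ^ mI) powr s * of_real (LINT x:embed_vec ` sh k|\<mu>. padic_abs (eval_Qp g x))"
      by (simp only: set_integral_mult_right set_integral_complex_of_real)
    also have "(LINT x:embed_vec ` sh k|\<mu>. padic_abs (eval_Qp g x)) = q ^ (m + (\<Sum>i\<in>UNIV. k i)) * shell_factor g k"
      using shell_integral unfolding shell_def sh_def shell_factor_def q_def .
    also have "q ^ mI = real CARD('p) powr (- supp_min (newton_ideal I) (nat_vec k))"
      using prime_card_gt_1[where 'p='p] by (simp add: smI q_def powr_minus powr_realpow power_inverse)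
    also have "q ^ (m + (\<Sum>i\<in>UNIV. k i)) = real CARD('p) powr (- supp_min (newton_poly g) (nat_vec k) - sigma (nat_vec k))"
    proof -
      have "- supp_min (newton_poly g) (nat_vec k) - sigma (nat_vec k) = - real (m + (\<Sum>i\<in>UNIV. k i))"
        by (simp add: sm sigma_nat_vec)
      then show ?thesis using prime_card_gt_1[where 'p='p]
        by (simp only: powr_minus q_def power_inverse powr_realpow)
    qed
    finally show ?thesis by (simp add: S_term_eq_prod[of I g s] ac_simps)
  qed

  have sh_meas: "padic_measurable (sh k)" for k
    unfolding sh_def by (intro padic_measurable_UN padic_measurable_cell) (simp add: countable_finite)
  have sh_disj: "embed_vec ` sh k \<inter> embed_vec ` sh k' = {}" if "k \<noteq> k'" for k k'
  proof -
    have "sh k \<inter> sh k' = {}"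
      using padic_cell_unique[of _ k _ k'] that unfolding sh_def torus_def by blast
    then show ?thesis by (simp flip: image_Int[OF inj_embed_vec])
  qed
  define U where "U = (\<Union>k. sh k)"
  have U_meas: "padic_measurable U"
    unfolding U_def by (intro padic_measurable_UN sh_meas) simp
  \<comment> \<open>An integral point outside all shells has a zero coordinate, and the set where a
    given coordinate is zero lies in boxes of volume q^N for every N.\<close>
  have null: "AE x in \<mu>. x \<in> embed_vec ` U \<longleftrightarrow> x \<in> Zp_vec"
  proof -
    let ?N = "\<lambda>i. {u :: 'p padic_int ^ 'n. u $ i = 0}"
    have box: "padic_box 0 (\<lambda>j. if j = i then N else 0) = {u :: 'p padic_int ^ 'n. uniformizer ^ N dvd u $ i - 0}" for i :: 'n and N
      by (auto simp: padic_box_def split: if_splits)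
    have N_eq: "?N i = (\<Inter>N. {u. uniformizer ^ N dvd u $ i - 0})" for i
    proof (intro equalityI subsetI)
      fix u :: "'p padic_int ^ 'n" assume u: "u \<in> (\<Inter>N. {u. uniformizer ^ N dvd u $ i - 0})"
      have "u $ i = 0"
      proof (rule padic_int_eqI)
        fix N show "Rep_padic_int (u $ i) N = Rep_padic_int 0 N"
          using u uniformizer_power_dvd_iff[of N "u $ i"] by simp
      qed
      then show "u \<in> ?N i" by simp
    qed simp
    have N_meas: "padic_measurable (?N i)" for i
    proof -
      have "embed_vec ` ?N i = (\<Inter>N. embed_vec ` {u. uniformizer ^ N dvd u $ i - 0})"
        unfolding N_eq by (rule image_INT[OF inj_embed_vec]) auto
      also have "\<dots> \<in> sets borel"
        using padic_measurable_dvd_coordinate[unfolded padic_measurable_def]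
        by (intro sets.countable_INT) blast+
      finally show ?thesis by (simp add: padic_measurable_def)
    qed
    have "embed_vec ` ?N i \<in> null_sets \<mu>" for i
    proof -
      have le: "vol (?N i) \<le> q ^ N" for N
      proof -
        have "vol (?N i) \<le> vol (padic_box 0 (\<lambda>j. if j = i then N else 0))"
        proof (rule measure_mono_fmeasurable)
          show "embed_vec ` ?N i \<subseteq> embed_vec ` padic_box 0 (\<lambda>j. if j = i then N else 0)"
            unfolding box by (intro image_mono) auto
          show "embed_vec ` ?N i \<in> sets \<mu>" using N_meas by (simp add: padic_measurable_def sets_haar)
          show "embed_vec ` padic_box 0 (\<lambda>j. if j = i then N else 0) \<in> fmeasurable \<mu>"
            using emeasure_finite[OF padic_measurable_box] padic_measurable_box
            by (intro fmeasurableI) (auto simp: padic_measurable_def sets_haar)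
        qed
        then show ?thesis by (simp add: vol_box q_def)
      qed
      have "(\<lambda>N. q ^ N) \<longlonglongrightarrow> 0" using q by (intro LIMSEQ_realpow_zero) auto
      then have "vol (?N i) \<le> 0" by (rule LIMSEQ_le_const) (use le in blast)
      then have "vol (?N i) = 0" by (simp add: antisym)
      then have "emeasure \<mu> (embed_vec ` ?N i) = 0"
        using emeasure_finite[OF N_meas[of i]] by (auto simp: measure_def enn2real_eq_0_iff)
      then show ?thesis using N_meas by (auto simp: padic_measurable_def sets_haar null_sets_def)
    qed
    then have "(\<Union>i. embed_vec ` ?N i) \<in> null_sets \<mu>" by (intro null_sets_UN') (auto simp: countable_finite)
    then have "AE x in \<mu>. x \<notin> (\<Union>i. embed_vec ` ?N i)" by (rule AE_not_in)
    then show ?thesis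
    proof eventually_elim
      case (elim x)
      show ?case
      proof
        assume "x \<in> Zp_vec"
        then obtain u where u: "x = embed_vec u" using range_embed_vec by blast
        then have "u $ i \<noteq> 0" for i using elim by blast
        then obtain k and a :: "'p mod_ring ^ 'n" where "\<forall>i. a $ i \<noteq> 0" "u \<in> padic_cell k a"
          using ex_padic_cell by blast
        then have "u \<in> U" unfolding U_def sh_def torus_def by blast
        then show "x \<in> embed_vec ` U" using u by blast
      qed (use range_embed_vec in blast)
    qed
  qed
  have bm: "set_borel_measurable \<mu> (embed_vec ` S) Z" if "padic_measurable S" for S
    using borel_measurable_integrable[OF Z_int[OF that, unfolded set_integrable_def]]
    by (simp add: set_borel_measurable_def)
  have "zeta_int \<mu> I g s = (LINT x:Zp_vec|\<mu>. Z x)"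
    unfolding zeta_int_def by (rule set_lebesgue_integral_cong) (use sets_haar sets_Zp_vec Z_Zp in auto)
  also have "\<dots> = (LINT x:embed_vec ` U|\<mu>. Z x)"
    by (rule set_integral_cong_set[OF bm[OF U_meas] _ null])
      (use bm[OF padic_measurable_UNIV] in \<open>simp add: range_embed_vec\<close>)
  also have "embed_vec ` U = (\<Union>k. embed_vec ` sh k)" unfolding U_def by blast
  also have "(LINT x:(\<Union>k. embed_vec ` sh k)|\<mu>. Z x) = (\<Sum>\<^sub>\<infinity>k. LINT x:embed_vec ` sh k|\<mu>. Z x)"
  proof (rule set_integral_countable_infsum)
    show "embed_vec ` sh k \<in> sets \<mu>" for k using sh_meas by (simp add: padic_measurable_def sets_haar)
    show "set_integrable \<mu> (\<Union>k. embed_vec ` sh k) Z"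
      using Z_int[OF U_meas] \<open>embed_vec ` U = (\<Union>k. embed_vec ` sh k)\<close> by simp
    define C where "C = real (CARD('p) ^ CARD('n)) + real (card (torus :: ('p mod_ring ^ 'n) set))"
    have "(\<lambda>k. C * norm (S_term I g s (nat_vec k))) summable_on UNIV"
      by (rule summable_on_cmult_right[OF summable])
    then have "(\<lambda>k. norm (of_real (shell_factor g k) * S_term I g s (nat_vec k))) summable_on UNIV"
      by (rule Infinite_Sum.abs_summable_on_comparison_test')
        (use shell_factor_bounded[of g] in \<open>auto simp: norm_mult C_def intro!: mult_right_mono\<close>)
    then show "(\<lambda>k. LINT x:embed_vec ` sh k|\<mu>. Z x) summable_on UNIV"
      unfolding shell by (rule abs_summable_summable)
  qed (rule sh_disj)
  finally show "zeta_int \<mu> I g s = (\<Sum>\<^sub>\<infinity>k. of_real (shell_factor g k) * S_term I g s (nat_vec k))"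
    unfolding shell .
qed


section \<open>Cone sums\<close>

locale newton_data = newton_pair "newton_ideal I" V "newton_poly g" W
  for I :: "('n::finite, 'p::prime_card padic_int) mpoly set" and g :: "('n, 'p padic_int) mpoly"
    and V W :: "(real ^ 'n) set"
begin

lemma dual_partition_eq: "dual_partition I g = dual_cell ` orthant"
  unfolding dual_partition_def by (rule dual_cell_partition)

lemma dual_cell_self: "k \<in> orthant \<Longrightarrow> k \<in> dual_cell k"
  by (simp add: dual_cell_def)

lemma dual_cell_cong: "k \<in> dual_cell k0 \<Longrightarrow> dual_cell k = dual_cell k0"
  by (simp add: dual_cell_def)

lemma cone_face_part_dual_cell:
  assumes "k0 \<in> orthant"
  shows "cone_face_part I g (dual_cell k0) = face_part g (first_meet (newton_poly g) k0)"
proof -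
  have "(THE \<tau>'. poly_face (newton_poly g) \<tau>' \<and> (\<exists>\<tau>. poly_face (newton_ideal I) \<tau> \<and>
        dual_cell k0 = dual_cone (newton_ideal I) \<tau> \<inter> dual_cone (newton_poly g) \<tau>'))
      = first_meet (newton_poly g) k0"
  proof (rule the_equality)
    show "poly_face (newton_poly g) (first_meet (newton_poly g) k0) \<and> (\<exists>\<tau>. poly_face (newton_ideal I) \<tau> \<and>
        dual_cell k0 = dual_cone (newton_ideal I) \<tau> \<inter> dual_cone (newton_poly g) (first_meet (newton_poly g) k0))"
      using A.poly_face_first_meet[OF assms] B.poly_face_first_meet[OF assms] dual_cell_eq by blast
  next
    fix \<tau>' assume "poly_face (newton_poly g) \<tau>' \<and> (\<exists>\<tau>. poly_face (newton_ideal I) \<tau> \<and>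
        dual_cell k0 = dual_cone (newton_ideal I) \<tau> \<inter> dual_cone (newton_poly g) \<tau>')"
    then have "k0 \<in> dual_cone (newton_poly g) \<tau>'" using dual_cell_self[OF assms] by blast
    then show "\<tau>' = first_meet (newton_poly g) k0" by (simp add: dual_cone_def)
  qed
  then show ?thesis by (simp add: cone_face_part_def)
qed

lemma L_cone_dual_cell: "L_cone I g (dual_cell (nat_vec k)) = shell_factor g k"
  by (simp add: L_cone_def Let_def shell_factor_def N_cone_def cone_face_part_dual_cell[OF nat_vec_orthant] torus_def)

text \<open>On a cone with vertices \<open>v\<close> and \<open>w\<close> the exponent is linear; its linear extension to the whole
  space makes the weight multiplicative everywhere.\<close>

definition linear_exponent :: "real ^ 'n \<Rightarrow> real ^ 'n \<Rightarrow> complex \<Rightarrow> real ^ 'n \<Rightarrow> complex" where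
  "linear_exponent v w s x = of_real (x \<bullet> v) * s + of_real (x \<bullet> w) + of_real (sigma x)"

text \<open>p raised to minus the linear exponent, written with \<open>exp\<close> so that it is
  visibly entire in \<open>s\<close> and nowhere zero.\<close>

definition weight :: "real ^ 'n \<Rightarrow> real ^ 'n \<Rightarrow> complex \<Rightarrow> real ^ 'n \<Rightarrow> complex" where
  "weight v w s x = exp (- (linear_exponent v w s x * of_real (ln (real CARD('p)))))"

lemma weight_add: "weight v w s (x + y) = weight v w s x * weight v w s y"
  by (simp add: weight_def linear_exponent_def inner_add_left sigma_def sum.distrib algebra_simps flip: exp_add)

lemma weight_0: "weight v w s 0 = 1"
  by (simp add: weight_def linear_exponent_def sigma_def)

lemma weight_nonzero: "weight v w s x \<noteq> 0"
  by (simp add: weight_def)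

lemma weight_diff: "weight v w s (x - y) = weight v w s x / weight v w s y"
proof -
  have "weight v w s (x - y) * weight v w s y = weight v w s x" by (simp flip: weight_add)
  then show ?thesis by (simp add: weight_nonzero field_simps)
qed

lemma weight_scale_nat: "weight v w s (real a *\<^sub>R x) = weight v w s x ^ a"
  by (induction a) (simp_all add: weight_0 weight_add scaleR_left_distrib)

lemma weight_sum: "weight v w s (\<Sum>x\<in>K. f x) = (\<Prod>x\<in>K. weight v w s (f x))"
  by (induction K rule: infinite_finite_induct) (simp_all add: weight_0 weight_add)

lemma weight_comb: "weight v w s (h + (\<Sum>x\<in>K. real (a x) *\<^sub>R x)) = weight v w s h * (\<Prod>x\<in>K. weight v w s x ^ a x)"
  by (simp add: weight_add weight_sum weight_scale_nat)

lemma norm_weight: "norm (weight v w s x) = exp (- (((x \<bullet> v) * Re s + x \<bullet> w + sigma x) * ln (real CARD('p))))"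
  by (simp add: weight_def linear_exponent_def)

lemma weight_holomorphic: "(\<lambda>s. weight v w s x) analytic_on S"
  unfolding weight_def linear_exponent_def by (intro analytic_intros)

section \<open>Sums over a single cell, with a vertex of each polyhedron fixed\<close>

context
  fixes v w :: "real ^ 'n"
  assumes vw: "v \<in> V" "w \<in> W" and pos: "v \<in> orthant" "w \<in> orthant"
begin

abbreviation "D \<equiv> halfspace_cone (facet_normals v w)"

interpretation C: integral_cone "facet_normals v w"
  by (rule integral_cone_facet_normals[OF vw])

lemma D_orthant: "x \<in> D \<Longrightarrow> x \<in> orthant"
  using halfspace_cone_facet_normals[OF vw] by blast

lemma p_exponent_linear: "x \<in> D \<Longrightarrow> p_exponent I g s x = linear_exponent v w s x"
  unfolding p_exponent_def linear_exponent_def using supp_min_linear[OF vw, of x] by simp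

lemma powr_p_exponent: "x \<in> D \<Longrightarrow> of_nat CARD('p) powr p_exponent I g s x = inverse (weight v w s x)"
  using prime_card_gt_1[where 'p='p] Ln_of_real[of "real CARD('p)"]
  by (simp add: p_exponent_linear weight_def powr_def flip: exp_minus)

lemma S_term_weight: "x \<in> D \<Longrightarrow> S_term I g s x = weight v w s x"
  unfolding S_term_def powr_minus by (simp add: powr_p_exponent)

lemma weight_exponent_pos:
  assumes "x \<in> D" "x \<noteq> 0"
  shows "0 < x \<bullet> w + sigma x"
  using C.sigma_pos[OF assms] orthant_inner_nonneg[OF D_orthant[OF assms(1)] pos(2)] by linarith

lemma norm_weight_less_1:
  assumes x: "x \<in> D" "x \<noteq> 0" and s: "Re s > 0"
  shows "norm (weight v w s x) < 1"
proof -
  have "0 \<le> (x \<bullet> v) * Re s" using orthant_inner_nonneg[OF D_orthant[OF x(1)] pos(1)] s by simp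
  then have "0 < (x \<bullet> v) * Re s + x \<bullet> w + sigma x" using weight_exponent_pos[OF x] by linarith
  moreover have "ln (real CARD('p)) > 0" using prime_card_gt_1[where 'p='p] by simp
  ultimately show ?thesis unfolding norm_weight by simp
qed

text \<open>Taking absolute values makes the real part of the exponent vanish. Since
  \<open>x \<bullet> w + sigma x\<close> is positive, the coefficient of \<open>Re z\<close> cannot
  be zero; rays with m_I(k) = 0 therefore give no poles, and on the others the equation determines
  the real part.\<close>

lemma weight_eq_1_imp:
  assumes x: "x \<in> D" "x \<noteq> 0" and eq: "weight v w z x = 1"
  shows "supp_min (newton_ideal I) x \<noteq> 0" "Re z = candidate_real_part I g x"
proof -
  have "ln (real CARD('p)) > 0" using prime_card_gt_1[where 'p='p] by simp
  then have *: "(x \<bullet> v) * Re z + x \<bullet> w + sigma x = 0"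
    using norm_weight[of v w z x] eq by simp
  show m: "supp_min (newton_ideal I) x \<noteq> 0"
    using * weight_exponent_pos[OF x] supp_min_linear[OF vw x(1)] by auto
  have "Re z = - (x \<bullet> w + sigma x) / (x \<bullet> v)"
    using * m supp_min_linear[OF vw x(1)] by (simp add: field_simps)
  then show "Re z = candidate_real_part I g x"
    using supp_min_linear[OF vw x(1)] by (simp add: candidate_real_part_def)
qed

lemma closure_rays_ray_generators:
  assumes "r \<in> C.closure_rays k0"
  shows "r \<in> ray_generators I g" "r \<in> D" "r \<noteq> 0"
proof -
  have r: "r \<in> D" "primitive_vec r" "cell (facet_normals v w) r = strict_cone {r}"
    using assms unfolding C.closure_rays_def cell_rays_def by auto
  then have "strict_cone {r} \<in> dual_partition I g"
    using dual_cell_eq_cell[OF vw r(1)] D_orthant[OF r(1)] unfolding dual_partition_eq by auto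
  then show "r \<in> ray_generators I g" "r \<in> D" "r \<noteq> 0"
    using r primitive_vec_nonzero by (auto simp: ray_generators_def)
qed

text \<open>The finite expression obtained from \<open>has_sum_generated\<close> is defined for
  every \<open>s\<close>. Its numerators are entire and its denominators are factors
  \<open>1 - weight v w s r\<close> with \<open>r\<close> a generator of a ray, so it can fail to be
  analytic only where one of these vanishes.\<close>

lemma S_cone_continuation:
  assumes k0: "k0 \<in> D"
  shows "\<exists>G. G meromorphic_on UNIV \<and> (\<forall>s. Re s > 0 \<longrightarrow> G s = S_cone I g s (dual_cell k0)) \<and>
    (\<forall>z. (\<forall>k\<in>ray_generators I g. supp_min (newton_ideal I) k \<noteq> 0 \<longrightarrow> Re z \<noteq> candidate_real_part I g k) \<longrightarrow>
      G analytic_on {z})"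
proof -
  let ?K = "C.closure_rays k0" and ?M = "{k \<in> dual_cell k0. int_vec k}"
  have fK: "finite ?K" by (rule C.finite_closure_rays)
  obtain H where H: "finite H" "H \<subseteq> ?M" "?M = {h + (\<Sum>r\<in>?K. real (a r) *\<^sub>R r) | h a. h \<in> H}"
    using C.int_vec_cell_generated[OF k0] unfolding dual_cell_eq_cell[OF vw k0] by blast
  obtain P and C :: nat where P: "finite P" "fst ` P \<subseteq> H"
    "\<And>wt :: real ^ 'n \<Rightarrow> complex. (\<forall>x\<in>?K. norm (wt x) < 1) \<Longrightarrow>
       (\<forall>h\<in>H. \<forall>a. wt (h + (\<Sum>x\<in>?K. real (a x) *\<^sub>R x)) = wt h * (\<Prod>x\<in>?K. wt x ^ a x)) \<Longrightarrow>
       (wt has_sum (\<Sum>(h, b)\<in>P. wt h * ((\<Prod>x\<in>?K. wt x ^ b x) * (\<Prod>x | x \<in> ?K \<and> b x = C. 1 / (1 - wt x))))) ?M"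
    using has_sum_generated[OF fK H(1)] unfolding H(3)[symmetric] by (elim exE conjE) blast
  define G where "G s = (\<Sum>(h, b)\<in>P. weight v w s h *
    ((\<Prod>x\<in>?K. weight v w s x ^ b x) * (\<Prod>x | x \<in> ?K \<and> b x = C. 1 / (1 - weight v w s x))))" for s
  have mero: "(\<lambda>s. weight v w s x) meromorphic_on UNIV" for x
    by (rule analytic_on_imp_meromorphic_on[OF weight_holomorphic])
  have "G meromorphic_on UNIV"
    unfolding G_def case_prod_unfold by (intro meromorphic_intros mero)
  moreover have "G s = S_cone I g s (dual_cell k0)" if s: "Re s > 0" for s
  proof -
    have "(weight v w s has_sum G s) ?M"
      unfolding G_def
    proof (rule P(3))
      show "\<forall>x\<in>?K. norm (weight v w s x) < 1"
        using closure_rays_ray_generators norm_weight_less_1 s by blast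
    qed (simp add: weight_comb)
    moreover have "?M \<subseteq> D" unfolding dual_cell_eq_cell[OF vw k0] by (auto simp: cell_def)
    ultimately have "(S_term I g s has_sum G s) ?M"
      by (subst has_sum_cong[where g = "weight v w s"]) (auto simp: S_term_weight)
    then show ?thesis unfolding S_cone_def by (simp add: infsumI)
  qed
  moreover have "G analytic_on {z}"
    if z: "\<forall>k\<in>ray_generators I g. supp_min (newton_ideal I) k \<noteq> 0 \<longrightarrow> Re z \<noteq> candidate_real_part I g k" for z
  proof -
    have nz: "1 - weight v w z x \<noteq> 0" if "x \<in> ?K" for x
      using closure_rays_ray_generators[OF that] weight_eq_1_imp[of x z] z by auto
    show ?thesis unfolding G_def case_prod_unfold
      by (intro analytic_intros weight_holomorphic) (use nz in auto)
  qed
  ultimately show ?thesis by blast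
qed

lemma nonneg_comb_D:
  assumes "finite B" "B \<subseteq> D" "\<And>x. x \<in> B \<Longrightarrow> 0 \<le> c x"
  shows "(\<Sum>x\<in>B. c x *\<^sub>R x) \<in> D"
  by (rule C.nonneg_comb_tight(1)[OF assms])

text \<open>A lattice point of the open cone is written uniquely as the sum of all generators, minus
  a box point h, plus a natural combination. The reflection of h exchanges the conditions 0 <
  \<lambda> \<le> 1 of the open cone with 0 \<le> \<lambda> < 1 of the box; it is the reason why the
  powers of p in the numerator have exponents of positive sign.\<close>

lemma simplicial_cone_sum:
  assumes B: "independent B" "B \<subseteq> D" "\<And>x. x \<in> B \<Longrightarrow> int_vec x" "\<And>x. x \<in> B \<Longrightarrow> x \<noteq> 0" and s: "Re s > 0"
  shows "(S_term I g s has_sum simplicial_term I g s B) {k \<in> strict_cone B. int_vec k}"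
proof -
  let ?w = "weight v w s"
  have fB: "finite B" using B(1) by (rule independent_imp_finite)
  have unique: "c x = d x" if "(\<Sum>x\<in>B. c x *\<^sub>R x) = (\<Sum>x\<in>B. d x *\<^sub>R x)" "x \<in> B" for c d x
  proof -
    have "(\<Sum>x\<in>B. (c x - d x) *\<^sub>R x) = 0" using that(1) by (simp add: scaleR_left_diff_distrib sum_subtractf)
    then have "c x - d x = 0" using independentD[OF B(1) fB order_refl _ that(2), of "\<lambda>x. c x - d x"] by blast
    then show ?thesis by simp
  qed
  have fin_box: "finite (box_points B)"
    by (rule finite_subset[OF _ finite_int_vec_bounded_comb[of B]])
      (auto simp: box_points_def dest: less_imp_le)
  define pt where "pt h a = ((\<Sum>x\<in>B. x) - h) + (\<Sum>x\<in>B. real (a x) *\<^sub>R x)" for h and a :: "real ^ 'n \<Rightarrow> nat"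
  have pt_comb: "pt h a = (\<Sum>x\<in>B. (1 + real (a x) - c x) *\<^sub>R x)" if "h = (\<Sum>x\<in>B. c x *\<^sub>R x)" for h a c
    by (simp add: pt_def that scaleR_left_distrib scaleR_left_diff_distrib sum.distrib sum_subtractf)
  have pt_inj: "h = h' \<and> a = a'"
    if h: "h \<in> box_points B" "h' \<in> box_points B" and a: "a \<in> exponents_on B" "a' \<in> exponents_on B"
      and eq: "pt h a = pt h' a'" for h h' a a'
  proof -
    obtain c where c: "\<forall>x\<in>B. 0 \<le> c x \<and> c x < 1" "h = (\<Sum>x\<in>B. c x *\<^sub>R x)"
      using h(1) unfolding box_points_def by blast
    obtain d where d: "\<forall>x\<in>B. 0 \<le> d x \<and> d x < 1" "h' = (\<Sum>x\<in>B. d x *\<^sub>R x)"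
      using h(2) unfolding box_points_def by blast
    have e: "1 + real (a x) - c x = 1 + real (a' x) - d x" if "x \<in> B" for x
      using unique[OF eq[unfolded pt_comb[OF c(2)] pt_comb[OF d(2)]] that] .
    have ax: "a x = a' x" if "x \<in> B" for x
    proof -
      have "0 \<le> c x" "c x < 1" "0 \<le> d x" "d x < 1" using c(1) d(1) that by auto
      then have "real (a x) < real (a' x) + 1" "real (a' x) < real (a x) + 1" using e[OF that] by linarith+
      then show ?thesis by linarith
    qed
    then have "a = a'" using a by (auto simp: exponents_on_def fun_eq_iff) (metis)
    then show ?thesis using eq by (simp add: pt_def)
  qed
  have UN: "{k \<in> strict_cone B. int_vec k} = (\<Union>h\<in>box_points B. pt h ` exponents_on B)"
  proof (intro equalityI subsetI)
    fix k assume "k \<in> {k \<in> strict_cone B. int_vec k}"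
    then obtain l where l: "int_vec k" "\<forall>x\<in>B. 0 < l x" "k = (\<Sum>x\<in>B. l x *\<^sub>R x)"
      unfolding strict_cone_def by blast
    \<comment> \<open>With this rounding \<open>l x - a x\<close> lies in (0, 1], hence
      \<open>c x\<close> lies in [0, 1).\<close>
    define a where "a x = (if x \<in> B then nat \<lceil>l x\<rceil> - 1 else 0)" for x
    define c where "c x = 1 + real (a x) - l x" for x
    have c: "0 \<le> c x \<and> c x < 1" if "x \<in> B" for x
    proof -
      have "0 < l x" using l(2) that by blast
      moreover have "a x = nat \<lceil>l x\<rceil> - 1" using that by (simp add: a_def)
      ultimately show ?thesis unfolding c_def by linarith
    qed
    define h where "h = (\<Sum>x\<in>B. c x *\<^sub>R x)"
    have "k = pt h a" unfolding pt_comb[OF h_def] l(3) by (simp add: c_def)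
    then have "h = (\<Sum>x\<in>B. x) + (\<Sum>x\<in>B. real (a x) *\<^sub>R x) - k" by (simp add: pt_def)
    then have "int_vec h"
      by (simp add: int_vec_diff int_vec_add int_vec_sum int_vec_scale_nat B(3) l(1))
    then have "h \<in> box_points B" unfolding box_points_def h_def using c by blast
    moreover have "a \<in> exponents_on B" by (simp add: exponents_on_def a_def)
    ultimately show "k \<in> (\<Union>h\<in>box_points B. pt h ` exponents_on B)" using \<open>k = pt h a\<close> by blast
  next
    fix k assume "k \<in> (\<Union>h\<in>box_points B. pt h ` exponents_on B)"
    then obtain h a where h: "h \<in> box_points B" "k = pt h a" by blast
    then obtain c where c: "int_vec h" "\<forall>x\<in>B. 0 \<le> c x \<and> c x < 1" "h = (\<Sum>x\<in>B. c x *\<^sub>R x)"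
      unfolding box_points_def by blast
    have pos: "\<forall>x\<in>B. 0 < 1 + real (a x) - c x" using c(2) by (auto intro: add_pos_nonneg)
    have "k \<in> strict_cone B" unfolding h(2) pt_comb[OF c(3)] strict_cone_def
      by (intro CollectI exI[of _ "\<lambda>x. 1 + real (a x) - c x"] conjI refl pos)
    moreover have "int_vec k" unfolding h(2) pt_def
      by (intro int_vec_add int_vec_diff int_vec_sum int_vec_scale_nat B(3) c(1))
    ultimately show "k \<in> {k \<in> strict_cone B. int_vec k}" by simp
  qed
  have w1: "norm (?w x) < 1" if "x \<in> B" for x
    using norm_weight_less_1 B(2,4) s that by blast
  let ?v = "\<lambda>h. (\<Prod>x\<in>B. ?w x) / ?w h * (\<Prod>x\<in>B. 1 / (1 - ?w x))"
  have "(?w has_sum (\<Sum>h\<in>box_points B. ?v h)) (\<Union>h\<in>box_points B. pt h ` exponents_on B)"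
  proof (rule sum_has_sum[OF fin_box])
    fix h assume h: "h \<in> box_points B"
    have "((\<lambda>a. (\<Prod>x\<in>B. ?w x) / ?w h * (\<Prod>x\<in>B. ?w x ^ a x)) has_sum ?v h) (exponents_on B)"
      by (intro has_sum_cmult_right has_sum_monomials(1) fB w1)
    moreover have "?w (pt h a) = (\<Prod>x\<in>B. ?w x) / ?w h * (\<Prod>x\<in>B. ?w x ^ a x)" for a
      by (simp add: pt_def weight_comb weight_diff weight_sum)
    ultimately show "(?w has_sum ?v h) (pt h ` exponents_on B)"
      by (subst has_sum_reindex) (use pt_inj[OF h h] in \<open>auto simp: inj_on_def o_def\<close>)
  next
    fix h h' assume "h \<in> box_points B" "h' \<in> box_points B" "h \<noteq> h'"
    then show "pt h ` exponents_on B \<inter> pt h' ` exponents_on B = {}" using pt_inj by blast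
  qed
  moreover have "(\<Sum>h\<in>box_points B. ?v h) = simplicial_term I g s B"
  proof -
    have box_D: "h \<in> D" if "h \<in> box_points B" for h
      using that nonneg_comb_D[OF fB B(2)] unfolding box_points_def by blast
    \<comment> \<open>Each factor w/(1 - w) equals 1/(1/w - 1), and 1/w is the power of p with the
      positive exponent.\<close>
    have "(\<Prod>x\<in>B. ?w x) * (\<Prod>x\<in>B. 1 / (1 - ?w x)) = (\<Prod>x\<in>B. 1 / (inverse (?w x) - 1))"
      unfolding prod.distrib[symmetric]
    proof (rule prod.cong[OF refl])
      fix x assume "x \<in> B"
      then have "1 - ?w x \<noteq> 0" using w1[of x] by auto
      moreover have "inverse (?w x) - 1 = (1 - ?w x) / ?w x" using weight_nonzero[of v w s x] by (simp add: field_simps)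
      ultimately show "?w x * (1 / (1 - ?w x)) = 1 / (inverse (?w x) - 1)" by simp
    qed
    also have "\<dots> = 1 / (\<Prod>x\<in>B. of_nat CARD('p) powr p_exponent I g s x - 1)"
      using B(2) by (simp add: prod_dividef powr_p_exponent subset_iff)
    finally have *: "(\<Prod>x\<in>B. ?w x) * (\<Prod>x\<in>B. 1 / (1 - ?w x)) = 1 / (\<Prod>x\<in>B. of_nat CARD('p) powr p_exponent I g s x - 1)" .
    have "(\<Sum>h\<in>box_points B. ?v h) = (\<Sum>h\<in>box_points B. inverse (?w h)) * ((\<Prod>x\<in>B. ?w x) * (\<Prod>x\<in>B. 1 / (1 - ?w x)))"
      unfolding sum_distrib_right by (rule sum.cong[OF refl]) (simp only: divide_inverse ac_simps)
    also have "(\<Sum>h\<in>box_points B. inverse (?w h)) = (\<Sum>h\<in>box_points B. of_nat CARD('p) powr p_exponent I g s h)"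
      by (rule sum.cong) (simp_all add: powr_p_exponent box_D)
    finally show ?thesis unfolding * simplicial_term_def by simp
  qed
  ultimately have "(?w has_sum simplicial_term I g s B) {k \<in> strict_cone B. int_vec k}" unfolding UN by simp
  moreover have "{k \<in> strict_cone B. int_vec k} \<subseteq> D"
    using nonneg_comb_D[OF fB B(2)] by (auto simp: strict_cone_def less_imp_le)
  ultimately show ?thesis
    by (subst has_sum_cong[where g = ?w]) (auto simp: S_term_weight)
qed

lemma S_cone_simplicial:
  assumes k0: "k0 \<in> D" and P: "simplicial_partition (dual_cell k0) \<B>" and s: "Re s > 0"
  shows "S_cone I g s (dual_cell k0) = (\<Sum>B\<in>\<B>. simplicial_term I g s B)"
proof -
  have P': "finite \<B>" "\<And>B. B \<in> \<B> \<Longrightarrow> B \<subseteq> cone_generators (dual_cell k0) \<and> independent B"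
    "\<And>B C. B \<in> \<B> \<Longrightarrow> C \<in> \<B> \<Longrightarrow> B \<noteq> C \<Longrightarrow> strict_cone B \<inter> strict_cone C = {}"
    "(\<Union>B\<in>\<B>. strict_cone B) = dual_cell k0"
    using P unfolding simplicial_partition_def by simp_all
  have "(S_term I g s has_sum (\<Sum>B\<in>\<B>. simplicial_term I g s B)) (\<Union>B\<in>\<B>. {k \<in> strict_cone B. int_vec k})"
  proof (rule sum_has_sum)
    fix B assume B: "B \<in> \<B>"
    then have Bg: "B \<subseteq> cone_generators (dual_cell k0)" "independent B" using P'(2) by blast+
    have "cone_generators (dual_cell k0) \<subseteq> closure (dual_cell k0)"
      by (auto simp: cone_generators_def poly_face_def)
    then have "B \<subseteq> D" using Bg(1) closure_dual_cell[OF vw k0] by blast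
    moreover have "primitive_vec x" if "x \<in> B" for x using that Bg(1) by (auto simp: cone_generators_def)
    ultimately show "(S_term I g s has_sum simplicial_term I g s B) {k \<in> strict_cone B. int_vec k}"
      by (intro simplicial_cone_sum Bg(2) s) (auto dest: primitive_vec_int_vec primitive_vec_nonzero)
  next
    fix B C assume "B \<in> \<B>" "C \<in> \<B>" "B \<noteq> C"
    then have "strict_cone B \<inter> strict_cone C = {}" by (rule P'(3))
    then show "{k \<in> strict_cone B. int_vec k} \<inter> {k \<in> strict_cone C. int_vec k} = {}" by blast
  qed (rule P'(1))
  moreover have "(\<Union>B\<in>\<B>. {k \<in> strict_cone B. int_vec k}) = {k \<in> dual_cell k0. int_vec k}"
    unfolding P'(4)[symmetric] by blast
  ultimately show ?thesis unfolding S_cone_def by (simp add: infsumI)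
qed

end

lemma nat_vec_bij: "bij_betw nat_vec UNIV {k :: real ^ 'n \<in> orthant. int_vec k}"
proof (rule bij_betwI[where g = "\<lambda>(k :: real ^ 'n) i. nat \<lfloor>k $ i\<rfloor>"])
  show "nat_vec \<in> UNIV \<rightarrow> {k :: real ^ 'n \<in> orthant. int_vec k}"
    by (auto simp: nat_vec_orthant) (simp add: nat_vec_def int_vec_def)
  show "nat_vec (\<lambda>i. nat \<lfloor>k $ i\<rfloor>) = k" if k: "k \<in> {k :: real ^ 'n \<in> orthant. int_vec k}" for k
  proof -
    have "real (nat \<lfloor>k $ i\<rfloor>) = k $ i" for i
    proof -
      have "k $ i \<in> \<int>" "0 \<le> k $ i" using k by (auto simp: int_vec_def orthant_def)
      then show ?thesis by (elim Ints_cases) simp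
    qed
    then show ?thesis by (simp add: nat_vec_def vec_eq_iff)
  qed
qed (auto simp: nat_vec_def)

text \<open>The factor \<open>L_cone\<close> depends only on the cell, and the lattice points of the
  orthant are distributed over finitely many cells, so the series can be regrouped cell by
  cell.\<close>

lemma zeta_sum_by_cells:
  assumes sm: "(\<lambda>k. norm (S_term I g s (nat_vec k))) summable_on UNIV"
  shows "\<And>\<delta>. \<delta> \<in> dual_partition I g \<Longrightarrow> S_term I g s summable_on {k\<in>\<delta>. int_vec k}"
    and "(\<Sum>\<^sub>\<infinity>k. of_real (shell_factor g k) * S_term I g s (nat_vec k)) =
      (\<Sum>\<delta>\<in>dual_partition I g. of_real (L_cone I g \<delta>) * S_cone I g s \<delta>)"
proof -
  let ?O = "{k :: real ^ 'n \<in> orthant. int_vec k}"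
  have "(\<lambda>k. S_term I g s (nat_vec k)) summable_on UNIV" using sm by (rule abs_summable_summable)
  then have sO: "S_term I g s summable_on ?O"
    using summable_on_reindex_bij_betw[OF nat_vec_bij] by blast
  show sm_\<delta>: "S_term I g s summable_on {k\<in>\<delta>. int_vec k}" if "\<delta> \<in> dual_partition I g" for \<delta>
    by (rule summable_on_subset[OF sO]) (use that in \<open>auto simp: dual_partition_eq dual_cell_def\<close>)
  define \<Phi> where "\<Phi> k = of_real (L_cone I g (dual_cell k)) * S_term I g s k" for k
  have "(\<Phi> has_sum (\<Sum>\<delta>\<in>dual_partition I g. of_real (L_cone I g \<delta>) * S_cone I g s \<delta>))
      (\<Union>\<delta>\<in>dual_partition I g. {k\<in>\<delta>. int_vec k})"
  proof (rule sum_has_sum)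
    show "finite (dual_partition I g)" unfolding dual_partition_eq by (rule finite_dual_cells)
  next
    fix \<delta> assume \<delta>: "\<delta> \<in> dual_partition I g"
    then obtain k0 where k0: "\<delta> = dual_cell k0" unfolding dual_partition_eq by blast
    have "((\<lambda>k. of_real (L_cone I g \<delta>) * S_term I g s k) has_sum (of_real (L_cone I g \<delta>) * S_cone I g s \<delta>))
        {k\<in>\<delta>. int_vec k}"
      unfolding S_cone_def by (intro has_sum_cmult_right has_sum_infsum sm_\<delta>[OF \<delta>])
    then show "(\<Phi> has_sum (of_real (L_cone I g \<delta>) * S_cone I g s \<delta>)) {k\<in>\<delta>. int_vec k}"
      by (subst has_sum_cong[where g = "\<lambda>k. of_real (L_cone I g \<delta>) * S_term I g s k"])
        (auto simp: \<Phi>_def k0 dest: dual_cell_cong)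
  next
    fix \<delta> \<delta>' assume "\<delta> \<in> dual_partition I g" "\<delta>' \<in> dual_partition I g" "\<delta> \<noteq> \<delta>'"
    then show "{k\<in>\<delta>. int_vec k} \<inter> {k\<in>\<delta>'. int_vec k} = {}"
      unfolding dual_partition_eq using dual_cell_cong by blast
  qed
  moreover have "(\<Union>\<delta>\<in>dual_partition I g. {k\<in>\<delta>. int_vec k}) = ?O"
    unfolding dual_partition_eq using dual_cell_self by (auto simp: dual_cell_def)
  ultimately have "((\<lambda>k. \<Phi> (nat_vec k)) has_sum (\<Sum>\<delta>\<in>dual_partition I g. of_real (L_cone I g \<delta>) * S_cone I g s \<delta>)) UNIV"
    unfolding has_sum_reindex_bij_betw[OF nat_vec_bij, of \<Phi>] by simp
  then show "(\<Sum>\<^sub>\<infinity>k. of_real (shell_factor g k) * S_term I g s (nat_vec k)) =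
      (\<Sum>\<delta>\<in>dual_partition I g. of_real (L_cone I g \<delta>) * S_cone I g s \<delta>)"
    by (simp add: \<Phi>_def L_cone_dual_cell infsumI)
qed

lemma candidate_rational:
  assumes "k \<in> ray_generators I g"
  shows "candidate_real_part I g k \<in> \<rat>"
proof -
  have k: "primitive_vec k" "strict_cone {k} \<in> dual_partition I g" using assms by (auto simp: ray_generators_def)
  have "k \<in> strict_cone {k}" unfolding strict_cone_single by (auto intro: exI[of _ 1])
  then have ko: "k \<in> orthant" using k(2) unfolding dual_partition_eq by (auto simp: dual_cell_def)
  obtain v w where vw: "v \<in> V" "w \<in> W" "k \<in> halfspace_cone (facet_normals v w)"
    using ex_facet_normals[OF ko] by blast
  have ik: "int_vec k" by (rule primitive_vec_int_vec[OF k(1)])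
  have "k \<bullet> v \<in> \<int>" "k \<bullet> w \<in> \<int>" using int_vec_inner[OF ik] A.int_V[OF vw(1)] B.int_V[OF vw(2)] by auto
  moreover have "sigma k \<in> \<int>" using ik by (auto simp: sigma_def int_vec_def intro!: Ints_sum)
  ultimately show ?thesis
    unfolding candidate_real_part_def supp_min_linear[OF vw]
    by (intro Rats_divide Rats_minus_iff[THEN iffD2] Rats_add) (auto simp: Ints_subset_Rats[THEN subsetD])
qed

end

section \<open>Uniqueness of the continuation, and the theorem\<close>

text \<open>The identity theorem: the difference either vanishes or is nonzero off a sparse set, and
  the latter contradicts the agreement near 1. Only a punctured neighbourhood is claimed, because
  values at isolated points are arbitrary for meromorphic functions.\<close>

lemma meromorphic_extension_eventually_eq:
  assumes F: "F meromorphic_on UNIV" and G: "G meromorphic_on UNIV"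
    and eq: "\<And>s. Re s > 0 \<Longrightarrow> F s = G s"
  shows "eventually (\<lambda>s. F s = G s) (at z)"
proof -
  have "(\<lambda>s. F s - G s) meromorphic_on UNIV" by (intro meromorphic_intros F G)
  then consider "eventually (\<lambda>s. F s - G s = 0) (cosparse UNIV)" | "eventually (\<lambda>s. F s - G s \<noteq> 0) (cosparse UNIV)"
    using meromorphic_imp_constant_or_avoid[of "\<lambda>s. F s - G s" UNIV 0] by auto
  then show ?thesis
  proof cases
    case 1
    then show ?thesis by (simp add: eventually_cosparse_open_eq)
  next
    case 2
    then have "eventually (\<lambda>s. F s - G s \<noteq> 0) (at 1)" by (simp add: eventually_cosparse_open_eq)
    moreover have "eventually (\<lambda>s. s \<in> {s. Re s > 0}) (at 1)"
      by (rule eventually_at_in_open') (auto simp: open_halfspace_Re_gt)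
    ultimately have "eventually (\<lambda>s. False) (at (1 :: complex))"
      by eventually_elim (use eq in auto)
    then show ?thesis by simp
  qed
qed

theorem theorem2p5:
  fixes \<mu> :: "('p::prime_card padic ^ 'n::finite) measure"
    and I :: "('n, 'p padic_int) mpoly set"
    and g :: "('n, 'p padic_int) mpoly"
  assumes haar: "normalized_haar \<mu>"
    and ideal: "monomial_ideal I" "I \<noteq> {0}" "I \<noteq> UNIV"
    and g: "g \<noteq> 0" "mpoly_eval 0 g = 0" "nondegenerate g"
  shows
    \<comment> \<open>the integral, the series and the sum over the cones are well defined\<close>
    "finite (dual_partition I g) \<and>
     (\<forall>s. Re s > 0 \<longrightarrow> set_integrable \<mu> Zp_vec (zeta_integrand I g s)) \<and>
     (\<forall>s. Re s > 0 \<longrightarrow> (\<forall>\<delta>\<in>dual_partition I g. S_term I g s summable_on {k\<in>\<delta>. int_vec k})) \<and>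
     \<comment> \<open>the formula for the zeta function and for the series\<close>
     (\<forall>s. Re s > 0 \<longrightarrow>
        zeta_int \<mu> I g s = (\<Sum>\<delta>\<in>dual_partition I g. of_real (L_cone I g \<delta>) * S_cone I g s \<delta>)) \<and>
     (\<forall>s. Re s > 0 \<longrightarrow> (\<forall>\<delta>\<in>dual_partition I g. \<forall>\<B>. simplicial_partition \<delta> \<B> \<longrightarrow>
        S_cone I g s \<delta> = (\<Sum>B\<in>\<B>. simplicial_term I g s B))) \<and>
     \<comment> \<open>the meromorphic continuation and the real parts of its poles\<close>
     (\<exists>F. F meromorphic_on UNIV \<and> (\<forall>s. Re s > 0 \<longrightarrow> F s = zeta_int \<mu> I g s)) \<and>
     (\<forall>F z. F meromorphic_on UNIV \<and> (\<forall>s. Re s > 0 \<longrightarrow> F s = zeta_int \<mu> I g s) \<and> is_pole F z \<longrightarrow>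
        (\<exists>k\<in>ray_generators I g. supp_min (newton_ideal I) k \<noteq> 0 \<and> Re z = candidate_real_part I g k)) \<and>
     (\<forall>k\<in>ray_generators I g. supp_min (newton_ideal I) k \<noteq> 0 \<longrightarrow> candidate_real_part I g k \<in> \<rat>)"
proof -
  obtain E where E: "newton_polyhedron (newton_ideal I) (expvec ` E)"
    using newton_polyhedron_ideal[OF ideal(1,2)] by blast
  interpret A: newton_polyhedron "newton_ideal I" "expvec ` E" by (rule E)
  interpret B: newton_polyhedron "newton_poly g" "expvec ` Poly_Mapping.keys g"
    by (rule newton_polyhedron_poly[OF g(1)])
  interpret newton_data I g "expvec ` E" "expvec ` Poly_Mapping.keys g" by unfold_locales
  note zeta = zeta_int_eq_infsum[OF haar ideal(1,2) g(1,3)]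
  have orth: "v \<in> orthant" if "v \<in> expvec ` E \<or> v \<in> expvec ` Poly_Mapping.keys g" for v :: "real ^ 'n"
    using that expvec_orthant by blast
  \<comment> \<open>Every member of the partition lies in a cone where a pair of vertices is
    minimal, so the results for fixed \<open>v\<close> and \<open>w\<close> apply to it.\<close>
  have cell: "\<exists>v\<in>expvec ` E. \<exists>w\<in>expvec ` Poly_Mapping.keys g. \<exists>k0\<in>halfspace_cone (facet_normals v w). \<delta> = dual_cell k0"
    if "\<delta> \<in> dual_partition I g" for \<delta>
    using that ex_facet_normals unfolding dual_partition_eq by blast
  have formula: "zeta_int \<mu> I g s = (\<Sum>\<delta>\<in>dual_partition I g. of_real (L_cone I g \<delta>) * S_cone I g s \<delta>)"
    if s: "Re s > 0" for s
    using zeta(2)[OF s] zeta_sum_by_cells(2)[OF zeta(3)[OF s]] by simp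
  have "\<forall>\<delta>\<in>dual_partition I g. \<exists>G. G meromorphic_on UNIV \<and> (\<forall>s. Re s > 0 \<longrightarrow> G s = S_cone I g s \<delta>) \<and>
    (\<forall>z. (\<forall>k\<in>ray_generators I g. supp_min (newton_ideal I) k \<noteq> 0 \<longrightarrow> Re z \<noteq> candidate_real_part I g k) \<longrightarrow>
      G analytic_on {z})"
  proof
    fix \<delta> assume "\<delta> \<in> dual_partition I g"
    then obtain v w k0 where *: "v \<in> expvec ` E" "w \<in> expvec ` Poly_Mapping.keys g"
      "k0 \<in> halfspace_cone (facet_normals v w)" "\<delta> = dual_cell k0" using cell by blast
    show "\<exists>G. G meromorphic_on UNIV \<and> (\<forall>s. Re s > 0 \<longrightarrow> G s = S_cone I g s \<delta>) \<and>
      (\<forall>z. (\<forall>k\<in>ray_generators I g. supp_min (newton_ideal I) k \<noteq> 0 \<longrightarrow> Re z \<noteq> candidate_real_part I g k) \<longrightarrow>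
        G analytic_on {z})"
      unfolding *(4) by (rule S_cone_continuation[OF *(1,2) orth orth *(3)]) (use * in blast)+
  qed
  from bchoice[OF this] obtain G where G: "\<forall>\<delta>\<in>dual_partition I g. G \<delta> meromorphic_on UNIV \<and>
    (\<forall>s. Re s > 0 \<longrightarrow> G \<delta> s = S_cone I g s \<delta>) \<and>
    (\<forall>z. (\<forall>k\<in>ray_generators I g. supp_min (newton_ideal I) k \<noteq> 0 \<longrightarrow> Re z \<noteq> candidate_real_part I g k) \<longrightarrow>
      G \<delta> analytic_on {z})" by (rule exE)
  define F0 where "F0 s = (\<Sum>\<delta>\<in>dual_partition I g. of_real (L_cone I g \<delta>) * G \<delta> s)" for s
  have F0_mero: "F0 meromorphic_on UNIV"
    unfolding F0_def using G by (intro meromorphic_intros) auto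
  have F0_eq: "F0 s = zeta_int \<mu> I g s" if s: "Re s > 0" for s
    unfolding F0_def formula[OF s] using G s by (intro sum.cong) auto
  \<comment> \<open>A pole depends only on a punctured neighbourhood, so an arbitrary continuation
    has the same poles as the explicit one, \<open>F0\<close>.\<close>
  have poles: "\<exists>k\<in>ray_generators I g. supp_min (newton_ideal I) k \<noteq> 0 \<and> Re z = candidate_real_part I g k"
    if F: "F meromorphic_on UNIV" "\<forall>s. Re s > 0 \<longrightarrow> F s = zeta_int \<mu> I g s" "is_pole F z" for F z
  proof (rule ccontr)
    assume no: "\<not> ?thesis"
    have "F0 analytic_on {z}"
      unfolding F0_def using G no by (intro analytic_intros) auto
    then have "\<not> is_pole F0 z"
      using analytic_at not_is_pole_holomorphic by metis
    moreover have "eventually (\<lambda>s. F s = F0 s) (at z)"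
      by (rule meromorphic_extension_eventually_eq[OF F(1) F0_mero]) (use F(2) F0_eq in auto)
    ultimately show False using F(3) is_pole_cong[OF _ refl] by blast
  qed
  have simplicial: "S_cone I g s \<delta> = (\<Sum>B\<in>\<B>. simplicial_term I g s B)"
    if s: "Re s > 0" and \<delta>: "\<delta> \<in> dual_partition I g" and P: "simplicial_partition \<delta> \<B>" for s \<delta> \<B>
  proof -
    obtain v w k0 where *: "v \<in> expvec ` E" "w \<in> expvec ` Poly_Mapping.keys g"
      "k0 \<in> halfspace_cone (facet_normals v w)" "\<delta> = dual_cell k0" using cell[OF \<delta>] by blast
    show ?thesis using P s unfolding *(4)
      by (intro S_cone_simplicial[OF *(1,2) orth orth *(3)]) (use * in blast)+
  qed
  have fin: "finite (dual_partition I g)" unfolding dual_partition_eq by (rule finite_dual_cells)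
  show ?thesis
    using fin zeta(1) zeta_sum_by_cells(1)[OF zeta(3)] formula simplicial F0_mero F0_eq poles candidate_rational
    by blast
qed

end
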